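(* Let $0<p<1$, $q=1-p$, and let $\xi_1,\xi_2,\dots$ be i.i.d. with $P(\xi_i=1)=p=1-P(\xi_i=0)$. Let $U^{(n)}$ be the longest length of arithmetic progressions relative to $\xi_1,\dots,\xi_n$ (defined in the context), and put $C=-2/\ln p$, $D=1/\ln p$, and, for integers $1<r\le n$, $$\lambda_{n,r}=\frac{n^2p^r(p+qr)}{2r(r-1)}.$$ Then the following hold. (1) As $n\to\infty$, $$\max_{1<r\le n}\left|P(U^{(n)}<r)-e^{-\lambda_{n,r}}\right|\le O\!\left(\frac{\ln^4 n\,\ln\ln n}{n}\right),$$ the maximum being over integers $r$. (2) Let $h_n=C\ln n+D\ln\ln n$. For any real $a<1$, as $n\to\infty$, $$\max_{x\ge aD\ln\ln n,\ h_n+x\in\mathbb Z}\left|\exp\!\left(\frac{-q\ln p}{4}\,p^{x}\right)P(U^{(n)}<h_n+x)-1\right|\le O\!\left(\frac{\ln\ln n}{\ln^{1-a}n}\right),$$ the maximum being over real $x$ with $x\ge aD\ln\ln n$ and $h_n+x\in\mathbb Z$. (3) As $n\to\infty$, $$\frac{U^{(n)}-C\ln n}{\ln\ln n}\to D\quad\text{in probability}.$$ (4) Almost surely, $$D=\liminf_{n\to\infty}\frac{U^{(n)}-C\ln n}{\ln\ln n}<\limsup_{n\to\infty}\frac{U^{(n)}-C\ln n}{\ln\ln n}=0,$$ $$\lim_{n\to\infty}\frac{1}{n\ln n}\left(\sum_{k=1}^n U^{(2^k)}+\frac{\ln 2}{\ln p}\,n^2\right)=D,$$ and $$\lim_{n\to\infty}\frac{1}{\ln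 n\,\ln\ln n}\left(\sum_{k=1}^n\frac{U^{(k)}}{k}+D\ln^2 n\right)=D.$$
   Context: For integers $1\le a,s\le n$, let $$U^{(n)}_{a,s}=\max\{1\le m\le 1+[\tfrac{n-a}{s}]:\ \xi_a=1,\ \xi_{a+s}=1,\dots,\xi_{a+(m-1)s}=1\},$$ with $U^{(n)}_{a,s}=0$ if $\xi_a=0$, where $[x]$ is the integer part of $x$; let $U^{(n)}=\max_{1\le a,s\le n}U^{(n)}_{a,s}$. Thus $U^{(n)}$ is the length of the longest arithmetic progression contained in $\{1\le i\le n:\xi_i=1\}$. All $U^{(n)}$, $n\ge1$, are built from the same infinite sequence $(\xi_i)$. $\ln$ is the natural logarithm, and $\ln^k n=(\ln n)^k$. A statement $f_n\le O(g_n)$ means that there is a constant $K$, not depending on $n$ (but possibly depending on $p$ and, in (2), on $a$), with $f_n\le K g_n$ for all sufficiently large $n$. *)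

theory Defs
  imports "HOL-Probability.Probability"
begin

text \<open>
  The $0$-$1$ sequence \<open>x\<close> is indexed from 1; the value at index 0 is never used when
  \<open>1 \<le> a\<close>.  Testing \<open>x a = 1\<close> rather than \<open>x a = 0\<close> makes no difference for a sequence with
  values in \<open>{0, 1}\<close>, and keeps \<open>Max\<close> away from the empty set for other sequences.
  The subtraction \<open>n - a\<close> is only relevant for \<open>a \<le> n\<close>.
\<close>
definition ap_run :: "(nat \<Rightarrow> real) \<Rightarrow> nat \<Rightarrow> nat \<Rightarrow> nat \<Rightarrow> nat" where
  "ap_run x n a s =
    (if x a = 1
     then Max {m. 1 \<le> m \<and> m \<le> 1 + (n - a) div s \<and> (\<forall>j<m. x (a + j * s) = 1)}
     else 0)"

text \<open>Meaningful for \<open>n \<ge> 1\<close> only; for \<open>n = 0\<close> the maximum is over the empty set.\<close>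
definition longest_ap :: "(nat \<Rightarrow> real) \<Rightarrow> nat \<Rightarrow> nat" where
  "longest_ap x n = Max {ap_run x n a s | a s. a \<in> {1..n} \<and> s \<in> {1..n}}"

definition lam :: "real \<Rightarrow> nat \<Rightarrow> nat \<Rightarrow> real" where
  "lam p n r =
    (real n)\<^sup>2 * p ^ r * (p + (1 - p) * real r) / (2 * real r * (real r - 1))"

definition tendsto_in_prob :: "'a measure \<Rightarrow> (nat \<Rightarrow> 'a \<Rightarrow> real) \<Rightarrow> real \<Rightarrow> bool" where
  "tendsto_in_prob M X c \<longleftrightarrow>
    (\<forall>\<epsilon>>0. (\<lambda>n. measure M {\<omega> \<in> space M. \<bar>X n \<omega> - c\<bar> > \<epsilon>}) \<longlonglongrightarrow> 0)"

end

theory Submission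
  imports Defs "HOL-Real_Asymp.Real_Asymp"
begin

text \<open>
  Call a progression of length \<open>r\<close> with step \<open>s\<close> in \<open>{1..n}\<close> a start if all its positions carry a one
  and the position one step before it, when it exists, does not.  Then \<open>U < r\<close> means that there is no
  start, and two starts with the same step that meet exclude each other.  The expected number of starts
  is \<open>\<lambda>\<close> up to \<open>n p\<^sup>r\<close>.  Adding the start events one at a time and comparing the conditional
  probabilities as in the proof of the local lemma gives \<open>P(U < r) = exp(-\<lambda>) (1 + error)\<close> with a
  relative error of order \<open>(1 + \<lambda>)\<^sup>2 ln\<^sup>3 n / n\<close>.  Because the error is relative, it stays small for
  \<open>\<lambda>\<close> up to a power of \<open>ln n\<close>, which yields (1) and (2).  Pairs of starts with different
  steps share at most \<open>(r + 1) / 2\<close> positions, and at most \<open>(r + 2) / 3\<close> unless one step is twice the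
  other; this makes their contribution negligible.

  The almost sure statements follow from Borel-Cantelli arguments along \<open>n = 2\<^sup>k\<close>, and along
  \<open>n = 2^(2^k)\<close> for the upper bound on the lower limit; the lower bound on the upper limit uses the
  independent blocks \<open>{2\<^sup>k<..2\<^sup>k\<^sup>+\<^sup>1}\<close>.  For the averages, the levels \<open>k\<close> at which \<open>U\<close> exceeds its
  typical value have summable expected weight, so a Kronecker argument removes them, and the remaining
  deterministic sums are evaluated with the Stolz-Cesaro theorem.
\<close>

section \<open>Avoiding sparsely dependent events\<close>

text \<open>Starts are counted instead of all-ones progressions because the latter come in clumps:
  shifting one by its step keeps r - 1 positions, so the pair sum would be of the order of the mean.
  A start costs q p^r, or p^r if nothing precedes it; there are about n^2/(2r) of the first kind and
  n^2/(2r(r-1)) of the second, and the total is \<open>lam\<close>. A pair with steps in ratio 1:2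
  can have conditional probability about p^(r/2), which is already 1/n up to logarithms when
  \<open>lam\<close> is bounded. A count of r^4 such pairs would spoil the rate, r^2 does not, so
  this ratio is separated from the others, where the exponent 2r/3 leaves a spare n^(-1/3).

  The level -2 ln n / ln p is critical: it is reached with probability of order 1/ln n, whose sum
  along n = 2^k just diverges. Hence the upper limit 0 above the typical value D, and no pointwise
  limit to be averaged. Just above D ln ln n the exceedance probabilities are not summable along
  2^k, which forces the sparser sequence for the lower limit and, for the averages, weights in place
  of a plain Borel-Cantelli argument.\<close>

locale sparse_dependency = prob_space M for M :: "'a measure" +
  fixes A :: "'i \<Rightarrow> 'a set" and I :: "'i set" and N :: "'i \<Rightarrow> 'i set" and \<delta> :: real
  assumes finite_I: "finite I"
    and A_events [simp]: "\<And>i. i \<in> I \<Longrightarrow> A i \<in> events"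
    and self_nbr: "\<And>i. i \<in> I \<Longrightarrow> i \<in> N i"
    and indep_single: "\<And>i S. i \<in> I \<Longrightarrow> S \<subseteq> I - N i \<Longrightarrow>
       prob (A i \<inter> (space M - (\<Union>j\<in>S. A j))) = prob (A i) * prob (space M - (\<Union>j\<in>S. A j))"
    and indep_pair: "\<And>i k S. i \<in> I \<Longrightarrow> k \<in> I \<Longrightarrow> S \<subseteq> I - N i - N k \<Longrightarrow>
       prob (A i \<inter> A k \<inter> (space M - (\<Union>j\<in>S. A j)))
         = prob (A i \<inter> A k) * prob (space M - (\<Union>j\<in>S. A j))"
    and nbr_sum: "\<And>i. i \<in> I \<Longrightarrow> (\<Sum>j\<in>I \<inter> N i. prob (A j)) \<le> \<delta>"
    and delta_le: "\<delta> \<le> 1/4"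
begin

definition avoid :: "'i set \<Rightarrow> 'a set" where
  "avoid S = space M - (\<Union>j\<in>S. A j)"

lemma avoid_event: "S \<subseteq> I \<Longrightarrow> avoid S \<in> events"
  unfolding avoid_def using finite_subset[OF _ finite_I]
  by (intro sets.Diff sets.finite_UN sets.top) auto

lemma prob_avoid_mono: "S \<subseteq> T \<Longrightarrow> T \<subseteq> I \<Longrightarrow> prob (avoid T) \<le> prob (avoid S)"
  by (rule finite_measure_mono) (auto simp: avoid_def intro!: avoid_event[unfolded avoid_def])

lemma prob_diff_UN_ge:
  assumes "finite T" "B \<in> events" "\<And>j. j \<in> T \<Longrightarrow> F j \<in> events"
  shows "prob (B - (\<Union>j\<in>T. F j)) \<ge> prob B - (\<Sum>j\<in>T. prob (F j \<inter> B))"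
proof -
  have "prob B = prob ((B - (\<Union>j\<in>T. F j)) \<union> (\<Union>j\<in>T. F j \<inter> B))"
    by (rule arg_cong[where f = prob]) auto
  also have "\<dots> \<le> prob (B - (\<Union>j\<in>T. F j)) + prob (\<Union>j\<in>T. F j \<inter> B)"
    using assms by (intro measure_Un_le sets.Diff sets.finite_UN sets.Int) auto
  also have "prob (\<Union>j\<in>T. F j \<inter> B) \<le> (\<Sum>j\<in>T. prob (F j \<inter> B))"
    using assms by (intro measure_UNION_le) auto
  finally show ?thesis by simp
qed

lemma prob_le_delta: "i \<in> I \<Longrightarrow> prob (A i) \<le> \<delta>"
  using nbr_sum[of i] self_nbr[of i] finite_I
    member_le_sum[of i "I \<inter> N i" "\<lambda>j. prob (A j)"] by fastforce

text \<open>Without the neighbours of \<open>i\<close> the avoidance is independent of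
  \<open>A i\<close>. Putting the neighbours back loses at most half of the avoidance probability:
  by induction each costs at most twice its own probability, and these add up to at most 1/4. So the
  factor 2 reproduces itself, as in the local lemma.\<close>

lemma prob_inter_avoid_le2:
  assumes "i \<in> I" "S \<subseteq> I"
  shows "prob (A i \<inter> avoid S) \<le> 2 * prob (A i) * prob (avoid S)"
  using assms
proof (induction "card S" arbitrary: S i rule: less_induct)
  case less
  define S1 where "S1 = S - N i"
  define S2 where "S2 = S \<inter> N i"
  have S: "S1 \<subseteq> I" "S2 \<subseteq> I \<inter> N i" "finite S" "S1 \<subseteq> S" "finite S2"
    using less.prems finite_subset[OF _ finite_I] by (auto simp: S1_def S2_def)
  have eq: "avoid S = avoid S1 - (\<Union>j\<in>S2. A j)"
    unfolding avoid_def S1_def S2_def by auto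
  \<comment> \<open>The induction hypothesis is used for neighbours of \<open>i\<close> against
    \<open>S1\<close>, so the set has to shrink strictly. If \<open>S2 = {}\<close>, nothing was
    removed and nothing is to be proved.\<close>
  have half: "prob (avoid S1) \<le> 2 * prob (avoid S)"
  proof (cases "S2 = {}")
    case True
    then have "S1 = S" by (auto simp: S1_def S2_def)
    then show ?thesis by simp
  next
    case False
    then have "card S1 < card S"
      using S by (intro psubset_card_mono) (auto simp: S1_def S2_def)
    then have IH: "prob (A j \<inter> avoid S1) \<le> 2 * prob (A j) * prob (avoid S1)" if "j \<in> S2" for j
      using less.hyps[of S1 j] S that by auto
    have "(\<Sum>j\<in>S2. prob (A j)) \<le> (\<Sum>j\<in>I \<inter> N i. prob (A j))"
      using S finite_I by (intro sum_mono2) auto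
    also have "\<dots> \<le> 1/4" using nbr_sum[OF less.prems(1)] delta_le by linarith
    finally have le: "(\<Sum>j\<in>S2. prob (A j)) \<le> 1/4" .
    have "(\<Sum>j\<in>S2. prob (A j \<inter> avoid S1)) \<le> (\<Sum>j\<in>S2. 2 * prob (A j) * prob (avoid S1))"
      using IH by (intro sum_mono) auto
    also have "\<dots> = 2 * (\<Sum>j\<in>S2. prob (A j)) * prob (avoid S1)"
      by (simp add: sum_distrib_left sum_distrib_right)
    also have "\<dots> \<le> 1/2 * prob (avoid S1)"
      using le by (intro mult_right_mono) auto
    finally show ?thesis
      using prob_diff_UN_ge[of S2 "avoid S1" A] S avoid_event[of S1] unfolding eq by fastforce
  qed
  have "prob (A i \<inter> avoid S) \<le> prob (A i \<inter> avoid S1)"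
    using S less.prems by (intro finite_measure_mono sets.Int avoid_event) (auto simp: avoid_def)
  also have "\<dots> = prob (A i) * prob (avoid S1)"
    unfolding avoid_def using less.prems by (intro indep_single) (auto simp: S1_def)
  also have "\<dots> \<le> prob (A i) * (2 * prob (avoid S))"
    using half by (intro mult_left_mono) auto
  finally show ?case by simp
qed

text \<open>A second pass: with the factor 2 known, putting back neighbours of a single
  \<open>i\<close> costs only the fraction 2 \<delta> instead of one half. Both sharper estimates
  below rest on this.\<close>

lemma prob_avoid_Un_ge:
  assumes "S \<subseteq> I" "T \<subseteq> I \<inter> N i" "i \<in> I"
  shows "prob (avoid (S \<union> T)) \<ge> (1 - 2 * \<delta>) * prob (avoid S)"
proof -
  have fin: "finite T" using assms finite_subset[OF _ finite_I] by blast
  have eq: "avoid (S \<union> T) = avoid S - (\<Union>j\<in>T. A j)"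
    unfolding avoid_def by auto
  have "(\<Sum>j\<in>T. prob (A j \<inter> avoid S)) \<le> (\<Sum>j\<in>T. 2 * prob (A j) * prob (avoid S))"
    using assms by (intro sum_mono prob_inter_avoid_le2) auto
  also have "\<dots> = 2 * (\<Sum>j\<in>T. prob (A j)) * prob (avoid S)"
    by (simp add: sum_distrib_left sum_distrib_right)
  also have "(\<Sum>j\<in>T. prob (A j)) \<le> (\<Sum>j\<in>I \<inter> N i. prob (A j))"
    using assms finite_I by (intro sum_mono2) auto
  also have "\<dots> \<le> \<delta>" using assms by (intro nbr_sum)
  finally have "(\<Sum>j\<in>T. prob (A j \<inter> avoid S)) \<le> 2 * \<delta> * prob (avoid S)"
    by (simp add: mult_right_mono)
  then show ?thesis
    using prob_diff_UN_ge[of T "avoid S" A] fin avoid_event[OF assms(1)] assms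
    unfolding eq by (fastforce simp: algebra_simps)
qed

text \<open>The factor 1 / (1 - 2 \<delta>) for putting the neighbours back is at most 1 + 4
  \<delta> for 0 \<le> \<delta> \<le> 1/4.\<close>

lemma prob_inter_avoid_le:
  assumes "i \<in> I" "S \<subseteq> I"
  shows "prob (A i \<inter> avoid S) \<le> prob (A i) * (1 + 4 * \<delta>) * prob (avoid S)"
proof -
  have d0: "0 \<le> \<delta>" using prob_le_delta[OF assms(1)] measure_nonneg[of M "A i"] by linarith
  have "prob (A i \<inter> avoid S) \<le> prob (A i \<inter> avoid (S - N i))"
    using assms by (intro finite_measure_mono sets.Int avoid_event) (auto simp: avoid_def)
  also have "\<dots> = prob (A i) * prob (avoid (S - N i))"
    unfolding avoid_def using assms by (intro indep_single) auto
  also have "prob (avoid (S - N i)) \<le> (1 + 4 * \<delta>) * ((1 - 2 * \<delta>) * prob (avoid (S - N i)))"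
  proof -
    have "1 \<le> (1 + 4 * \<delta>) * (1 - 2 * \<delta>)"
      using d0 delta_le mult_left_mono[of \<delta> "1/4" "8 * \<delta>"] by (simp add: algebra_simps)
    from mult_right_mono[OF this, of "prob (avoid (S - N i))"] show ?thesis
      by (simp only: mult.assoc mult_1_left measure_nonneg)
  qed
  also have "(1 - 2 * \<delta>) * prob (avoid (S - N i)) \<le> prob (avoid S)"
    using prob_avoid_Un_ge[of "S - N i" "S \<inter> N i" i] assms
    by (simp add: Un_Diff_Int le_infI1 subset_iff)
  finally show ?thesis using d0 by (simp add: mult_left_mono mult.assoc)
qed

text \<open>The neighbours of \<open>i\<close> inside \<open>S\<close> are removed by a first-order
  Bonferroni bound, which brings in the joint probabilities. For the pair with \<open>k\<close> the
  remaining avoidance must also be cleared of the neighbours of \<open>k\<close>; putting these back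
  costs the factor 2.\<close>

lemma prob_inter_avoid_ge:
  assumes "i \<in> I" "S \<subseteq> I" "i \<notin> S"
  shows "prob (A i \<inter> avoid S)
    \<ge> (prob (A i) - 2 * (\<Sum>k\<in>I \<inter> N i - {i}. prob (A i \<inter> A k))) * prob (avoid S)"
    (is "_ \<ge> ?c * _")
proof -
  define S1 where "S1 = S - N i"
  define S2 where "S2 = S \<inter> N i"
  have S: "S1 \<subseteq> I" "S2 \<subseteq> I \<inter> N i - {i}" "finite S2" "S1 \<subseteq> S"
    using assms finite_subset[OF _ finite_I] by (auto simp: S1_def S2_def)
  have pair: "prob (A i \<inter> A k \<inter> avoid S1) \<le> 2 * prob (A i \<inter> A k) * prob (avoid S1)"
    if "k \<in> S2" for k
  proof -
    have k: "k \<in> I" using that S by auto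
    have "prob (A i \<inter> A k \<inter> avoid S1) \<le> prob (A i \<inter> A k \<inter> avoid (S1 - N k))"
      using S assms k by (intro finite_measure_mono sets.Int avoid_event) (auto simp: avoid_def)
    also have "\<dots> = prob (A i \<inter> A k) * prob (avoid (S1 - N k))"
      unfolding avoid_def using assms k by (intro indep_pair) (auto simp: S1_def)
    also have "prob (avoid (S1 - N k)) \<le> 2 * ((1 - 2 * \<delta>) * prob (avoid (S1 - N k)))"
      using mult_right_mono[of 1 "2 * (1 - 2 * \<delta>)" "prob (avoid (S1 - N k))"] delta_le
      by (simp add: algebra_simps)
    also have "(1 - 2 * \<delta>) * prob (avoid (S1 - N k)) \<le> prob (avoid S1)"
      using prob_avoid_Un_ge[of "S1 - N k" "S1 \<inter> N k" k] S k
      by (simp add: Un_Diff_Int le_infI1 subset_iff)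
    finally show ?thesis by (simp add: mult_left_mono mult.assoc)
  qed
  have "(\<Sum>k\<in>S2. prob (A k \<inter> (A i \<inter> avoid S1))) \<le> (\<Sum>k\<in>S2. 2 * prob (A i \<inter> A k) * prob (avoid S1))"
    using pair by (intro sum_mono) (simp add: Int_ac)
  also have "\<dots> = 2 * (\<Sum>k\<in>S2. prob (A i \<inter> A k)) * prob (avoid S1)"
    by (simp add: sum_distrib_left sum_distrib_right)
  also have "\<dots> \<le> 2 * (\<Sum>k\<in>I \<inter> N i - {i}. prob (A i \<inter> A k)) * prob (avoid S1)"
    using S finite_I by (intro mult_right_mono mult_left_mono sum_mono2) auto
  finally have sum_le: "(\<Sum>k\<in>S2. prob (A k \<inter> (A i \<inter> avoid S1)))
      \<le> 2 * (\<Sum>k\<in>I \<inter> N i - {i}. prob (A i \<inter> A k)) * prob (avoid S1)" .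
  have eq: "A i \<inter> avoid S = A i \<inter> avoid S1 - (\<Union>j\<in>S2. A j)"
    unfolding avoid_def S1_def S2_def by auto
  have "prob (A i \<inter> avoid S1) = prob (A i) * prob (avoid S1)"
    unfolding avoid_def using assms by (intro indep_single) (auto simp: S1_def)
  then have ge: "prob (A i \<inter> avoid S) \<ge> ?c * prob (avoid S1)"
    using prob_diff_UN_ge[of S2 "A i \<inter> avoid S1" A] sum_le S sets.Int[OF A_events[OF assms(1)] avoid_event[of S1]] assms
    unfolding eq by (simp add: algebra_simps subset_iff)
  \<comment> \<open>Passing from \<open>S1\<close> to the larger \<open>S\<close> needs a
    nonnegative coefficient; with a negative one the claimed bound is at most 0 anyway.\<close>
  show ?thesis
  proof (cases "?c \<ge> 0")
    case True
    then have "?c * prob (avoid S) \<le> ?c * prob (avoid S1)"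
      using S assms by (intro mult_left_mono prob_avoid_mono) auto
    then show ?thesis using ge by linarith
  next
    case False
    then have "?c * prob (avoid S) \<le> 0" by (intro mult_nonpos_nonneg) auto
    then show ?thesis using measure_nonneg[of M "A i \<inter> avoid S"] by linarith
  qed
qed

lemma prob_avoid_insert:
  assumes "i \<in> I" "S \<subseteq> I"
  shows "prob (avoid (insert i S)) = prob (avoid S) - prob (A i \<inter> avoid S)"
proof -
  have "avoid (insert i S) = avoid S - A i \<inter> avoid S" unfolding avoid_def by auto
  then show ?thesis
    using avoid_event[OF assms(2)] assms by (simp only:) (intro finite_measure_Diff; auto)
qed

text \<open>The events are excluded one after another. Each step multiplies the probability by at
  most 1 + t, where t is minus the probability of \<open>A i\<close> plus twice its pair sum, and 1
  + t \<le> exp t holds for either sign of t. The inner sum runs over all neighbours, so it does not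
  depend on the order.\<close>

lemma prob_avoid_le:
  "prob (avoid I) \<le> exp (- (\<Sum>i\<in>I. prob (A i)) + 2 * (\<Sum>i\<in>I. \<Sum>k\<in>I \<inter> N i - {i}. prob (A i \<inter> A k)))"
proof -
  let ?c = "\<lambda>i. \<Sum>k\<in>I \<inter> N i - {i}. prob (A i \<inter> A k)"
  have "prob (avoid S) \<le> exp (- (\<Sum>i\<in>S. prob (A i)) + 2 * (\<Sum>i\<in>S. ?c i))" if "S \<subseteq> I" for S
    using finite_subset[OF that finite_I] that
  proof (induction S rule: finite_induct)
    case empty
    then show ?case by simp
  next
    case (insert i S)
    have "prob (avoid (insert i S)) \<le> (1 + (- prob (A i) + 2 * ?c i)) * prob (avoid S)"
      using prob_avoid_insert[of i S] prob_inter_avoid_ge[of i S] insert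
      by (simp add: algebra_simps)
    also have "\<dots> \<le> exp (- prob (A i) + 2 * ?c i) * prob (avoid S)"
      using exp_ge_add_one_self by (intro mult_right_mono) auto
    also have "\<dots> \<le> exp (- prob (A i) + 2 * ?c i) *
        exp (- (\<Sum>i\<in>S. prob (A i)) + 2 * (\<Sum>i\<in>S. ?c i))"
      using insert by (intro mult_left_mono) auto
    also have "\<dots> = exp (- (\<Sum>i\<in>insert i S. prob (A i)) + 2 * (\<Sum>i\<in>insert i S. ?c i))"
      using insert by (simp add: exp_add[symmetric] algebra_simps)
    finally show ?case .
  qed
  then show ?thesis by simp
qed

lemma prob_avoid_ge:
  "prob (avoid I) \<ge> exp (- (1 + 12 * \<delta>) * (\<Sum>i\<in>I. prob (A i)))"
proof -
  have "prob (avoid S) \<ge> exp (- (1 + 12 * \<delta>) * (\<Sum>i\<in>S. prob (A i)))" if "S \<subseteq> I" for S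
    using finite_subset[OF that finite_I] that
  proof (induction S rule: finite_induct)
    case empty
    then show ?case by (simp add: avoid_def prob_space)
  next
    case (insert i S)
    define x where "x = prob (A i)"
    define y where "y = x * (1 + 4 * \<delta>)"
    have x: "0 \<le> x" "x \<le> \<delta>" "0 \<le> \<delta>"
      using prob_le_delta[of i] insert.prems measure_nonneg[of M "A i"]
      unfolding x_def by (simp_all del: measure_nonneg)
    have y: "0 \<le> y" "y \<le> 2 * x"
      using x delta_le mult_left_mono[of "1 + 4 * \<delta>" 2 x] by (auto simp: y_def)
    \<comment> \<open>12 = 4 + 8: the 4 comes with \<open>y\<close>, the 8 from the quadratic term
      in ln (1 - y) \<ge> - y - 2 y^2, where y^2 \<le> 4 \<delta> x.\<close>
    have "y * y \<le> (2 * x) * (2 * \<delta>)" using x y by (intro mult_mono) auto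
    then have "y + 2 * y\<^sup>2 \<le> (1 + 12 * \<delta>) * x"
      by (simp add: y_def power2_eq_square algebra_simps)
    moreover have "- y - 2 * y\<^sup>2 \<le> ln (1 - y)"
      using x y delta_le by (intro ln_one_minus_pos_lower_bound) auto
    ultimately have "- ((1 + 12 * \<delta>) * x) \<le> ln (1 - y)" by linarith
    then have le: "exp (- ((1 + 12 * \<delta>) * x)) \<le> 1 - y"
      using x y delta_le by (subst (asm) ln_ge_iff) auto
    have "exp (- (1 + 12 * \<delta>) * (\<Sum>i\<in>insert i S. prob (A i)))
        = exp (- ((1 + 12 * \<delta>) * x)) * exp (- (1 + 12 * \<delta>) * (\<Sum>i\<in>S. prob (A i)))"
      using insert by (simp add: exp_add[symmetric] algebra_simps x_def)
    also have "\<dots> \<le> (1 - y) * prob (avoid S)"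
      using insert le x y delta_le by (intro mult_mono) auto
    also have "\<dots> \<le> prob (avoid (insert i S))"
      using prob_avoid_insert[of i S] prob_inter_avoid_le[of i S] insert
      by (simp add: algebra_simps x_def y_def)
    finally show ?case .
  qed
  then show ?thesis by simp
qed

end

section \<open>Events of an i.i.d. sequence\<close>

text \<open>Only whether a variable equals 1 matters, so events are encoded as predicates on Boolean
  patterns. A support is recorded for each, and disjoint supports yield independence in
  \<open>prob_evt_conj\<close>.\<close>

definition depends_on :: "((nat \<Rightarrow> bool) \<Rightarrow> bool) \<Rightarrow> nat set \<Rightarrow> bool" where
  "depends_on Q J \<longleftrightarrow> (\<forall>f g. (\<forall>i\<in>J. f i = g i) \<longrightarrow> Q f = Q g)"

lemma depends_onD: "depends_on Q J \<Longrightarrow> (\<And>i. i \<in> J \<Longrightarrow> f i = g i) \<Longrightarrow> Q f = Q g"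
  unfolding depends_on_def by blast

locale iid_ones = prob_space M for M :: "'a measure" +
  fixes \<xi> :: "nat \<Rightarrow> 'a \<Rightarrow> real" and p :: real
  assumes p_pos: "0 < p" and p_less_1: "p < 1"
    and indep: "indep_vars (\<lambda>_. borel) \<xi> {1..}"
    and prob_one: "i \<ge> 1 \<Longrightarrow> prob {\<omega> \<in> space M. \<xi> i \<omega> = 1} = p"
begin

definition evt :: "((nat \<Rightarrow> bool) \<Rightarrow> bool) \<Rightarrow> 'a set" where
  "evt Q = {\<omega> \<in> space M. Q (\<lambda>i. \<xi> i \<omega> = 1)}"

lemma indep_ones: "indep_vars (\<lambda>_. count_space UNIV) (\<lambda>i \<omega>. \<xi> i \<omega> = 1) {1..}"
  by (rule indep_vars_compose2[OF indep]) measurable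

lemma evt_vimage:
  assumes "depends_on Q J"
  shows "evt Q = (\<lambda>\<omega>. \<lambda>i\<in>J. \<xi> i \<omega> = 1) -` {f \<in> PiE J (\<lambda>_. UNIV). Q f} \<inter> space M"
proof -
  have "Q (\<lambda>i. \<xi> i \<omega> = 1) = Q (\<lambda>i\<in>J. \<xi> i \<omega> = 1)" for \<omega>
    by (rule depends_onD[OF assms]) simp
  then show ?thesis unfolding evt_def by auto
qed

lemma pattern_sets:
  "finite J \<Longrightarrow> {f \<in> PiE J (\<lambda>_. UNIV). Q f} \<in> sets (PiM J (\<lambda>_. count_space (UNIV :: bool set)))"
  by (subst count_space_PiM_finite) auto

lemma evt_events:
  assumes "depends_on Q J" "finite J" "J \<subseteq> {1..}"
  shows "evt Q \<in> events"
proof -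
  have "(\<lambda>\<omega>. \<lambda>i\<in>J. \<xi> i \<omega> = 1) \<in> measurable M (PiM J (\<lambda>_. count_space UNIV))"
    using indep_ones assms unfolding indep_vars_def by (intro measurable_restrict) auto
  from measurable_sets[OF this pattern_sets[OF assms(2)]] show ?thesis
    unfolding evt_vimage[OF assms(1)] .
qed

lemma prob_evt_conj:
  assumes "depends_on Q J" "finite J" "J \<subseteq> {1..}"
    and "depends_on R K" "finite K" "K \<subseteq> {1..}" and "J \<inter> K = {}"
  shows "prob (evt (\<lambda>f. Q f \<and> R f)) = prob (evt Q) * prob (evt R)"
proof -
  have "prob (evt Q) * prob (evt R) =
    prob ((\<lambda>\<omega>. (\<lambda>i\<in>J. \<xi> i \<omega> = 1, \<lambda>i\<in>K. \<xi> i \<omega> = 1)) -`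
      ({f \<in> PiE J (\<lambda>_. UNIV). Q f} \<times> {f \<in> PiE K (\<lambda>_. UNIV). R f}) \<inter> space M)"
    unfolding evt_vimage[OF assms(1)] evt_vimage[OF assms(4)]
    by (rule indep_varD[OF indep_var_restrict[OF indep_ones], symmetric])
      (use assms in \<open>auto intro!: pattern_sets\<close>)
  also have "\<dots> = prob (evt Q \<inter> evt R)"
    unfolding evt_vimage[OF assms(1)] evt_vimage[OF assms(4)]
    by (rule arg_cong[where f = prob]) auto
  also have "evt Q \<inter> evt R = evt (\<lambda>f. Q f \<and> R f)" unfolding evt_def by auto
  finally show ?thesis by simp
qed

lemma prob_evt_single: "i \<ge> 1 \<Longrightarrow> prob (evt (\<lambda>f. f i)) = p"
  using prob_one[of i] by (simp add: evt_def)

lemma prob_evt_single_not: "i \<ge> 1 \<Longrightarrow> prob (evt (\<lambda>f. \<not> f i)) = 1 - p"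
proof -
  assume i: "i \<ge> 1"
  have "evt (\<lambda>f. f i) \<in> events"
    by (rule evt_events[of _ "{i}"]) (use i in \<open>auto simp: depends_on_def\<close>)
  moreover have "evt (\<lambda>f. \<not> f i) = space M - evt (\<lambda>f. f i)" by (auto simp: evt_def)
  ultimately show ?thesis using prob_compl[of "evt (\<lambda>f. f i)"] prob_evt_single[OF i] by simp
qed

lemma prob_evt_pattern:
  assumes "finite S" "finite Z" "S \<inter> Z = {}" "S \<subseteq> {1..}" "Z \<subseteq> {1..}"
  shows "prob (evt (\<lambda>f. (\<forall>i\<in>S. f i) \<and> (\<forall>i\<in>Z. \<not> f i))) = p ^ card S * (1 - p) ^ card Z"
  using assms
proof (induction S rule: finite_induct)
  case empty
  have "prob (evt (\<lambda>f. \<forall>i\<in>Z. \<not> f i)) = (1 - p) ^ card Z"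
    using empty(1,4)
  proof (induction Z rule: finite_induct)
    case empty
    then show ?case by (simp add: evt_def prob_space)
  next
    case (insert j Z)
    have "prob (evt (\<lambda>f. \<not> f j \<and> (\<forall>i\<in>Z. \<not> f i))) = prob (evt (\<lambda>f. \<not> f j)) * prob (evt (\<lambda>f. \<forall>i\<in>Z. \<not> f i))"
      by (rule prob_evt_conj[of _ "{j}" _ Z]) (use insert in \<open>auto simp: depends_on_def\<close>)
    then show ?case using insert by (simp add: prob_evt_single_not)
  qed
  then show ?case by simp
next
  case (insert j S)
  have "prob (evt (\<lambda>f. f j \<and> ((\<forall>i\<in>S. f i) \<and> (\<forall>i\<in>Z. \<not> f i))))
      = prob (evt (\<lambda>f. f j)) * prob (evt (\<lambda>f. (\<forall>i\<in>S. f i) \<and> (\<forall>i\<in>Z. \<not> f i)))"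
    by (rule prob_evt_conj[of _ "{j}" _ "S \<union> Z"]) (use insert in \<open>auto simp: depends_on_def\<close>)
  then show ?case using insert by (simp add: prob_evt_single conj_assoc)
qed

text \<open>Progressions inside a block of consecutive positions are progressions of a shifted
  sequence, so all estimates apply to the blocks that begin after 2^k.\<close>

lemma iid_ones_shift: "iid_ones M (\<lambda>i. \<xi> (i + m)) p"
proof unfold_locales
  show "0 < p" "p < 1" by (fact p_pos p_less_1)+
  show "prob {\<omega> \<in> space M. \<xi> (i + m) \<omega> = 1} = p" if "i \<ge> 1" for i
    using that by (intro prob_one) auto
  \<comment> \<open>Reindexing by \<open>j + m\<close> is done by grouping the family into the
    singleton blocks \<open>{j + m}\<close> and reading off their only component.\<close>
  have "indep_vars (\<lambda>j. PiM {j + m} (\<lambda>_. borel)) (\<lambda>j \<omega>. \<lambda>i\<in>{j + m}. \<xi> i \<omega>) {1..}"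
    by (rule indep_vars_restrict[OF indep]) (auto simp: disjoint_family_on_def)
  then have "indep_vars (\<lambda>_. borel) (\<lambda>j \<omega>. (\<lambda>i\<in>{j + m}. \<xi> i \<omega>) (j + m)) {1..}"
    by (rule indep_vars_compose2[where Y = "\<lambda>j f. f (j + m)"]) (auto intro!: measurable_component_singleton)
  then show "indep_vars (\<lambda>_. borel) (\<lambda>i. \<xi> (i + m)) {1..}" by simp
qed

end

section \<open>Arithmetic progressions\<close>

definition ap_idx :: "nat \<Rightarrow> nat \<Rightarrow> (nat \<times> nat) set" where
  "ap_idx n r = {(a, s). 1 \<le> a \<and> 1 \<le> s \<and> a + (r - 1) * s \<le> n}"

fun ap_ones :: "nat \<Rightarrow> nat \<times> nat \<Rightarrow> nat set" where
  "ap_ones r (a, s) = (\<lambda>j. a + j * s) ` {..<r}"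

text \<open>Positions begin at 1, so a predecessor exists only for \<open>s < a\<close>; otherwise
  \<open>a - s\<close> would be truncated to 0, which is not a position.\<close>

fun ap_zeros :: "nat \<times> nat \<Rightarrow> nat set" where
  "ap_zeros (a, s) = (if s < a then {a - s} else {})"

definition ap_sites :: "nat \<Rightarrow> nat \<times> nat \<Rightarrow> nat set" where
  "ap_sites r \<alpha> = ap_ones r \<alpha> \<union> ap_zeros \<alpha>"

definition ap_starts :: "nat \<Rightarrow> nat \<times> nat \<Rightarrow> (nat \<Rightarrow> bool) \<Rightarrow> bool" where
  "ap_starts r \<alpha> f \<longleftrightarrow> (\<forall>i\<in>ap_ones r \<alpha>. f i) \<and> (\<forall>i\<in>ap_zeros \<alpha>. \<not> f i)"

lemma depends_on_ap_starts: "depends_on (ap_starts r \<alpha>) (ap_sites r \<alpha>)"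
  unfolding depends_on_def ap_starts_def ap_sites_def by blast

lemma finite_ap_ones [simp]: "finite (ap_ones r \<alpha>)"
  by (cases \<alpha>) auto

lemma finite_ap_sites [simp]: "finite (ap_sites r \<alpha>)"
  by (cases \<alpha>) (auto simp: ap_sites_def)

lemma ap_sites_ge_1: "\<alpha> \<in> ap_idx n r \<Longrightarrow> ap_sites r \<alpha> \<subseteq> {1..}"
  by (cases \<alpha>) (auto simp: ap_sites_def ap_idx_def split: if_splits)

lemma ap_idx_subset:
  assumes "r \<ge> 2"
  shows "ap_idx n r \<subseteq> {1..n} \<times> {1..n}"
proof (rule subsetI)
  fix \<alpha> assume "\<alpha> \<in> ap_idx n r"
  then obtain a s where \<alpha>: "\<alpha> = (a, s)" "1 \<le> a" "1 \<le> s" "a + (r - 1) * s \<le> n"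
    by (auto simp: ap_idx_def)
  have "1 * s \<le> (r - 1) * s" using assms by (intro mult_right_mono) auto
  then have "s \<le> n" "a \<le> n" using \<alpha>(4) by linarith+
  then show "\<alpha> \<in> {1..n} \<times> {1..n}" using \<alpha> by simp
qed

lemma finite_ap_idx: "r \<ge> 2 \<Longrightarrow> finite (ap_idx n r)"
  using ap_idx_subset finite_subset by blast

lemma card_ap_ones: "\<alpha> \<in> ap_idx n r \<Longrightarrow> card (ap_ones r \<alpha>) = r"
  by (cases \<alpha>) (auto simp: ap_idx_def card_image inj_on_def)

lemma card_ap_sites:
  assumes "\<alpha> \<in> ap_idx n r" shows "card (ap_sites r \<alpha>) \<le> r + 1"
proof -
  have "card (ap_sites r \<alpha>) \<le> card (ap_ones r \<alpha>) + card (ap_zeros \<alpha>)"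
    unfolding ap_sites_def by (rule card_Un_le)
  moreover have "card (ap_zeros \<alpha>) \<le> 1" by (cases \<alpha>) auto
  ultimately show ?thesis using card_ap_ones[OF assms] by simp
qed

lemma ap_zeros_disjoint: "\<alpha> \<in> ap_idx n r \<Longrightarrow> ap_ones r \<alpha> \<inter> ap_zeros \<alpha> = {}"
  by (cases \<alpha>) (auto simp: ap_idx_def)

text \<open>The integer part in the length bound says that the last term is at most
  \<open>n\<close>. Both conditions pass to shorter lengths, so the maximum reaches \<open>r\<close>
  as soon as \<open>r\<close> itself is admissible.\<close>

lemma ap_run_ge_iff:
  assumes "r \<ge> 1" "1 \<le> a" "a \<le> n" "1 \<le> s"
  shows "r \<le> ap_run x n a s \<longleftrightarrow> a + (r - 1) * s \<le> n \<and> (\<forall>j<r. x (a + j * s) = 1)"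
proof -
  define T where "T = {m. 1 \<le> m \<and> m \<le> 1 + (n - a) div s \<and> (\<forall>j<m. x (a + j * s) = 1)}"
  have fin: "finite T" by (rule finite_subset[of _ "{..1 + (n - a) div s}"]) (auto simp: T_def)
  have len: "m \<le> 1 + (n - a) div s \<longleftrightarrow> a + (m - 1) * s \<le> n" if "m \<ge> 1" for m
  proof -
    have "m \<le> 1 + (n - a) div s \<longleftrightarrow> m - 1 \<le> (n - a) div s" using that by auto
    also have "\<dots> \<longleftrightarrow> (m - 1) * s \<le> n - a"
      using assms by (simp add: less_eq_div_iff_mult_less_eq)
    also have "\<dots> \<longleftrightarrow> a + (m - 1) * s \<le> n" using assms by auto
    finally show ?thesis .
  qed
  show ?thesis
  proof (cases "x a = 1")
    case True
    then have "1 \<in> T" by (auto simp: T_def)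
    then have ne: "T \<noteq> {}" by blast
    have run: "ap_run x n a s = Max T" using True by (simp add: ap_run_def T_def)
    show ?thesis
    proof
      assume "r \<le> ap_run x n a s"
      then have le: "r \<le> Max T" by (simp add: run)
      have "Max T \<in> T" using fin ne by (rule Max_in)
      then have M: "Max T \<le> 1 + (n - a) div s" "\<forall>j<Max T. x (a + j * s) = 1"
        by (auto simp: T_def)
      show "a + (r - 1) * s \<le> n \<and> (\<forall>j<r. x (a + j * s) = 1)"
        using len[of r] assms le M by auto
    next
      assume "a + (r - 1) * s \<le> n \<and> (\<forall>j<r. x (a + j * s) = 1)"
      then have "r \<in> T" using len[of r] assms by (auto simp: T_def)
      then show "r \<le> ap_run x n a s" unfolding run using fin by (intro Max_ge)
    qed
  next
    case False
    have "\<not> (\<forall>j<r. x (a + j * s) = 1)" using False assms(1) by (auto intro!: exI[of _ 0])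
    moreover have "ap_run x n a s = 0" using False by (simp add: ap_run_def)
    ultimately show ?thesis using assms(1) by auto
  qed
qed

text \<open>With at least two terms the step cannot exceed \<open>n\<close>, so the ranges of
  \<open>a\<close> and \<open>s\<close> in the definition are implied by the last term being at most
  \<open>n\<close>.\<close>

lemma longest_ap_ge_iff:
  assumes "n \<ge> 1" "r \<ge> 2"
  shows "r \<le> longest_ap x n \<longleftrightarrow> (\<exists>\<alpha>\<in>ap_idx n r. \<forall>i\<in>ap_ones r \<alpha>. x i = 1)"
proof -
  define T where "T = {ap_run x n a s | a s. a \<in> {1..n} \<and> s \<in> {1..n}}"
  have "T = (\<lambda>(a, s). ap_run x n a s) ` ({1..n} \<times> {1..n})" unfolding T_def by fast
  then have T: "finite T" "T \<noteq> {}" using assms by auto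
  have "r \<le> longest_ap x n \<longleftrightarrow> (\<exists>t\<in>T. r \<le> t)"
    unfolding longest_ap_def T_def[symmetric] by (rule Max_ge_iff[OF T])
  also have "\<dots> \<longleftrightarrow> (\<exists>a\<in>{1..n}. \<exists>s\<in>{1..n}. r \<le> ap_run x n a s)"
    unfolding T_def by blast
  also have "\<dots> \<longleftrightarrow> (\<exists>a\<in>{1..n}. \<exists>s\<in>{1..n}. a + (r - 1) * s \<le> n \<and> (\<forall>j<r. x (a + j * s) = 1))"
    using assms by (intro bex_cong refl ap_run_ge_iff) auto
  also have "\<dots> \<longleftrightarrow> (\<exists>\<alpha>\<in>ap_idx n r. \<forall>i\<in>ap_ones r \<alpha>. x i = 1)"
  proof
    assume "\<exists>a\<in>{1..n}. \<exists>s\<in>{1..n}. a + (r - 1) * s \<le> n \<and> (\<forall>j<r. x (a + j * s) = 1)"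
    then obtain a s where "(a, s) \<in> ap_idx n r" "\<forall>i\<in>ap_ones r (a, s). x i = 1"
      by (auto simp: ap_idx_def)
    then show "\<exists>\<alpha>\<in>ap_idx n r. \<forall>i\<in>ap_ones r \<alpha>. x i = 1" by blast
  next
    assume "\<exists>\<alpha>\<in>ap_idx n r. \<forall>i\<in>ap_ones r \<alpha>. x i = 1"
    then obtain a s where as: "(a, s) \<in> ap_idx n r" "\<forall>i\<in>ap_ones r (a, s). x i = 1"
      by (metis surj_pair)
    then have "a \<in> {1..n}" "s \<in> {1..n}" "a + (r - 1) * s \<le> n \<and> (\<forall>j<r. x (a + j * s) = 1)"
      using ap_idx_subset[OF assms(2), of n] by (auto simp: ap_idx_def)
    then show "\<exists>a\<in>{1..n}. \<exists>s\<in>{1..n}. a + (r - 1) * s \<le> n \<and> (\<forall>j<r. x (a + j * s) = 1)"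
      by blast
  qed
  finally show ?thesis .
qed

text \<open>Moving an all-ones progression back as long as possible makes it start a run.\<close>
lemma ex_ap_starts_iff:
  "(\<exists>\<alpha>\<in>ap_idx n r. \<forall>i\<in>ap_ones r \<alpha>. f i) \<longleftrightarrow> (\<exists>\<alpha>\<in>ap_idx n r. ap_starts r \<alpha> f)"
proof
  have "\<exists>\<alpha>\<in>ap_idx n r. ap_starts r \<alpha> f"
    if "(a, s) \<in> ap_idx n r" "\<forall>i\<in>ap_ones r (a, s). f i" for a s
    using that
  proof (induction a rule: less_induct)
    case (less a)
    have as: "1 \<le> a" "1 \<le> s" "a + (r - 1) * s \<le> n" using less.prems by (auto simp: ap_idx_def)
    show ?case
    proof (cases "s < a \<and> f (a - s)")
      case True
      have "(a - s, s) \<in> ap_idx n r" using as True by (auto simp: ap_idx_def)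
      moreover have "f (a - s + j * s)" if "j < r" for j
      proof (cases j)
        case 0
        then show ?thesis using True by simp
      next
        case (Suc k)
        then have "a - s + j * s = a + k * s" using True by simp
        then show ?thesis using less.prems(2) that Suc by auto
      qed
      ultimately show ?thesis using less.IH[of "a - s"] as True by auto
    next
      case False
      then have "ap_starts r (a, s) f" using less.prems by (auto simp: ap_starts_def)
      then show ?thesis using less.prems(1) by blast
    qed
  qed
  then show "\<exists>\<alpha>\<in>ap_idx n r. \<forall>i\<in>ap_ones r \<alpha>. f i \<Longrightarrow> \<exists>\<alpha>\<in>ap_idx n r. ap_starts r \<alpha> f"
    by fast
qed (auto simp: ap_starts_def)

section \<open>Number of progressions of a given length\<close>

lemma card_ap_idx:
  assumes "r \<ge> 2"
  shows "real (card (ap_idx n r)) \<le> (real n)\<^sup>2 / (2 * (real r - 1))"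
    and "real (card (ap_idx n r)) \<ge> (real n)\<^sup>2 / (2 * (real r - 1)) - real n / 2"
proof -
  define m where "m = r - 1"
  define k where "k = n div m"
  define e where "e = n mod m"
  have m: "m \<ge> 1" "real r - 1 = real m" using assms by (auto simp: m_def)
  have n: "n = m * k + e" "e < m" using m by (auto simp: k_def e_def)
  have "ap_idx n r = (\<lambda>(s, a). (a, s)) ` (SIGMA s:{1..k}. {1..n - m * s})"
  proof -
    have "a + m * s \<le> n \<longleftrightarrow> s \<le> k \<and> a \<le> n - m * s" if "1 \<le> a" "1 \<le> s" for a s
    proof -
      have "s \<le> k \<longleftrightarrow> m * s \<le> n"
        using m by (simp add: k_def less_eq_div_iff_mult_less_eq mult.commute)
      then show ?thesis by linarith
    qed
    then have "(a, s) \<in> ap_idx n r \<longleftrightarrow> (a, s) \<in> (\<lambda>(s, a). (a, s)) ` (SIGMA s:{1..k}. {1..n - m * s})" for a s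
      unfolding ap_idx_def m_def[symmetric] by (auto simp: image_iff)
    then show ?thesis by (intro set_eqI) (simp only: split_paired_all)
  qed
  then have "card (ap_idx n r) = card (SIGMA s:{1..k}. {1..n - m * s})"
    by (simp only:) (rule card_image, auto simp: inj_on_def)
  also have "\<dots> = (\<Sum>s=1..k. n - m * s)" by simp
  finally have "real (card (ap_idx n r)) = (\<Sum>s=1..k. real (n - m * s))" by simp
  also have "\<dots> = (\<Sum>s=1..k. real n - real m * real s)"
  proof (rule sum.cong)
    fix s assume "s \<in> {1..k}"
    then have "m * s \<le> m * k" by auto
    then have "m * s \<le> n" using n by linarith
    then show "real (n - m * s) = real n - real m * real s" by (simp add: of_nat_diff)
  qed simp
  also have "\<dots> = real n * real k - real m * (\<Sum>s=1..k. real s)"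
    by (simp add: sum_subtractf sum_distrib_left)
  also have "(\<Sum>s=1..k. real s) = real k * (real k + 1) / 2"
    by (induction k) (auto simp: field_simps)
  finally have card: "real (card (ap_idx n r)) = real n * real k - real m * (real k * (real k + 1) / 2)" .
  \<comment> \<open>With n = m k + e the count falls short of n^2 / (2m) by exactly m k / 2 + e^2 /
    (2m). As e < m, this lies between 0 and (m k + e) / 2 = n / 2.\<close>
  have "(real n)\<^sup>2 / (2 * real m) - real (card (ap_idx n r)) = real m * real k / 2 + (real e)\<^sup>2 / (2 * real m)"
    unfolding card using m n(1) by (simp add: field_simps power2_eq_square)
  moreover have "0 \<le> real m * real k / 2 + (real e)\<^sup>2 / (2 * real m)" by simp
  moreover have "(real e)\<^sup>2 / (2 * real m) \<le> real e / 2"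
    using n(2) m(1) by (simp add: field_simps power2_eq_square mult_left_mono)
  moreover have "real n = real m * real k + real e" using n(1) by simp
  ultimately show "real (card (ap_idx n r)) \<le> (real n)\<^sup>2 / (2 * (real r - 1))"
    "real (card (ap_idx n r)) \<ge> (real n)\<^sup>2 / (2 * (real r - 1)) - real n / 2"
    unfolding m(2) by linarith+
qed

text \<open>Prepending the preceding position turns a progression of length \<open>r\<close> that
  has one into an arbitrary progression of length r + 1. This is how the count for r + 1 enters the
  mean, and with it both r and r - 1 into \<open>lam\<close>.\<close>

lemma card_ap_idx_preceded:
  assumes "r \<ge> 1"
  shows "card {(a, s). (a, s) \<in> ap_idx n r \<and> s < a} = card (ap_idx n (r + 1))"
proof (rule bij_betw_same_card)
  have step: "r * s = (r - 1) * s + s" for s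
    using assms by (cases r) auto
  show "bij_betw (\<lambda>(a, s). (a - s, s)) {(a, s). (a, s) \<in> ap_idx n r \<and> s < a} (ap_idx n (r + 1))"
    by (rule bij_betw_byWitness[where f' = "\<lambda>(a, s). (a + s, s)"])
       (auto simp: ap_idx_def step)
qed

section \<open>Common positions of two progressions\<close>

lemma card_residue_class_le:
  assumes "K \<subseteq> {..<r}" "m \<ge> 1" and cong: "\<And>i j. i \<in> K \<Longrightarrow> j \<in> K \<Longrightarrow> i mod m = j mod m"
  shows "m * card K \<le> r + m - 1"
proof (cases "K = {}")
  case False
  then have r: "r \<ge> 1" using assms(1) by auto
  have "inj_on (\<lambda>i. i div m) K"
  proof (rule inj_onI)
    fix i j assume "i \<in> K" "j \<in> K" "i div m = j div m"
    then show "i = j" using cong[of i j] by (metis div_mult_mod_eq)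
  qed
  then have "card K = card ((\<lambda>i. i div m) ` K)" by (simp add: card_image)
  also have "\<dots> \<le> card {..(r - 1) div m}"
    using assms(1) by (intro card_mono) (auto intro!: div_le_mono)
  finally have "m * card K \<le> m * ((r - 1) div m + 1)"
    by (intro mult_le_mono2) simp
  also have "\<dots> \<le> (r - 1) + m" by simp
  finally show ?thesis using r by simp
qed simp

text \<open>For two common positions with indices i, j in the first progression, (j - i) u is a
  multiple of m, where s = g u and t = g m with u and m coprime. So these indices lie in one residue
  class modulo m, which leaves at most r / m of them, rounded up.\<close>

lemma card_ap_ones_inter_le:
  assumes "s \<ge> 1" "t \<ge> 1" "t = g * m" "g = gcd s t"
  shows "m * card (ap_ones r (a, s) \<inter> ap_ones r (b, t)) \<le> r + m - 1"
proof -
  define K where "K = {i. i < r \<and> a + i * s \<in> ap_ones r (b, t)}"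
  have m: "m \<ge> 1" using assms(2,3) by (cases m) auto
  have g: "g \<ge> 1" unfolding assms(4) using assms(1) by (simp add: Suc_le_eq)
  have "g dvd s" unfolding assms(4) by simp
  then obtain u where u: "s = g * u" by (rule dvdE)
  have cop: "coprime u m"
  proof -
    have "g * gcd u m = g * 1" 
      using assms(4) unfolding gcd_mult_distrib_nat u[symmetric] assms(3)[symmetric] by simp
    then show ?thesis using g by (simp add: coprime_iff_gcd_eq_1)
  qed
  have mod: "i mod m = j mod m" if "i \<in> K" "j \<in> K" "i \<le> j" for i j
  proof -
    obtain i' j' where e: "a + i * s = b + i' * t" "a + j * s = b + j' * t"
      using \<open>i \<in> K\<close> \<open>j \<in> K\<close> by (auto simp: K_def)
    have "i * s \<le> j * s" using \<open>i \<le> j\<close> by simp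
    then have "i' * t \<le> j' * t" using e by linarith
    have "(j - i) * s = (j' - i') * t"
      using e \<open>i \<le> j\<close> by (simp add: diff_mult_distrib)
    then have "(j - i) * u = (j' - i') * m" using u assms(3) g by auto
    then have "m dvd (j - i) * u" by simp
    then have "m dvd j - i" using cop by (simp add: coprime_commute coprime_dvd_mult_left_iff)
    then show ?thesis using \<open>i \<le> j\<close> by (metis mod_eq_dvd_iff_nat)
  qed
  have "ap_ones r (a, s) \<inter> ap_ones r (b, t) = (\<lambda>i. a + i * s) ` K" by (auto simp: K_def)
  then have "card (ap_ones r (a, s) \<inter> ap_ones r (b, t)) \<le> card K"
    using card_image_le[of K] by (simp add: K_def)
  moreover have "m * card K \<le> r + m - 1"
  proof (rule card_residue_class_le[OF _ m])
    show "i mod m = j mod m" if "i \<in> K" "j \<in> K" for i j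
      using mod[OF that] mod[OF that(2,1), symmetric] nat_le_linear[of i j] by blast
  qed (unfold K_def, blast)
  ultimately show ?thesis by (rule le_trans[OF mult_le_mono2])
qed

text \<open>After division by the gcd the steps are distinct positive numbers, so the larger is at
  least 2, and at least 3 unless they are 1 and 2. The bound with the larger reduced step as
  multiplier applies because either progression may be taken as the reference.\<close>

lemma card_ap_ones_inter_le_half:
  assumes "s \<ge> 1" "t \<ge> 1" "s \<noteq> t"
  shows "2 * card (ap_ones r (a, s) \<inter> ap_ones r (b, t)) \<le> r + 1"
    and "t \<noteq> 2 * s \<Longrightarrow> s \<noteq> 2 * t \<Longrightarrow> 3 * card (ap_ones r (a, s) \<inter> ap_ones r (b, t)) \<le> r + 2"
proof -
  define g where "g = gcd s t"
  have "g dvd s" "g dvd t" unfolding g_def by simp_all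
  then obtain u v where u: "s = g * u" and v: "t = g * v" by (auto elim!: dvdE)
  let ?c = "card (ap_ones r (a, s) \<inter> ap_ones r (b, t))"
  have uv: "u \<noteq> v" "u \<ge> 1" "v \<ge> 1" using assms u v by (auto simp: Suc_le_eq)
  have le: "w * ?c \<le> r + w - 1" if "w = u \<or> w = v" for w
    using card_ap_ones_inter_le[OF assms(1,2) v g_def, of r a b]
      card_ap_ones_inter_le[OF assms(2,1) u, of r b a] that
    by (auto simp: Int_commute g_def gcd.commute)
  \<comment> \<open>Lowering the multiplier by one lowers the right side by 1 and the left side by
    the number of common positions, which is at least 1 unless the claim is trivial.\<close>
  have bound: "l * ?c \<le> r + l - 1" if "w \<ge> l" "w = u \<or> w = v" "l \<ge> 1" for w l
  proof (cases "?c = 0")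
    case False
    then have "(w - l) * 1 \<le> (w - l) * ?c" by (intro mult_le_mono2) linarith
    moreover have "w * ?c = l * ?c + (w - l) * ?c"
      using \<open>w \<ge> l\<close> by (metis add_mult_distrib le_add_diff_inverse)
    ultimately show ?thesis using le[of w] that by linarith
  qed simp
  show "2 * ?c \<le> r + 1"
  proof (cases "u \<ge> 2")
    case True
    then show ?thesis using bound[of 2 u] by simp
  next
    case False
    then have "v \<ge> 2" using uv by linarith
    then show ?thesis using bound[of 2 v] by simp
  qed
  assume "t \<noteq> 2 * s" "s \<noteq> 2 * t"
  then have "v \<noteq> 2 * u" "u \<noteq> 2 * v" using u v by auto
  then have "u \<ge> 3 \<or> v \<ge> 3" using uv by linarith
  then show "3 * ?c \<le> r + 2"
    using bound[of 3 u] bound[of 3 v] by (elim disjE) simp_all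
qed

section \<open>Counting neighbours\<close>

lemma ap_idx_step_le: "r \<ge> 2 \<Longrightarrow> (b, t) \<in> ap_idx n r \<Longrightarrow> 1 \<le> b \<and> 1 \<le> t \<and> t \<le> n"
  using ap_idx_subset[of r n] by auto

text \<open>A progression through \<open>x\<close> is determined by its step and by the rank of
  \<open>x\<close> among its at most r + 1 sites.\<close>

lemma card_ap_nbrs_site:
  assumes "r \<ge> 2"
  shows "card {\<beta> \<in> ap_idx n r. x \<in> ap_sites r \<beta>} \<le> (r + 1) * n"
proof -
  have "{\<beta> \<in> ap_idx n r. x \<in> ap_sites r \<beta>} \<subseteq> (\<lambda>(j, t). (x + t - j * t, t)) ` ({..r} \<times> {1..n})"
  proof clarify
    fix b t assume bt: "(b, t) \<in> ap_idx n r" and x: "x \<in> ap_sites r (b, t)"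
    have t: "1 \<le> t" "t \<le> n" using ap_idx_step_le[OF assms bt] by auto
    \<comment> \<open>Ranks are counted from the preceding position: rank 0 is the zero, rank j + 1
      the j-th one. Adding \<open>t\<close> on the left keeps rank 0 within the natural
      numbers.\<close>
    have "\<exists>j\<le>r. x + t = b + j * t"
    proof (cases "x \<in> ap_ones r (b, t)")
      case True
      then obtain j where "j < r" "x = b + j * t" by auto
      then show ?thesis by (intro exI[of _ "Suc j"]) auto
    next
      case False
      then have "t < b" "x = b - t" using x by (auto simp: ap_sites_def split: if_splits)
      then show ?thesis by (intro exI[of _ 0]) auto
    qed
    then obtain j where j: "j \<le> r" "x + t = b + j * t" by blast
    then have "(b, t) = (\<lambda>(j, t). (x + t - j * t, t)) (j, t)" by simp
    then show "(b, t) \<in> (\<lambda>(j, t). (x + t - j * t, t)) ` ({..r} \<times> {1..n})"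
      using j t by (intro image_eqI[of _ _ "(j, t)"]) auto
  qed
  then have "card {\<beta> \<in> ap_idx n r. x \<in> ap_sites r \<beta>}
      \<le> card ((\<lambda>(j, t). (x + t - j * t, t)) ` ({..r} \<times> {1..n}))"
    by (intro card_mono) auto
  also have "\<dots> \<le> card ({..r} \<times> {1..n})" by (intro card_image_le) auto
  finally show ?thesis by (simp add: card_cartesian_product)
qed

definition ap_nbrs :: "nat \<Rightarrow> nat \<times> nat \<Rightarrow> (nat \<times> nat) set" where
  "ap_nbrs r \<alpha> = {\<beta>. ap_sites r \<alpha> \<inter> ap_sites r \<beta> \<noteq> {}}"

lemma card_ap_nbrs:
  assumes "r \<ge> 2" "\<alpha> \<in> ap_idx n r"
  shows "card (ap_idx n r \<inter> ap_nbrs r \<alpha>) \<le> (r + 1)\<^sup>2 * n"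
proof -
  have "ap_idx n r \<inter> ap_nbrs r \<alpha> = (\<Union>x\<in>ap_sites r \<alpha>. {\<beta> \<in> ap_idx n r. x \<in> ap_sites r \<beta>})"
    unfolding ap_nbrs_def by blast
  then have "card (ap_idx n r \<inter> ap_nbrs r \<alpha>) \<le> (\<Sum>x\<in>ap_sites r \<alpha>. card {\<beta> \<in> ap_idx n r. x \<in> ap_sites r \<beta>})"
    by (simp only:) (rule card_UN_le, simp)
  also have "\<dots> \<le> (\<Sum>x\<in>ap_sites r \<alpha>. (r + 1) * n)"
    by (intro sum_mono card_ap_nbrs_site assms)
  also have "\<dots> \<le> (r + 1) * ((r + 1) * n)"
    using card_ap_sites[OF assms(2)] by (simp only: sum_constant of_nat_id) (rule mult_le_mono1)
  finally show ?thesis by (simp only: power2_eq_square mult.assoc)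
qed

text \<open>The step takes one of two values, with \<open>s div 2\<close> covering s = 2 t, and the
  indices of one common point in both progressions then fix the start. Such pairs can share half of
  their positions, which leaves only a factor of order 1/n; this is why a count better than r^4 is
  required.\<close>

lemma card_ap_nbrs_doubled_step:
  assumes "r \<ge> 2" "s \<ge> 1"
  shows "card {(b, t) \<in> ap_idx n r. (t = 2 * s \<or> s = 2 * t) \<and> ap_ones r (a, s) \<inter> ap_ones r (b, t) \<noteq> {}}
    \<le> 2 * r\<^sup>2" (is "card ?B \<le> _")
proof -
  let ?F = "\<lambda>(i, j, t). (a + i * s - j * t, t)"
  let ?D = "{..<r} \<times> {..<r} \<times> {2 * s, s div 2}"
  have "?B \<subseteq> ?F ` ?D"
  proof (rule subsetI)
    fix z assume "z \<in> ?B"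
    then obtain b t x where z: "z = (b, t)" and t: "t = 2 * s \<or> s = 2 * t"
      and x: "x \<in> ap_ones r (a, s)" "x \<in> ap_ones r (b, t)"
      by (auto simp del: ap_ones.simps)
    then obtain i j where ij: "i < r" "j < r" "a + i * s = b + j * t" by auto
    then have "(b, t) = ?F (i, j, t)" by simp
    moreover have "(i, j, t) \<in> ?D" using ij t by auto
    ultimately show "z \<in> ?F ` ?D" unfolding z by (rule image_eqI)
  qed
  then have "card ?B \<le> card (?F ` ?D)" by (intro card_mono) auto
  also have "\<dots> \<le> card ?D" by (intro card_image_le) auto
  also have "\<dots> \<le> r * (r * 2)"
    unfolding card_cartesian_product by (intro mult_le_mono) (auto simp: card_insert_if)
  finally show ?thesis by (simp add: power2_eq_square)
qed

text \<open>Two common points x < y give (i2 - i1) s = (j2 - j1) t, so their four indices determine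
  the step \<open>t\<close>, and then the start. The count is free of n.\<close>

lemma card_ap_nbrs_two_common:
  assumes "r \<ge> 2" "s \<ge> 1"
  shows "card {(b, t) \<in> ap_idx n r. card (ap_ones r (a, s) \<inter> ap_ones r (b, t)) \<ge> 2} \<le> r ^ 4"
    (is "card ?B \<le> _")
proof -
  let ?t = "\<lambda>i1 i2 j1 j2. (i2 - i1) * s div (j2 - j1)"
  let ?F = "\<lambda>(i1, i2, j1, j2). (a + i1 * s - j1 * ?t i1 i2 j1 j2, ?t i1 i2 j1 j2)"
  let ?D = "{..<r} \<times> {..<r} \<times> {..<r} \<times> {..<r}"
  have "?B \<subseteq> ?F ` ?D"
  proof clarify
    fix b t
    assume bt: "(b, t) \<in> ap_idx n r" and c: "card (ap_ones r (a, s) \<inter> ap_ones r (b, t)) \<ge> 2"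
    have t: "1 \<le> t" using ap_idx_step_le[OF assms(1) bt] by auto
    have "\<not> card (ap_ones r (a, s) \<inter> ap_ones r (b, t)) \<le> Suc 0" using c by linarith
    then obtain x0 y0 where "x0 \<noteq> y0" "x0 \<in> ap_ones r (a, s) \<inter> ap_ones r (b, t)"
      "y0 \<in> ap_ones r (a, s) \<inter> ap_ones r (b, t)"
      using card_le_Suc0_iff_eq[of "ap_ones r (a, s) \<inter> ap_ones r (b, t)"] by (metis finite_Int finite_ap_ones)
    then obtain x y where xy: "x < y" "x \<in> ap_ones r (a, s)" "x \<in> ap_ones r (b, t)"
      "y \<in> ap_ones r (a, s)" "y \<in> ap_ones r (b, t)"
      by (metis Int_iff nat_neq_iff)
    obtain i1 where i1: "i1 < r" "x = a + i1 * s" using xy(2) by auto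
    obtain j1 where j1: "j1 < r" "x = b + j1 * t" using xy(3) by auto
    obtain i2 where i2: "i2 < r" "y = a + i2 * s" using xy(4) by auto
    obtain j2 where j2: "j2 < r" "y = b + j2 * t" using xy(5) by auto
    have "j1 * t < j2 * t" using xy(1) j1(2) j2(2) by linarith
    then have lt: "j1 < j2" by simp
    have "(i2 - i1) * s = y - x" using i1(2) i2(2) by (simp add: diff_mult_distrib)
    also have "\<dots> = (j2 - j1) * t" using j1(2) j2(2) by (simp add: diff_mult_distrib)
    finally have "?t i1 i2 j1 j2 = t" using lt by simp
    moreover have "a + i1 * s - j1 * t = b" using i1(2) j1(2) by simp
    ultimately have "(b, t) = ?F (i1, i2, j1, j2)" by simp
    moreover have "(i1, i2, j1, j2) \<in> ?D" using i1 i2 j1 j2 by simp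
    ultimately show "(b, t) \<in> ?F ` ?D" by (rule image_eqI)
  qed
  then have "card ?B \<le> card (?F ` ?D)" by (intro card_mono) auto
  also have "\<dots> \<le> card ?D" by (intro card_image_le) auto
  also have "\<dots> = r ^ 4" by (simp add: card_cartesian_product power4_eq_xxxx mult.assoc)
  finally show ?thesis .
qed

text \<open>Two runs with the same step that meet exclude each other: the position preceding the later
  one belongs to the earlier one.\<close>
lemma ap_starts_same_step:
  assumes "(a, s) \<in> ap_idx n r" "(b, s) \<in> ap_idx n r" "a < b"
    and "(b, s) \<in> ap_nbrs r (a, s)" "ap_starts r (a, s) f"
  shows "\<not> ap_starts r (b, s) f"
proof -
  have as: "1 \<le> a" "1 \<le> s" using assms(1) by (auto simp: ap_idx_def)
  obtain x where x: "x \<in> ap_sites r (a, s)" "x \<in> ap_sites r (b, s)"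
    using assms(4) unfolding ap_nbrs_def by blast
  have site: "\<exists>j\<le>r. x + s = c + j * s" if "x \<in> ap_sites r (c, s)" for c
  proof (cases "x \<in> ap_ones r (c, s)")
    case True
    then obtain j where "j < r" "x = c + j * s" by auto
    then show ?thesis by (intro exI[of _ "Suc j"]) auto
  next
    case False
    then have "s < c" "x = c - s" using that by (auto simp: ap_sites_def split: if_splits)
    then show ?thesis by (intro exI[of _ 0]) auto
  qed
  obtain i where i: "i \<le> r" "x + s = a + i * s" using site[OF x(1)] by blast
  obtain j where j: "j \<le> r" "x + s = b + j * s" using site[OF x(2)] by blast
  have "j * s < i * s" using i(2) j(2) assms(3) by linarith
  then have ji: "j < i" by simp
  define k where "k = i - j"
  have k: "1 \<le> k" "k \<le> r" "i = j + k" using ji i(1) by (auto simp: k_def)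
  have b: "b = a + k * s" using i(2) j(2) by (simp add: k(3) add_mult_distrib)
  have "s < b" using as k(1) b by (cases k) auto
  moreover have "b - s = a + (k - 1) * s" using k(1) b by (cases k) auto
  then have "b - s \<in> ap_ones r (a, s)" using k by (auto intro!: image_eqI[of _ _ "k - 1"])
  ultimately show ?thesis using assms(5) unfolding ap_starts_def by auto
qed

section \<open>Probabilities of single starts and of pairs of starts\<close>

context iid_ones
begin

lemma prob_ap_starts_le:
  assumes "\<alpha> \<in> ap_idx n r"
  shows "prob (evt (ap_starts r \<alpha>)) \<le> p ^ r"
    and "prob (evt (ap_starts r \<alpha>)) \<ge> (1 - p) * p ^ r"
    and "prob (evt (ap_starts r \<alpha>)) = (if snd \<alpha> < fst \<alpha> then (1 - p) * p ^ r else p ^ r)"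
proof -
  obtain a s where \<alpha>: "\<alpha> = (a, s)" by fastforce
  have sub: "ap_ones r \<alpha> \<subseteq> {1..}" "ap_zeros \<alpha> \<subseteq> {1..}"
    using ap_sites_ge_1[OF assms] by (auto simp: ap_sites_def)
  have "prob (evt (ap_starts r \<alpha>)) = p ^ card (ap_ones r \<alpha>) * (1 - p) ^ card (ap_zeros \<alpha>)"
    unfolding ap_starts_def using ap_zeros_disjoint[OF assms] sub
    by (intro prob_evt_pattern) (auto simp: \<alpha>)
  then have "prob (evt (ap_starts r \<alpha>)) = p ^ r * (1 - p) ^ card (ap_zeros \<alpha>)"
    using card_ap_ones[OF assms] by simp
  then show eq: "prob (evt (ap_starts r \<alpha>)) = (if snd \<alpha> < fst \<alpha> then (1 - p) * p ^ r else p ^ r)"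
    unfolding \<alpha> by simp
  have "(1 - p) * p ^ r \<le> 1 * p ^ r" using p_pos p_less_1 by (intro mult_right_mono) auto
  then show "prob (evt (ap_starts r \<alpha>)) \<le> p ^ r" "prob (evt (ap_starts r \<alpha>)) \<ge> (1 - p) * p ^ r"
    unfolding eq by auto
qed

text \<open>The zeros are discarded; the union of the two sets of ones has at least r + (r - k)
  elements.\<close>

lemma prob_two_ap_starts_le:
  assumes "\<alpha> \<in> ap_idx n r" "\<beta> \<in> ap_idx n r" and k: "card (ap_ones r \<alpha> \<inter> ap_ones r \<beta>) \<le> k" "k \<le> r"
  shows "prob (evt (ap_starts r \<alpha>) \<inter> evt (ap_starts r \<beta>)) \<le> p ^ r * p ^ (r - k)"
proof -
  let ?S = "ap_ones r \<alpha> \<union> ap_ones r \<beta>"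
  have sub: "?S \<subseteq> {1..}"
    using ap_sites_ge_1[OF assms(1)] ap_sites_ge_1[OF assms(2)] by (auto simp: ap_sites_def)
  have "prob (evt (ap_starts r \<alpha>) \<inter> evt (ap_starts r \<beta>)) \<le> prob (evt (\<lambda>f. (\<forall>i\<in>?S. f i) \<and> (\<forall>i\<in>{}. \<not> f i)))"
    by (intro finite_measure_mono evt_events[of _ ?S] sub)
      (auto simp: evt_def ap_starts_def depends_on_def)
  also have "\<dots> = p ^ card ?S"
    using sub by (subst prob_evt_pattern) auto
  also have "\<dots> \<le> p ^ (r + (r - k))"
  proof (intro power_decreasing)
    have "card ?S + card (ap_ones r \<alpha> \<inter> ap_ones r \<beta>) = r + r"
      using card_Un_Int[of "ap_ones r \<alpha>" "ap_ones r \<beta>"] card_ap_ones[OF assms(1)] card_ap_ones[OF assms(2)]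
      by simp
    then show "r + (r - k) \<le> card ?S" using k by linarith
  qed (use p_pos p_less_1 in auto)
  finally show ?thesis by (simp add: power_add)
qed

lemma prob_two_ap_starts_same_step:
  assumes "(a, s) \<in> ap_idx n r" "(b, s) \<in> ap_idx n r" "a \<noteq> b" "(b, s) \<in> ap_nbrs r (a, s)"
  shows "prob (evt (ap_starts r (a, s)) \<inter> evt (ap_starts r (b, s))) = 0"
proof -
  have "\<not> (ap_starts r (a, s) f \<and> ap_starts r (b, s) f)" for f
    using ap_starts_same_step[of a s n r b f] ap_starts_same_step[of b s n r a f] assms
    by (cases "a < b") (auto simp: ap_nbrs_def Int_commute)
  then have "evt (ap_starts r (a, s)) \<inter> evt (ap_starts r (b, s)) = {}" by (auto simp: evt_def)
  then show ?thesis by simp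
qed

text \<open>The terms account for pairs of starts that share at most one position with a one, for pairs
  whose steps have ratio two, and for all other pairs.\<close>
definition pair_bound :: "nat \<Rightarrow> nat \<Rightarrow> real" where
  "pair_bound n r = real ((r + 1)\<^sup>2 * n) * p ^ (r - 1) + real (2 * r\<^sup>2) * p ^ (r - (r + 1) div 2)
     + real (r ^ 4) * p ^ (r - (r + 2) div 3)"

text \<open>Neighbours with the same step exclude each other. With at most one common one the
  exponent r - 1 is so large that all (r + 1)^2 n neighbours may be counted, while neighbours with
  more common ones are few, independently of n.\<close>

lemma sum_pair_le:
  assumes r: "r \<ge> 2" and \<alpha>: "\<alpha> \<in> ap_idx n r"
  shows "(\<Sum>\<beta>\<in>ap_idx n r \<inter> ap_nbrs r \<alpha> - {\<alpha>}. prob (evt (ap_starts r \<alpha>) \<inter> evt (ap_starts r \<beta>)))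
    \<le> p ^ r * pair_bound n r"
proof -
  obtain a s where as: "\<alpha> = (a, s)" by fastforce
  have s: "1 \<le> s" using \<alpha> by (auto simp: as ap_idx_def)
  let ?P = "\<lambda>\<beta>. prob (evt (ap_starts r \<alpha>) \<inter> evt (ap_starts r \<beta>))"
  let ?c = "\<lambda>\<beta>. card (ap_ones r \<alpha> \<inter> ap_ones r \<beta>)"
  define B where "B = ap_idx n r \<inter> ap_nbrs r \<alpha>"
  define B2 where "B2 = {(b, t) \<in> ap_idx n r. (t = 2 * s \<or> s = 2 * t) \<and> ap_ones r (a, s) \<inter> ap_ones r (b, t) \<noteq> {}}"
  define B3 where "B3 = {(b, t) \<in> ap_idx n r. card (ap_ones r (a, s) \<inter> ap_ones r (b, t)) \<ge> 2}"
  have fin: "finite B" "finite B2" "finite B3"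
    using finite_ap_idx[OF r, of n] by (auto simp: B_def B2_def B3_def intro: finite_subset[of _ "ap_idx n r"])
  define w1 where "w1 = p ^ r * p ^ (r - 1)"
  define w2 where "w2 = p ^ r * p ^ (r - (r + 1) div 2)"
  define w3 where "w3 = p ^ r * p ^ (r - (r + 2) div 3)"
  have w: "0 \<le> w1" "0 \<le> w2" "0 \<le> w3" using p_pos by (auto simp: w1_def w2_def w3_def)
  \<comment> \<open>\<open>w1\<close> is granted to every neighbour, and membership in
    \<open>B2\<close> or \<open>B3\<close> adds the larger weights. A neighbour that meets only in a
    preceding position has at most one common one and is covered by \<open>w1\<close>.\<close>
  have point: "?P \<beta> \<le> w1 + (if \<beta> \<in> B2 then w2 else 0) + (if \<beta> \<in> B3 then w3 else 0)"
    if "\<beta> \<in> B - {\<alpha>}" for \<beta>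
  proof -
    obtain b t where bt: "\<beta> = (b, t)" by fastforce
    have \<beta>: "\<beta> \<in> ap_idx n r" using that by (auto simp: B_def)
    have t: "1 \<le> t" using \<beta> by (auto simp: bt ap_idx_def)
    consider "t = s" | "?c \<beta> \<le> 1" "t \<noteq> s" | "?c \<beta> \<ge> 2" "t \<noteq> s" "t = 2 * s \<or> s = 2 * t"
      | "?c \<beta> \<ge> 2" "t \<noteq> s" "t \<noteq> 2 * s" "s \<noteq> 2 * t" by linarith
    then show ?thesis
    proof cases
      case 1
      have "?P \<beta> = 0"
        using that \<alpha> unfolding as bt B_def 1 by (intro prob_two_ap_starts_same_step) auto
      then show ?thesis using w by simp
    next
      case 2
      then have "?P \<beta> \<le> w1" unfolding w1_def using r by (intro prob_two_ap_starts_le[OF \<alpha> \<beta>]) auto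
      then show ?thesis using w by simp
    next
      case 3
      have "2 * ?c \<beta> \<le> r + 1" unfolding as bt
        using 3 s t by (intro card_ap_ones_inter_le_half(1)) auto
      then have "?P \<beta> \<le> w2" unfolding w2_def using r by (intro prob_two_ap_starts_le[OF \<alpha> \<beta>]) auto
      moreover have "\<beta> \<in> B2"
        using 3 \<beta> unfolding B2_def as bt by (auto simp del: ap_ones.simps)
      ultimately show ?thesis using w by simp
    next
      case 4
      have "3 * ?c \<beta> \<le> r + 2" unfolding as bt
        using 4 s t by (intro card_ap_ones_inter_le_half(2)) auto
      then have "?P \<beta> \<le> w3" unfolding w3_def using r by (intro prob_two_ap_starts_le[OF \<alpha> \<beta>]) auto
      moreover have "\<beta> \<in> B3" using 4 \<beta> unfolding B3_def as bt by (auto simp del: ap_ones.simps)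
      ultimately show ?thesis using w by simp
    qed
  qed
  have "(\<Sum>\<beta>\<in>B - {\<alpha>}. ?P \<beta>) \<le> (\<Sum>\<beta>\<in>B - {\<alpha>}. w1 + (if \<beta> \<in> B2 then w2 else 0) + (if \<beta> \<in> B3 then w3 else 0))"
    by (intro sum_mono point)
  also have "\<dots> = (\<Sum>\<beta>\<in>B - {\<alpha>}. w1) + (\<Sum>\<beta>\<in>(B - {\<alpha>}) \<inter> B2. w2) + (\<Sum>\<beta>\<in>(B - {\<alpha>}) \<inter> B3. w3)"
    using fin by (simp add: sum.distrib sum.inter_restrict del: sum_constant)
  also have "\<dots> \<le> (\<Sum>\<beta>\<in>B. w1) + (\<Sum>\<beta>\<in>B2. w2) + (\<Sum>\<beta>\<in>B3. w3)"
    using fin w by (intro add_mono sum_mono2) auto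
  also have "\<dots> = real (card B) * w1 + real (card B2) * w2 + real (card B3) * w3" by simp
  also have "\<dots> \<le> real ((r + 1)\<^sup>2 * n) * w1 + real (2 * r\<^sup>2) * w2 + real (r ^ 4) * w3"
    using card_ap_nbrs[OF r \<alpha>] card_ap_nbrs_doubled_step[OF r s, of n a] card_ap_nbrs_two_common[OF r s, of n a] w
    unfolding B_def[symmetric] B2_def[symmetric] B3_def[symmetric]
    by (intro add_mono mult_right_mono) (simp_all only: of_nat_le_iff)
  also have "\<dots> = p ^ r * pair_bound n r"
    by (simp add: w1_def w2_def w3_def pair_bound_def algebra_simps)
  finally show ?thesis unfolding B_def .
qed

end

section \<open>Bounds for the distribution of the longest progression\<close>

context iid_ones
begin

definition longest :: "nat \<Rightarrow> 'a \<Rightarrow> nat" where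
  "longest n \<omega> = longest_ap (\<lambda>i. \<xi> i \<omega>) n"

lemma longest_less_eq_evt:
  assumes "n \<ge> 1" "r \<ge> 2"
  shows "{\<omega> \<in> space M. longest n \<omega> < r} = evt (\<lambda>f. \<forall>\<alpha>\<in>ap_idx n r. \<not> ap_starts r \<alpha> f)"
  using longest_ap_ge_iff[OF assms] ex_ap_starts_iff[of n r "\<lambda>i. \<xi> i _ = 1"]
  unfolding evt_def longest_def not_le[symmetric] by auto

lemma depends_on_no_starts:
  "depends_on (\<lambda>f. \<forall>\<alpha>\<in>S. \<not> ap_starts r \<alpha> f) (\<Union>\<alpha>\<in>S. ap_sites r \<alpha>)"
  unfolding depends_on_def
proof (intro allI impI ball_cong refl arg_cong[where f = Not])
  fix f g :: "nat \<Rightarrow> bool" and \<alpha> assume "\<forall>i\<in>\<Union>\<alpha>\<in>S. ap_sites r \<alpha>. f i = g i" "\<alpha> \<in> S"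
  then show "ap_starts r \<alpha> f = ap_starts r \<alpha> g"
    by (intro depends_onD[OF depends_on_ap_starts]) auto
qed

lemma longest_less_event:
  assumes "n \<ge> 1" "r \<ge> 2"
  shows "{\<omega> \<in> space M. longest n \<omega> < r} \<in> events"
  unfolding longest_less_eq_evt[OF assms] using finite_ap_idx[OF assms(2), of n]
  by (intro evt_events[OF depends_on_no_starts] UN_least ap_sites_ge_1[of _ n]) auto

definition mean :: "nat \<Rightarrow> nat \<Rightarrow> real" where
  "mean n r = (\<Sum>\<alpha>\<in>ap_idx n r. prob (evt (ap_starts r \<alpha>)))"

text \<open>Starts are independent of everything that reads other positions, so being a neighbour
  means sharing a site, preceding positions included. The bound on the neighbourhood sum is its size
  times p^r.\<close>

lemma sparse_dependency_ap_starts: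
  assumes r: "r \<ge> 2" and small: "real ((r + 1)\<^sup>2 * n) * p ^ r \<le> 1/4"
  shows "sparse_dependency M (\<lambda>\<alpha>. evt (ap_starts r \<alpha>)) (ap_idx n r) (ap_nbrs r)
    (real ((r + 1)\<^sup>2 * n) * p ^ r)"
proof unfold_locales
  let ?I = "ap_idx n r"
  show fin: "finite ?I" by (rule finite_ap_idx[OF r])
  show "evt (ap_starts r \<alpha>) \<in> events" if "\<alpha> \<in> ?I" for \<alpha>
    by (rule evt_events[OF depends_on_ap_starts _ ap_sites_ge_1[OF that]]) simp
  show "\<alpha> \<in> ap_nbrs r \<alpha>" if "\<alpha> \<in> ?I" for \<alpha>
  proof -
    have "card (ap_ones r \<alpha>) \<noteq> 0" using card_ap_ones[OF that] r by simp
    then have "ap_ones r \<alpha> \<noteq> {}" by force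
    then show ?thesis by (auto simp: ap_nbrs_def ap_sites_def)
  qed
  have avoid: "space M - (\<Union>\<beta>\<in>S. evt (ap_starts r \<beta>)) = evt (\<lambda>f. \<forall>\<beta>\<in>S. \<not> ap_starts r \<beta> f)" for S
    by (auto simp: evt_def)
  have sites: "finite (\<Union>\<beta>\<in>S. ap_sites r \<beta>)" "(\<Union>\<beta>\<in>S. ap_sites r \<beta>) \<subseteq> {1..}" if "S \<subseteq> ?I" for S
  proof -
    show "finite (\<Union>\<beta>\<in>S. ap_sites r \<beta>)" using finite_subset[OF that fin] by simp
    show "(\<Union>\<beta>\<in>S. ap_sites r \<beta>) \<subseteq> {1..}"
      by (rule UN_least, rule ap_sites_ge_1[OF subsetD[OF that]])
  qed
  show "prob (evt (ap_starts r \<alpha>) \<inter> (space M - (\<Union>\<beta>\<in>S. evt (ap_starts r \<beta>))))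
      = prob (evt (ap_starts r \<alpha>)) * prob (space M - (\<Union>\<beta>\<in>S. evt (ap_starts r \<beta>)))"
    if \<alpha>: "\<alpha> \<in> ?I" and S: "S \<subseteq> ?I - ap_nbrs r \<alpha>" for \<alpha> S
  proof -
    have "prob (evt (\<lambda>f. ap_starts r \<alpha> f \<and> (\<forall>\<beta>\<in>S. \<not> ap_starts r \<beta> f)))
      = prob (evt (ap_starts r \<alpha>)) * prob (evt (\<lambda>f. \<forall>\<beta>\<in>S. \<not> ap_starts r \<beta> f))"
    proof (rule prob_evt_conj[OF depends_on_ap_starts _ _ depends_on_no_starts])
      show "ap_sites r \<alpha> \<inter> (\<Union>\<beta>\<in>S. ap_sites r \<beta>) = {}"
        using S by (auto simp: ap_nbrs_def)
      show "finite (\<Union>\<beta>\<in>S. ap_sites r \<beta>)" "(\<Union>\<beta>\<in>S. ap_sites r \<beta>) \<subseteq> {1..}"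
        using S by (intro sites; blast)+
    qed (use ap_sites_ge_1[OF \<alpha>] in auto)
    moreover have "evt (\<lambda>f. ap_starts r \<alpha> f \<and> (\<forall>\<beta>\<in>S. \<not> ap_starts r \<beta> f))
      = evt (ap_starts r \<alpha>) \<inter> evt (\<lambda>f. \<forall>\<beta>\<in>S. \<not> ap_starts r \<beta> f)"
      by (auto simp: evt_def)
    ultimately show ?thesis unfolding avoid by simp
  qed
  show "prob (evt (ap_starts r \<alpha>) \<inter> evt (ap_starts r \<gamma>) \<inter> (space M - (\<Union>\<beta>\<in>S. evt (ap_starts r \<beta>))))
      = prob (evt (ap_starts r \<alpha>) \<inter> evt (ap_starts r \<gamma>)) * prob (space M - (\<Union>\<beta>\<in>S. evt (ap_starts r \<beta>)))"
    if \<alpha>: "\<alpha> \<in> ?I" and \<gamma>: "\<gamma> \<in> ?I" and S: "S \<subseteq> ?I - ap_nbrs r \<alpha> - ap_nbrs r \<gamma>" for \<alpha> \<gamma> S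
  proof -
    have dep: "depends_on (\<lambda>f. ap_starts r \<alpha> f \<and> ap_starts r \<gamma> f) (ap_sites r \<alpha> \<union> ap_sites r \<gamma>)"
      using depends_on_ap_starts[of r \<alpha>] depends_on_ap_starts[of r \<gamma>]
      unfolding depends_on_def by (metis UnCI)
    have "prob (evt (\<lambda>f. (ap_starts r \<alpha> f \<and> ap_starts r \<gamma> f) \<and> (\<forall>\<beta>\<in>S. \<not> ap_starts r \<beta> f)))
      = prob (evt (\<lambda>f. ap_starts r \<alpha> f \<and> ap_starts r \<gamma> f)) * prob (evt (\<lambda>f. \<forall>\<beta>\<in>S. \<not> ap_starts r \<beta> f))"
    proof (rule prob_evt_conj[OF dep _ _ depends_on_no_starts])
      show "(ap_sites r \<alpha> \<union> ap_sites r \<gamma>) \<inter> (\<Union>\<beta>\<in>S. ap_sites r \<beta>) = {}"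
        using S by (fastforce simp: ap_nbrs_def)
      show "finite (\<Union>\<beta>\<in>S. ap_sites r \<beta>)" "(\<Union>\<beta>\<in>S. ap_sites r \<beta>) \<subseteq> {1..}"
        using S by (intro sites; blast)+
    qed (use ap_sites_ge_1[OF \<alpha>] ap_sites_ge_1[OF \<gamma>] in auto)
    moreover have "evt (\<lambda>f. (ap_starts r \<alpha> f \<and> ap_starts r \<gamma> f) \<and> (\<forall>\<beta>\<in>S. \<not> ap_starts r \<beta> f))
      = evt (ap_starts r \<alpha>) \<inter> evt (ap_starts r \<gamma>) \<inter> evt (\<lambda>f. \<forall>\<beta>\<in>S. \<not> ap_starts r \<beta> f)"
      "evt (\<lambda>f. ap_starts r \<alpha> f \<and> ap_starts r \<gamma> f) = evt (ap_starts r \<alpha>) \<inter> evt (ap_starts r \<gamma>)"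
      by (auto simp: evt_def)
    ultimately show ?thesis unfolding avoid by simp
  qed
  show "(\<Sum>\<beta>\<in>?I \<inter> ap_nbrs r \<alpha>. prob (evt (ap_starts r \<beta>))) \<le> real ((r + 1)\<^sup>2 * n) * p ^ r"
    if \<alpha>: "\<alpha> \<in> ?I" for \<alpha>
  proof -
    have "(\<Sum>\<beta>\<in>?I \<inter> ap_nbrs r \<alpha>. prob (evt (ap_starts r \<beta>))) \<le> (\<Sum>\<beta>\<in>?I \<inter> ap_nbrs r \<alpha>. p ^ r)"
      by (intro sum_mono prob_ap_starts_le(1)) auto
    also have "\<dots> = real (card (?I \<inter> ap_nbrs r \<alpha>)) * p ^ r" by simp
    also have "\<dots> \<le> real ((r + 1)\<^sup>2 * n) * p ^ r"
      using card_ap_nbrs[OF r \<alpha>] p_pos by (intro mult_right_mono) (simp_all only: of_nat_le_iff zero_le_power less_imp_le)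
    finally show ?thesis .
  qed
qed (use small in simp)

lemma card_ap_idx_le_mean: "real (card (ap_idx n r)) * p ^ r \<le> mean n r / (1 - p)"
proof -
  have "(\<Sum>\<alpha>\<in>ap_idx n r. (1 - p) * p ^ r) \<le> mean n r"
    unfolding mean_def by (intro sum_mono prob_ap_starts_le(2))
  then show ?thesis using p_less_1 by (simp add: field_simps)
qed

lemma prob_longest_less_bounds:
  assumes n: "n \<ge> 1" and r: "r \<ge> 2" and small: "real ((r + 1)\<^sup>2 * n) * p ^ r \<le> 1/4"
  shows "prob {\<omega> \<in> space M. longest n \<omega> < r} \<ge> exp (- (1 + 12 * (real ((r + 1)\<^sup>2 * n) * p ^ r)) * mean n r)"
    and "prob {\<omega> \<in> space M. longest n \<omega> < r} \<le> exp (- mean n r + 2 * (mean n r / (1 - p) * pair_bound n r))"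
proof -
  interpret sparse_dependency M "\<lambda>\<alpha>. evt (ap_starts r \<alpha>)" "ap_idx n r" "ap_nbrs r"
    "real ((r + 1)\<^sup>2 * n) * p ^ r"
    by (rule sparse_dependency_ap_starts[OF r small])
  have eq: "{\<omega> \<in> space M. longest n \<omega> < r} = avoid (ap_idx n r)"
    unfolding longest_less_eq_evt[OF n r] avoid_def by (auto simp: evt_def)
  show "prob {\<omega> \<in> space M. longest n \<omega> < r} \<ge> exp (- (1 + 12 * (real ((r + 1)\<^sup>2 * n) * p ^ r)) * mean n r)"
    unfolding eq mean_def by (rule prob_avoid_ge)
  let ?b = "\<Sum>\<alpha>\<in>ap_idx n r. \<Sum>\<beta>\<in>ap_idx n r \<inter> ap_nbrs r \<alpha> - {\<alpha>}.
    prob (evt (ap_starts r \<alpha>) \<inter> evt (ap_starts r \<beta>))"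
  have pb: "pair_bound n r \<ge> 0" using p_pos by (simp add: pair_bound_def)
  have "?b \<le> (\<Sum>\<alpha>\<in>ap_idx n r. p ^ r * pair_bound n r)"
    by (intro sum_mono sum_pair_le r)
  also have "\<dots> = real (card (ap_idx n r)) * p ^ r * pair_bound n r" by simp
  also have "\<dots> \<le> mean n r / (1 - p) * pair_bound n r"
    using pb by (intro mult_right_mono card_ap_idx_le_mean)
  finally have "?b \<le> mean n r / (1 - p) * pair_bound n r" .
  then show "prob {\<omega> \<in> space M. longest n \<omega> < r} \<le> exp (- mean n r + 2 * (mean n r / (1 - p) * pair_bound n r))"
    unfolding eq using prob_avoid_le[folded mean_def] by (smt (verit) exp_le_cancel_iff)
qed

text \<open>A start contributes p^r, less p * p^r if it has a predecessor, so the mean is p^r times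
  the count for r minus p times the count for r + 1. \<open>lam\<close> is the same expression with
  the counts replaced by n^2 / (2 (r - 1)) and n^2 / (2 r). Each replacement is off by at most n /
  2.\<close>

lemma mean_lam_diff:
  assumes r: "r \<ge> 2"
  shows "\<bar>mean n r - lam p n r\<bar> \<le> real n * p ^ r"
proof -
  let ?I = "ap_idx n r" and ?J = "{(a, s). (a, s) \<in> ap_idx n r \<and> s < a}"
  have fin: "finite ?I" by (rule finite_ap_idx[OF r])
  have J: "?J \<subseteq> ?I" "finite ?J" using fin by (auto intro: finite_subset[of _ ?I])
  define J where "J = ?J"
  have "mean n r = (\<Sum>\<alpha>\<in>?I. p ^ r - (if \<alpha> \<in> J then p * p ^ r else 0))"
    unfolding mean_def
    by (intro sum.cong refl) (auto simp: J_def prob_ap_starts_le(3) algebra_simps)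
  also have "\<dots> = real (card ?I) * p ^ r - (\<Sum>\<alpha>\<in>?I \<inter> J. p * p ^ r)"
    using fin by (simp add: sum_subtractf sum.inter_restrict del: sum_constant) simp
  also have "?I \<inter> J = ?J" using J unfolding J_def by blast
  also have "(\<Sum>\<alpha>\<in>?J. p * p ^ r) = real (card (ap_idx n (r + 1))) * (p * p ^ r)"
    using card_ap_idx_preceded[of r n] r by simp
  finally have mean: "mean n r = p ^ r * (real (card ?I) - p * real (card (ap_idx n (r + 1))))"
    by (simp add: algebra_simps)
  define x where "x = (real n)\<^sup>2 / (2 * (real r - 1)) - real (card ?I)"
  define y where "y = (real n)\<^sup>2 / (2 * real r) - real (card (ap_idx n (r + 1)))"
  have x: "0 \<le> x" "x \<le> real n / 2" using card_ap_idx[OF r, of n] unfolding x_def by linarith+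
  have "real (r + 1) - 1 = real r" "2 \<le> r + 1" using r by simp_all
  then have y: "0 \<le> y" "y \<le> real n / 2" using card_ap_idx[of "r + 1" n] unfolding y_def by force+
  have "lam p n r = p ^ r * ((real n)\<^sup>2 / (2 * (real r - 1)) - p * ((real n)\<^sup>2 / (2 * real r)))"
    unfolding lam_def using r by (simp add: field_simps)
  then have diff: "mean n r - lam p n r = p ^ r * (p * y - x)"
    unfolding mean x_def y_def by (simp add: algebra_simps)
  have "p * y \<le> 1 * y" "0 \<le> p * y" using mult_right_mono[of p 1 y] p_pos p_less_1 y by simp_all
  then have "\<bar>p * y - x\<bar> \<le> real n" using x y by linarith
  then show ?thesis unfolding diff using p_pos by (simp add: abs_mult mult.commute mult_left_mono)
qed

text \<open>A plain union bound, free of any smallness condition on the neighbourhoods. It serves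
  the far tail and all upper bounds along sequences.\<close>

lemma prob_longest_ge_le:
  assumes n: "n \<ge> 1" and r: "r \<ge> 2"
  shows "1 - prob {\<omega> \<in> space M. longest n \<omega> < r} \<le> (real n)\<^sup>2 / (2 * (real r - 1)) * p ^ r"
proof -
  let ?I = "ap_idx n r"
  have ev: "evt (ap_starts r \<alpha>) \<in> events" if "\<alpha> \<in> ?I" for \<alpha>
    by (rule evt_events[OF depends_on_ap_starts _ ap_sites_ge_1[OF that]]) simp
  have "1 - prob {\<omega> \<in> space M. longest n \<omega> < r} = prob (space M - {\<omega> \<in> space M. longest n \<omega> < r})"
    using longest_less_event[OF n r] by (simp add: prob_compl)
  also have "space M - {\<omega> \<in> space M. longest n \<omega> < r} = (\<Union>\<alpha>\<in>?I. evt (ap_starts r \<alpha>))"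
    unfolding longest_less_eq_evt[OF n r] by (auto simp: evt_def)
  also have "prob \<dots> \<le> (\<Sum>\<alpha>\<in>?I. prob (evt (ap_starts r \<alpha>)))"
    using ev finite_ap_idx[OF r] by (intro measure_UNION_le) auto
  also have "\<dots> \<le> (\<Sum>\<alpha>\<in>?I. p ^ r)" by (intro sum_mono prob_ap_starts_le(1))
  also have "\<dots> = real (card ?I) * p ^ r" by simp
  also have "\<dots> \<le> (real n)\<^sup>2 / (2 * (real r - 1)) * p ^ r"
    using card_ap_idx(1)[OF r] p_pos by (intro mult_right_mono) auto
  finally show ?thesis .
qed

end

section \<open>Error of the exponential approximation\<close>

lemma lam_bounds:
  assumes "0 < p" "p < 1" "r \<ge> 2"
  shows "(1 - p) * ((real n)\<^sup>2 * p ^ r) / (2 * real r) \<le> lam p n r"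
    and "lam p n r \<le> (real n)\<^sup>2 * p ^ r"
    and "0 \<le> lam p n r"
proof -
  define x where "x = (real n)\<^sup>2 * p ^ r"
  have x: "0 \<le> x" using assms by (simp add: x_def)
  have r: "real r \<ge> 2" using assms by simp
  have lam: "lam p n r = x * ((p + (1 - p) * real r) / (2 * real r * (real r - 1)))"
    by (simp add: lam_def x_def)
  have "(1 - p) / (2 * real r) = (1 - p) * (real r - 1) / (2 * real r * (real r - 1))" using r by simp
  also have "\<dots> \<le> (p + (1 - p) * real r) / (2 * real r * (real r - 1))"
    using r assms by (intro divide_right_mono) (auto simp: algebra_simps)
  finally have lo: "(1 - p) / (2 * real r) \<le> (p + (1 - p) * real r) / (2 * real r * (real r - 1))" .
  have "p * 1 \<le> p * real r" using r assms by (intro mult_left_mono) auto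
  then have le: "p + (1 - p) * real r \<le> real r" by (simp add: algebra_simps)
  have "2 * 1 \<le> real r * (real r - 1)" using r by (intro mult_mono) auto
  then have ge: "real r \<le> 2 * real r * (real r - 1)"
    using mult_left_mono[of 1 "2 * (real r - 1)" "real r"] r by (simp add: algebra_simps)
  have hi: "(p + (1 - p) * real r) / (2 * real r * (real r - 1)) \<le> 1"
  proof -
    have pos: "0 < 2 * real r * (real r - 1)" using r by (intro mult_pos_pos) auto
    show ?thesis unfolding divide_le_eq_1_pos[OF pos] using le ge by linarith
  qed
  show "(1 - p) * ((real n)\<^sup>2 * p ^ r) / (2 * real r) \<le> lam p n r"
    using mult_left_mono[OF lo x] unfolding lam x_def[symmetric] by (simp add: mult.commute)
  show "lam p n r \<le> (real n)\<^sup>2 * p ^ r"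
    using mult_left_mono[OF hi x] unfolding lam x_def[symmetric] by simp
  show "0 \<le> lam p n r"
    unfolding lam using x r assms by (intro mult_nonneg_nonneg divide_nonneg_nonneg add_nonneg_nonneg) auto
qed

lemma abs_exp_minus_1_le:
  fixes z :: real
  assumes "\<bar>z\<bar> \<le> 1"
  shows "\<bar>exp z - 1\<bar> \<le> 2 * \<bar>z\<bar>"
proof (cases "z \<ge> 0")
  case True
  have "exp z \<le> 1 + z + z\<^sup>2" using True assms by (intro exp_bound) auto
  moreover have "z\<^sup>2 \<le> z * 1" using True assms unfolding power2_eq_square by (intro mult_left_mono) auto
  moreover have "1 \<le> exp z" using True by simp
  ultimately show ?thesis using True by linarith
next
  case False
  then have "exp z \<le> 1" by simp
  then show ?thesis using exp_ge_add_one_self[of z] False by linarith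
qed

text \<open>Bounds the square root of z by 1 + z, so that no fractional powers have to be carried
  along.\<close>

lemma le_divide_of_power2_le:
  fixes y z n :: real
  assumes "y\<^sup>2 \<le> z / n\<^sup>2" "0 \<le> z" "0 < n"
  shows "y \<le> (1 + z) / n"
proof (rule power2_le_imp_le)
  have "z \<le> (1 + z)\<^sup>2" using assms by (simp add: power2_eq_square algebra_simps)
  then show "y\<^sup>2 \<le> ((1 + z) / n)\<^sup>2"
    using assms by (simp add: power_divide order_trans[OF assms(1)] divide_right_mono)
qed (use assms in simp)

text \<open>Write y = n^2 p^r. The exponents in \<open>pair_bound\<close> are at least r - 1, (r -
  1)/2 and 2(r - 1)/3, so the powers of p are at most y / (p n^2), its square root, and its power
  2/3. The last is n^(-4/3) up to a power of y, and \<open>small\<close> says that the spare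
  n^(-1/3) absorbs r^4; taking cubes turns this into the twelfth power.\<close>

lemma (in iid_ones) pair_bound_le:
  assumes r: "r \<ge> 2" and n: "n \<ge> 1" and "real r + 1 \<le> B" "1 \<le> B"
    and small: "B ^ 12 * ((real n)\<^sup>2 * p ^ r)\<^sup>2 \<le> p\<^sup>2 * real n"
  shows "pair_bound n r \<le> 4 * B\<^sup>2 * (1 + (real n)\<^sup>2 * p ^ r / p) / real n"
proof -
  define x where "x = (real n)\<^sup>2 * p ^ r"
  have n0: "real n > 0" using n by simp
  have x0: "0 \<le> x" using p_pos by (simp add: x_def)
  have pr: "p ^ (r - 1) = x / p / (real n)\<^sup>2"
  proof -
    have "p ^ r = p * p ^ (r - 1)" using r by (simp add: power_eq_if)
    then show ?thesis using n0 p_pos by (simp add: x_def)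
  qed
  have rB: "real (r + 1) \<le> B" "real r \<le> B" using assms(3) by auto
  have t1: "real ((r + 1)\<^sup>2 * n) * p ^ (r - 1) \<le> B\<^sup>2 * (x / p) / real n"
  proof -
    have "real ((r + 1)\<^sup>2 * n) * p ^ (r - 1) = (real (r + 1))\<^sup>2 * ((x / p) / real n)"
      unfolding of_nat_mult of_nat_power pr using n0 by (simp add: power2_eq_square[of "real n"] del: of_nat_add)
    also have "\<dots> \<le> B\<^sup>2 * ((x / p) / real n)"
      using rB x0 p_pos n0 by (intro mult_right_mono power_mono) auto
    finally show ?thesis by simp
  qed
  have t2: "real (2 * r\<^sup>2) * p ^ (r - (r + 1) div 2) \<le> 2 * B\<^sup>2 * ((1 + x / p) / real n)"
  proof -
    have "(p ^ (r - (r + 1) div 2))\<^sup>2 = p ^ ((r - (r + 1) div 2) * 2)" by (simp add: power_mult)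
    also have "\<dots> \<le> p ^ (r - 1)" using p_pos p_less_1 r by (intro power_decreasing) linarith+
    finally have "p ^ (r - (r + 1) div 2) \<le> (1 + x / p) / real n"
      unfolding pr using x0 p_pos n0 by (intro le_divide_of_power2_le) auto
    moreover have "(real r)\<^sup>2 \<le> B\<^sup>2" using rB by (intro power_mono) auto
    ultimately have "(real r)\<^sup>2 * p ^ (r - (r + 1) div 2) \<le> B\<^sup>2 * ((1 + x / p) / real n)"
      using p_pos by (intro mult_mono) auto
    then show ?thesis by simp
  qed
  have t3: "real (r ^ 4) * p ^ (r - (r + 2) div 3) \<le> 1 / real n"
  proof -
    have "(real (r ^ 4) * p ^ (r - (r + 2) div 3)) ^ 3 = real r ^ 12 * p ^ ((r - (r + 2) div 3) * 3)"
      by (simp add: power_mult_distrib power_mult[symmetric])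
    also have "\<dots> \<le> B ^ 12 * p ^ ((r - 1) * 2)"
    proof (rule mult_mono)
      show "real r ^ 12 \<le> B ^ 12" using rB by (intro power_mono) auto
      show "p ^ ((r - (r + 2) div 3) * 3) \<le> p ^ ((r - 1) * 2)"
        using p_pos p_less_1 r by (intro power_decreasing) linarith+
    qed (use p_pos assms(4) in auto)
    also have "p ^ ((r - 1) * 2) = x\<^sup>2 / p\<^sup>2 / real n ^ 4"
      unfolding power_mult pr
      by (simp add: power_divide power_mult_distrib power_mult[symmetric])
    also have "B ^ 12 * (x\<^sup>2 / p\<^sup>2 / real n ^ 4) = B ^ 12 * x\<^sup>2 / p\<^sup>2 / real n ^ 4" by simp
    also have "\<dots> \<le> real n / real n ^ 4"
      using small p_pos n0 unfolding x_def[symmetric]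
      by (intro divide_right_mono) (simp_all add: pos_divide_le_eq mult.commute)
    also have "\<dots> = (1 / real n) ^ 3" using n0 by (simp add: power_divide power3_eq_cube power4_eq_xxxx)
    finally have "(real (r ^ 4) * p ^ (r - (r + 2) div 3)) ^ 3 \<le> (1 / real n) ^ 3" .
    then show ?thesis by (subst (asm) power_mono_iff) (use p_pos n0 in auto)
  qed
  have "1 * 1 \<le> B\<^sup>2 * (1 + x / p)"
    using assms(4) x0 p_pos by (intro mult_mono) auto
  moreover have "B\<^sup>2 * (x / p) \<le> B\<^sup>2 * (1 + x / p)" by (intro mult_left_mono) auto
  ultimately have "B\<^sup>2 * (x / p) + 2 * B\<^sup>2 * (1 + x / p) + 1 \<le> 4 * B\<^sup>2 * (1 + x / p)"
    by linarith
  then have "(B\<^sup>2 * (x / p) + 2 * B\<^sup>2 * (1 + x / p) + 1) / real n \<le> 4 * B\<^sup>2 * (1 + x / p) / real n"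
    using n0 by (intro divide_right_mono) auto
  moreover have "pair_bound n r \<le> (B\<^sup>2 * (x / p) + 2 * B\<^sup>2 * (1 + x / p) + 1) / real n"
  proof -
    have "pair_bound n r \<le> B\<^sup>2 * (x / p) / real n + 2 * B\<^sup>2 * ((1 + x / p) / real n) + 1 / real n"
      using t1 t2 t3 unfolding pair_bound_def by linarith
    also have "\<dots> = (B\<^sup>2 * (x / p) + 2 * B\<^sup>2 * (1 + x / p) + 1) / real n"
      by (simp only: times_divide_eq_right add_divide_distrib[symmetric])
    finally show ?thesis .
  qed
  ultimately show ?thesis unfolding x_def by linarith
qed

text \<open>The terms come from replacing \<open>mean\<close> by \<open>lam\<close>, from the lower bound and from the upper bound in
  \<open>prob_longest_less_bounds\<close>.\<close>
definition err_const :: "real \<Rightarrow> real \<Rightarrow> real" where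
  "err_const p c = 2 * c / (1 - p) + 48 * c ^ 3 / (1 - p) + 16 * c\<^sup>2 / (1 - p) * (1 + 2 * c / ((1 - p) * p))"

text \<open>For fixed \<open>c\<close> the last four assumptions hold once n is large.
  \<open>s1\<close> is the input of \<open>pair_bound_le\<close>, \<open>s2\<close> makes the
  neighbourhood sum at most 1/4, \<open>s3\<close> makes the mean at most twice \<open>lam\<close>,
  and \<open>s4\<close> bounds the total exponent E by 1, so that exp E and exp (- E) may be
  linearised.\<close>

lemma (in iid_ones) prob_longest_less_exp:
  fixes c :: real
  defines "L \<equiv> \<lambda>n. ln (real n)"
  assumes r: "r \<ge> 2" and n: "n \<ge> 1" and rc: "real r + 1 \<le> c * L n" and L1: "L n \<ge> 1" "c * L n \<ge> 1"
    and x: "(real n)\<^sup>2 * p ^ r \<le> L n ^ 3 / p"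
    and s1: "(c * L n) ^ 12 * (L n ^ 3 / p)\<^sup>2 \<le> p\<^sup>2 * real n"
    and s2: "(c * L n)\<^sup>2 * (L n ^ 3 / p) \<le> real n / 4"
    and s3: "2 * (c * L n) / (1 - p) \<le> real n"
    and s4: "err_const p c * L n ^ 3 * (1 + L n ^ 3 / p)\<^sup>2 \<le> real n"
  shows "\<bar>prob {\<omega> \<in> space M. longest n \<omega> < r} * exp (lam p n r) - 1\<bar>
    \<le> 2 * (err_const p c * L n ^ 3 * (1 + lam p n r)\<^sup>2 / real n)"
proof -
  define B where "B = c * L n"
  define l where "l = lam p n r"
  define y where "y = (real n)\<^sup>2 * p ^ r"
  define \<delta> where "\<delta> = real ((r + 1)\<^sup>2 * n) * p ^ r"
  define q where "q = 1 - p"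
  define P where "P = prob {\<omega> \<in> space M. longest n \<omega> < r}"
  define m where "m = mean n r"
  have n0: "real n > 0" using n by simp
  have c0: "c \<ge> 0"
  proof (rule ccontr)
    assume "\<not> c \<ge> 0"
    then have "c * L n \<le> 0" using L1(1) by (intro mult_nonpos_nonneg) auto
    then show False using L1(2) by linarith
  qed
  have q0: "0 < q" "q < 1" using p_pos p_less_1 by (auto simp: q_def)
  have y0: "0 \<le> y" using p_pos by (simp add: y_def)
  have B: "real r + 1 \<le> B" "1 \<le> B" using rc L1 by (auto simp: B_def)
  have l: "q * y / (2 * real r) \<le> l" "l \<le> y" "0 \<le> l"
    using lam_bounds[OF p_pos p_less_1 r, of n] by (auto simp: q_def y_def l_def)
  \<comment> \<open>\<open>lam\<close> is smaller than n^2 p^r by a factor of order r, so expressing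
    an error through \<open>lam\<close> costs one factor \<open>B\<close>. With the B^2 from the
    size of a neighbourhood this makes up the cube of ln n.\<close>
  have yl: "y \<le> 2 * B / q * l"
  proof -
    have "y \<le> 2 * real r / q * l" using l(1) r q0 by (simp add: field_simps)
    also have "\<dots> \<le> 2 * B / q * l"
      using B q0 l by (intro mult_right_mono divide_right_mono) auto
    finally show ?thesis .
  qed
  have yn: "y / real n \<le> 2 * B / q * l / real n" using yl n0 by (intro divide_right_mono) auto
  have "2 * B / q * l \<le> real n * l"
    using s3 l by (intro mult_right_mono) (auto simp: B_def q_def)
  then have "2 * B / q * l / real n \<le> l" by (metis pos_divide_le_eq[OF n0] mult.commute)
  moreover have ml: "\<bar>m - l\<bar> \<le> y / real n"
  proof -
    have "real n * p ^ r = y / real n" using n0 by (simp add: y_def power2_eq_square)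
    then show ?thesis using mean_lam_diff[OF r, of n] by (simp add: m_def l_def)
  qed
  ultimately have m2: "m \<le> 2 * l" using yn by linarith
  have m0: "0 \<le> m" unfolding m_def mean_def by (intro sum_nonneg) auto
  have \<delta>: "\<delta> \<le> B\<^sup>2 * y / real n"
  proof -
    have "\<delta> = (real r + 1)\<^sup>2 * (y / real n)"
      using n0 by (simp add: \<delta>_def y_def power2_eq_square algebra_simps)
    also have "\<dots> \<le> B\<^sup>2 * (y / real n)" using B y0 n0 by (intro mult_right_mono power_mono) auto
    finally show ?thesis by simp
  qed
  have \<delta>0: "0 \<le> \<delta>" using p_pos by (simp add: \<delta>_def)
  have "B\<^sup>2 * y \<le> B\<^sup>2 * (L n ^ 3 / p)" using x by (intro mult_left_mono) (auto simp: y_def)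
  then have "B\<^sup>2 * y \<le> real n / 4" using s2 unfolding B_def[symmetric] by linarith
  then have "B\<^sup>2 * y / real n \<le> 1 / 4" using n0 by (simp add: pos_divide_le_eq)
  then have \<delta>4: "\<delta> \<le> 1 / 4" using \<delta> by linarith
  define pb where "pb = pair_bound n r"
  have pb0: "0 \<le> pb" using p_pos by (simp add: pb_def pair_bound_def)
  have "B ^ 12 * y\<^sup>2 \<le> B ^ 12 * (L n ^ 3 / p)\<^sup>2"
    using x y0 B by (intro mult_left_mono power_mono) (auto simp: y_def)
  then have pb: "pb \<le> 4 * B\<^sup>2 * (1 + y / p) / real n"
    unfolding pb_def y_def using s1 B r n by (intro pair_bound_le) (auto simp: B_def y_def)
  have lo: "exp (- (1 + 12 * \<delta>) * m) \<le> P" and hi: "P \<le> exp (- m + 2 * (m / q * pb))"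
    using prob_longest_less_bounds[OF n r \<delta>4[unfolded \<delta>_def]]
    by (auto simp: \<delta>_def m_def P_def q_def pb_def)
  define E where "E = err_const p c * L n ^ 3 * (1 + l)\<^sup>2 / real n"
  have e1: "2 * B / q * l / real n \<le> 2 * c / q * (L n ^ 3 * (1 + l)\<^sup>2 / real n)"
    and e2: "12 * \<delta> * m \<le> 48 * c ^ 3 / q * (L n ^ 3 * (1 + l)\<^sup>2 / real n)"
    and e3: "2 * (m / q * pb) \<le> 16 * c\<^sup>2 / q * (1 + 2 * c / (q * p)) * (L n ^ 3 * (1 + l)\<^sup>2 / real n)"
  proof -
    have L13: "L n \<le> L n ^ 3" "L n ^ 2 \<le> L n ^ 3"
      using L1 power_increasing[of 1 3 "L n"] power_increasing[of 2 3 "L n"] by auto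
    have l1: "l \<le> (1 + l)\<^sup>2" "l\<^sup>2 \<le> (1 + l)\<^sup>2" using l by (auto simp: power2_eq_square algebra_simps)
    have "L n * l \<le> L n ^ 3 * (1 + l)\<^sup>2" using L13 l1 l L1 by (intro mult_mono) auto
    then have "2 * c / q / real n * (L n * l) \<le> 2 * c / q / real n * (L n ^ 3 * (1 + l)\<^sup>2)"
      using c0 q0 n0 by (intro mult_left_mono) auto
    then show "2 * B / q * l / real n \<le> 2 * c / q * (L n ^ 3 * (1 + l)\<^sup>2 / real n)"
      by (simp add: B_def)
    have "12 * \<delta> * m \<le> 12 * (B\<^sup>2 * (2 * B / q * l) / real n) * (2 * l)"
    proof (intro mult_mono)
      show "\<delta> \<le> B\<^sup>2 * (2 * B / q * l) / real n"
        using \<delta> yl n0 by (meson divide_right_mono less_imp_le mult_left_mono order_trans zero_le_power2)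
    qed (use m2 m0 B q0 l n0 \<delta>0 in auto)
    also have "\<dots> = 48 * c ^ 3 / q * (L n ^ 3 * l\<^sup>2 / real n)"
      by (simp add: B_def power2_eq_square power3_eq_cube)
    also have "\<dots> \<le> 48 * c ^ 3 / q * (L n ^ 3 * (1 + l)\<^sup>2 / real n)"
      using l1 c0 q0 n0 L1 by (intro mult_left_mono divide_right_mono) auto
    finally show "12 * \<delta> * m \<le> 48 * c ^ 3 / q * (L n ^ 3 * (1 + l)\<^sup>2 / real n)" .
    have yp: "1 + y / p \<le> L n * ((1 + 2 * c / (q * p)) * (1 + l))"
    proof -
      have "y / p \<le> 2 * B / q * l / p" using yl p_pos by (intro divide_right_mono) auto
      also have "\<dots> = L n * (2 * c / (q * p) * l)" by (simp add: B_def)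
      finally have "1 + y / p \<le> L n * 1 + L n * (2 * c / (q * p) * l)" using L1 by simp
      also have "\<dots> = L n * (1 + 2 * c / (q * p) * l)" by (simp add: algebra_simps)
      also have "\<dots> \<le> L n * ((1 + 2 * c / (q * p)) * (1 + l))"
      proof (rule mult_left_mono)
        have "1 + k * l \<le> (1 + k) * (1 + l)" if "0 \<le> k" for k
          using that l(3) by (simp add: algebra_simps)
        from this[of "2 * c / (q * p)"]
        show "1 + 2 * c / (q * p) * l \<le> (1 + 2 * c / (q * p)) * (1 + l)"
          using c0 q0 p_pos by (simp only: divide_nonneg_pos mult_pos_pos)
      qed (use L1 in simp)
      finally show ?thesis .
    qed
    have "2 * (m / q * pb) \<le> 2 * ((2 * l) / q * (4 * B\<^sup>2 * (1 + y / p) / real n))"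
      using m2 m0 pb pb0 q0 l by (intro mult_left_mono mult_mono divide_right_mono) auto
    also have "\<dots> \<le> 2 * ((2 * l) / q * (4 * B\<^sup>2 * (L n * ((1 + 2 * c / (q * p)) * (1 + l))) / real n))"
      using yp l q0 n0 by (intro mult_left_mono divide_right_mono) auto
    also have "\<dots> = 16 * c\<^sup>2 / q * (1 + 2 * c / (q * p)) * (L n ^ 3 * (l * (1 + l)) / real n)"
      by (simp add: B_def power2_eq_square power3_eq_cube)
    also have "\<dots> \<le> 16 * c\<^sup>2 / q * (1 + 2 * c / (q * p)) * (L n ^ 3 * (1 + l)\<^sup>2 / real n)"
      using l c0 q0 p_pos n0 L1 unfolding power2_eq_square[of "1 + l"]
      by (intro mult_left_mono divide_right_mono mult_right_mono) auto
    finally show "2 * (m / q * pb) \<le> 16 * c\<^sup>2 / q * (1 + 2 * c / (q * p)) * (L n ^ 3 * (1 + l)\<^sup>2 / real n)" .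
  qed
  have E: "E = 2 * c / q * (L n ^ 3 * (1 + l)\<^sup>2 / real n) + 48 * c ^ 3 / q * (L n ^ 3 * (1 + l)\<^sup>2 / real n)
    + 16 * c\<^sup>2 / q * (1 + 2 * c / (q * p)) * (L n ^ 3 * (1 + l)\<^sup>2 / real n)"
    unfolding E_def err_const_def q_def[symmetric] by (simp add: algebra_simps add_divide_distrib)
  have nonneg: "0 \<le> 12 * \<delta> * m" "0 \<le> 2 * (m / q * pb)"
    using \<delta>0 m0 q0 pb0 by auto
  have E0: "0 \<le> E" and lm: "l - m \<ge> - (y / real n)" "l - m \<le> y / real n"
    using E e1 e2 e3 nonneg yn y0 n0 ml divide_nonneg_pos[of y "real n"] by linarith+
  have E1: "E \<le> 1"
  proof -
    have "(1 + l)\<^sup>2 \<le> (1 + L n ^ 3 / p)\<^sup>2" using l x by (intro power_mono) (auto simp: y_def)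
    moreover have "err_const p c \<ge> 0"
    proof -
      show ?thesis using c0 p_pos p_less_1 unfolding err_const_def by auto
    qed
    ultimately have "err_const p c * L n ^ 3 * (1 + l)\<^sup>2 \<le> err_const p c * L n ^ 3 * (1 + L n ^ 3 / p)\<^sup>2"
      using L1 by (intro mult_left_mono) auto
    then show ?thesis using s4 n0 by (simp add: E_def)
  qed
  have "P * exp l \<le> exp (- m + 2 * (m / q * pb)) * exp l" using hi by (intro mult_right_mono) auto
  also have "\<dots> = exp (l - m + 2 * (m / q * pb))" by (simp add: exp_add[symmetric])
  also have "\<dots> \<le> exp E" using E e1 e2 e3 nonneg yn lm by simp
  finally have up: "P * exp l \<le> exp E" .
  have "exp (- E) \<le> exp (- (1 + 12 * \<delta>) * m + l)"
    using E e1 e2 e3 nonneg yn lm by (simp add: algebra_simps)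
  also have "\<dots> \<le> P * exp l" unfolding exp_add using lo by (intro mult_right_mono) auto
  finally have down: "exp (- E) \<le> P * exp l" .
  have "\<bar>P * exp l - 1\<bar> \<le> 2 * E"
    using up down abs_exp_minus_1_le[of E] abs_exp_minus_1_le[of "- E"] E0 E1 by linarith
  then show ?thesis unfolding P_def l_def E_def .
qed

section \<open>Asymptotics of the distribution\<close>

text \<open>Kept outside the locale, with measure and sequence as arguments, so that one eventual
  statement can be quantified over all sequences.\<close>

definition below :: "'a measure \<Rightarrow> (nat \<Rightarrow> 'a \<Rightarrow> real) \<Rightarrow> nat \<Rightarrow> nat \<Rightarrow> real" where
  "below M \<xi> n r = measure M {\<omega> \<in> space M. longest_ap (\<lambda>i. \<xi> i \<omega>) n < r}"

lemma (in iid_ones) below_eq: "below M \<xi> n r = prob {\<omega> \<in> space M. longest n \<omega> < r}"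
  unfolding below_def longest_def ..

lemma (in iid_ones) below_mono:
  assumes "n \<ge> 1" "2 \<le> r" "r \<le> r'"
  shows "below M \<xi> n r \<le> below M \<xi> n r'"
  unfolding below_eq using assms by (intro finite_measure_mono longest_less_event) auto

lemma (in iid_ones) below_le_1: "below M \<xi> n r \<le> 1" "0 \<le> below M \<xi> n r"
  unfolding below_def by auto

text \<open>Both factors are 1 + O(1/n): the probability by the union bound, the exponential because
  \<open>lam\<close> is at most n^2 p^r. This disposes of lengths beyond a multiple of ln n.\<close>

lemma (in iid_ones) below_far_tail:
  assumes n: "n \<ge> 1" and r: "r \<ge> 2" and x: "(real n)\<^sup>2 * p ^ r \<le> 1 / real n"
  shows "\<bar>below M \<xi> n r * exp (lam p n r) - 1\<bar> \<le> 2 / real n"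
proof -
  define P where "P = below M \<xi> n r"
  define l where "l = lam p n r"
  have n1: "1 / real n \<le> 1" using n by simp
  have l: "0 \<le> l" "l \<le> 1 / real n"
    using lam_bounds[OF p_pos p_less_1 r, of n] x by (auto simp: l_def)
  have "1 - P \<le> (real n)\<^sup>2 / (2 * (real r - 1)) * p ^ r"
    unfolding P_def below_eq by (rule prob_longest_ge_le[OF n r])
  also have "\<dots> = (real n)\<^sup>2 * p ^ r / (2 * (real r - 1))" by simp
  also have "\<dots> \<le> (real n)\<^sup>2 * p ^ r / 1" using r p_pos by (intro divide_left_mono) auto
  finally have P: "1 - 1 / real n \<le> P" "P \<le> 1"
    using x below_le_1[of n r] by (auto simp: P_def)
  have "exp l \<ge> 1" using l by simp
  moreover have "P * 1 \<le> P * exp l"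
    using calculation below_le_1 by (intro mult_left_mono) (auto simp: P_def)
  moreover have "P * exp l \<le> 1 * exp l" using P by (intro mult_right_mono) auto
  moreover have "\<bar>exp l - 1\<bar> \<le> 2 * l" using abs_exp_minus_1_le[of l] l n1 by auto
  moreover have "0 \<le> 1 / real n" by simp
  ultimately have "P * exp l - 1 \<le> 2 * (1 / real n)" "- (P * exp l - 1) \<le> 2 * (1 / real n)"
    using P l by linarith+
  then have "\<bar>P * exp l - 1\<bar> \<le> 2 / real n" by simp
  then show ?thesis unfolding P_def l_def .
qed

lemma power_eq_exp_ln: "0 < p \<Longrightarrow> p ^ r = exp (real r * ln p)" for p :: real
  by (simp add: exp_of_nat_mult)

lemma square_eq_exp_ln: "n \<ge> 1 \<Longrightarrow> (real n)\<^sup>2 = exp (2 * ln (real n))"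
  using exp_of_nat_mult[of 2 "ln (real n)"] by simp

text \<open>The estimate is uniform over all i.i.d. sequences with the same \<open>p\<close>, so that it can be applied
  to shifted sequences as well.\<close>
lemma below_asymp:
  fixes p :: real
  assumes p: "0 < p" "p < 1"
  shows "\<exists>K>0. \<forall>\<^sub>F n in sequentially. \<forall>(M :: 'a measure) \<xi> r. iid_ones M \<xi> p \<longrightarrow> r \<ge> 2 \<longrightarrow>
    (real n)\<^sup>2 * p ^ r \<le> ln (real n) ^ 3 / p \<longrightarrow>
    \<bar>below M \<xi> n r * exp (lam p n r) - 1\<bar> \<le> K * (ln (real n) ^ 3 * (1 + lam p n r)\<^sup>2 / real n)"
proof -
  define b where "b = - ln p"
  have b: "b > 0" using p by (simp add: b_def)
  \<comment> \<open>If r + 1 > c ln n, then r > (4 / b) ln n, the summand 1 of \<open>c\<close>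
    absorbing the shift of r. Then n^2 p^r is at most 1/n and the far tail estimate applies.\<close>
  define c where "c = 4 / b + 1"
  have c: "c \<ge> 1" using b by (simp add: c_def)
  define e where "e = err_const p c"
  have e: "e \<ge> 0" using c p by (simp add: e_def err_const_def)
  have c0: "c > 0" using c by linarith
  have "\<forall>\<^sub>F n in sequentially. n \<ge> (1::nat)" by (rule eventually_ge_at_top)
  moreover have "\<forall>\<^sub>F n in sequentially. ln (real n) \<ge> 1" by real_asymp
  moreover have "\<forall>\<^sub>F n in sequentially. (c * ln (real n)) ^ 12 * (ln (real n) ^ 3 / p)\<^sup>2 \<le> p\<^sup>2 * real n"
    using p c0 by real_asymp
  moreover have "\<forall>\<^sub>F n in sequentially. (c * ln (real n))\<^sup>2 * (ln (real n) ^ 3 / p) \<le> real n / 4"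
    using p c0 by real_asymp
  moreover have "\<forall>\<^sub>F n in sequentially. 2 * (c * ln (real n)) / (1 - p) \<le> real n"
    using p c0 by real_asymp
  moreover have "\<forall>\<^sub>F n in sequentially. (e + 1) * ln (real n) ^ 3 * (1 + ln (real n) ^ 3 / p)\<^sup>2 \<le> real n"
    using p e by real_asymp
  ultimately have "\<forall>\<^sub>F n in sequentially. \<forall>(M :: 'a measure) \<xi> r. iid_ones M \<xi> p \<longrightarrow> r \<ge> 2 \<longrightarrow>
    (real n)\<^sup>2 * p ^ r \<le> ln (real n) ^ 3 / p \<longrightarrow>
    \<bar>below M \<xi> n r * exp (lam p n r) - 1\<bar> \<le> (2 + 2 * e) * (ln (real n) ^ 3 * (1 + lam p n r)\<^sup>2 / real n)"
  proof eventually_elim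
    case (elim n)
    define L where "L = ln (real n)"
    show ?case
    proof (intro allI impI)
      fix M :: "'a measure" and \<xi> :: "nat \<Rightarrow> 'a \<Rightarrow> real" and r :: nat
      assume iid: "iid_ones M \<xi> p" and r: "r \<ge> 2" and x: "(real n)\<^sup>2 * p ^ r \<le> ln (real n) ^ 3 / p"
      interpret iid_ones M \<xi> p by (rule iid)
      define T where "T = L ^ 3 * (1 + lam p n r)\<^sup>2 / real n"
      have l0: "0 \<le> lam p n r" using lam_bounds[OF p r] by simp
      have L: "L \<ge> 1" using elim by (simp add: L_def)
      have n0: "real n > 0" using elim by simp
      have T0: "0 \<le> T" using L n0 by (simp add: T_def)
      have "\<bar>below M \<xi> n r * exp (lam p n r) - 1\<bar> \<le> (2 + 2 * e) * T"
      proof (cases "real r + 1 \<le> c * L")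
        case True
        have "1 * 1 \<le> c * L" using c L by (intro mult_mono) auto
        moreover have "e * L ^ 3 * (1 + L ^ 3 / p)\<^sup>2 \<le> (e + 1) * L ^ 3 * (1 + L ^ 3 / p)\<^sup>2"
          using L by (intro mult_right_mono) auto
        ultimately have "\<bar>prob {\<omega> \<in> space M. longest n \<omega> < r} * exp (lam p n r) - 1\<bar> \<le> 2 * (e * L ^ 3 * (1 + lam p n r)\<^sup>2 / real n)"
          unfolding e_def L_def using elim True r x by (intro prob_longest_less_exp) (auto simp: L_def e_def)
        then have "\<bar>below M \<xi> n r * exp (lam p n r) - 1\<bar> \<le> 2 * e * T"
          unfolding below_eq T_def by simp
        then show ?thesis using T0 by (simp add: algebra_simps)
      next
        case False
        have "real r > 4 / b * L" using False L by (simp add: c_def algebra_simps)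
        then have "4 * L < real r * b" using b by (simp add: field_simps)
        then have "2 * L - real r * b \<le> - L" using L by linarith
        then have "exp (2 * L - real r * b) \<le> exp (- L)" by simp
        also have "exp (- L) = 1 / real n" using n0 by (simp add: L_def exp_minus field_simps)
        also have "exp (2 * L - real r * b) = (real n)\<^sup>2 * p ^ r"
          unfolding power_eq_exp_ln[OF p(1)] square_eq_exp_ln[OF elim(1)] exp_add[symmetric]
          by (simp add: b_def L_def)
        finally have "\<bar>below M \<xi> n r * exp (lam p n r) - 1\<bar> \<le> 2 / real n"
          using elim(1) r by (intro below_far_tail)
        also have "\<dots> \<le> 2 * T"
        proof -
          have "1 * 1 \<le> L ^ 3 * (1 + lam p n r)\<^sup>2" using L l0 by (intro mult_mono) auto
          then show ?thesis using n0 unfolding T_def by (simp add: divide_right_mono)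
        qed
        also have "\<dots> \<le> (2 + 2 * e) * T" using T0 e by (intro mult_right_mono) auto
        finally show ?thesis .
      qed
      then show "\<bar>below M \<xi> n r * exp (lam p n r) - 1\<bar> \<le> (2 + 2 * e) * (ln (real n) ^ 3 * (1 + lam p n r)\<^sup>2 / real n)"
        unfolding T_def L_def .
    qed
  qed
  then show ?thesis using e by (intro exI[of _ "2 + 2 * e"]) auto
qed

text \<open>Absorbs the factor (1 + lam)^2 of the relative error. The 4 is the square of the factor
  in 1 + x \<le> 2 exp (x / 2).\<close>

lemma exp_minus_mult_square_le: "0 \<le> x \<Longrightarrow> exp (- x) * (1 + x)\<^sup>2 \<le> 4" for x :: real
proof -
  assume x: "0 \<le> x"
  have "1 + x \<le> 2 * exp (x / 2)" using exp_ge_add_one_self[of "x / 2"] x by linarith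
  then have "(1 + x)\<^sup>2 \<le> (2 * exp (x / 2))\<^sup>2" using x by (intro power_mono) auto
  also have "\<dots> = 4 * exp x" by (simp add: power_mult_distrib exp_double[symmetric])
  finally show ?thesis by (simp add: exp_minus field_simps)
qed

section \<open>Absolute error, uniform in the length\<close>

context iid_ones
begin

text \<open>For n^2 p^r \<le> ln^3 n / p the relative error is multiplied by exp (- lam), which
  absorbs its growth in \<open>lam\<close>. For shorter lengths both quantities are close to 0: the
  exponential directly, the probability by monotonicity from the first length inside that
  range.\<close>

lemma below_sub_exp_le:
  "\<exists>K. \<forall>\<^sub>F n in sequentially. \<forall>r. r \<ge> 2 \<longrightarrow>
    \<bar>below M \<xi> n r - exp (- lam p n r)\<bar> \<le> K * (ln (real n) ^ 3 / real n)"
proof -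
  define b where "b = - ln p"
  have b: "b > 0" using p_pos p_less_1 by (simp add: b_def)
  \<comment> \<open>If n^2 p^r > ln^3 n, then r b < 2 ln n, and the lower bound (1 - p) n^2 p^r / (2
    r) for \<open>lam\<close> exceeds (1 - p) ln^3 n / (4 ln n / b) = g ln^2 n.\<close>
  define g where "g = (1 - p) * b / 4"
  have g: "g > 0" using b p_less_1 by (simp add: g_def)
  obtain K where K: "K > 0" and ev: "\<forall>\<^sub>F n in sequentially. \<forall>(M :: 'a measure) \<xi> r. iid_ones M \<xi> p \<longrightarrow> r \<ge> 2 \<longrightarrow>
    (real n)\<^sup>2 * p ^ r \<le> ln (real n) ^ 3 / p \<longrightarrow>
    \<bar>below M \<xi> n r * exp (lam p n r) - 1\<bar> \<le> K * (ln (real n) ^ 3 * (1 + lam p n r)\<^sup>2 / real n)"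
    using below_asymp[OF p_pos p_less_1] by blast
  have "\<forall>\<^sub>F n in sequentially. ln (real n) \<ge> 1" by real_asymp
  moreover have "\<forall>\<^sub>F n in sequentially. g * ln (real n) \<ge> 1" using g by real_asymp
  moreover have "\<forall>\<^sub>F n in sequentially. n \<ge> (1::nat)" by (rule eventually_ge_at_top)
  ultimately have "\<forall>\<^sub>F n in sequentially. \<forall>r. r \<ge> 2 \<longrightarrow>
    \<bar>below M \<xi> n r - exp (- lam p n r)\<bar> \<le> (4 * K + 1) * (ln (real n) ^ 3 / real n)"
    using ev
  proof eventually_elim
    case (elim n)
    define L where "L = ln (real n)"
    have L: "L \<ge> 1" using elim by (simp add: L_def)
    have L3: "L ^ 3 \<ge> 1" using L by simp
    have n0: "real n > 0" using elim by simp
    have n2: "(real n)\<^sup>2 = exp (2 * L)" using square_eq_exp_ln[of n] elim by (simp add: L_def)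
    have main: "\<bar>below M \<xi> n r - exp (- lam p n r)\<bar> \<le> 4 * K * (L ^ 3 / real n)"
      if r: "r \<ge> 2" and x: "(real n)\<^sup>2 * p ^ r \<le> L ^ 3 / p" for r
    proof -
      define l where "l = lam p n r"
      have l: "0 \<le> l" using lam_bounds[OF p_pos p_less_1 r] by (simp add: l_def)
      have "below M \<xi> n r - exp (- l) = exp (- l) * (below M \<xi> n r * exp l - 1)"
        by (simp add: exp_minus field_simps)
      then have "\<bar>below M \<xi> n r - exp (- l)\<bar> = exp (- l) * \<bar>below M \<xi> n r * exp l - 1\<bar>"
        by (simp add: abs_mult)
      also have "\<dots> \<le> exp (- l) * (K * (L ^ 3 * (1 + l)\<^sup>2 / real n))"
        using elim(4) iid_ones_axioms r x by (intro mult_left_mono) (auto simp: l_def L_def)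
      also have "\<dots> = K * (L ^ 3 / real n) * (exp (- l) * (1 + l)\<^sup>2)" by simp
      also have "\<dots> \<le> K * (L ^ 3 / real n) * 4"
        using K L n0 exp_minus_mult_square_le[OF l] by (intro mult_left_mono) auto
      finally show ?thesis by (simp add: l_def mult.commute mult.left_commute)
    qed
    have large: "exp (- lam p n r) \<le> 1 / real n" "(real r) * b < 2 * L"
      if r: "r \<ge> 2" and x: "(real n)\<^sup>2 * p ^ r > L ^ 3" for r
    proof -
      have "exp 0 < (real n)\<^sup>2 * p ^ r" using x L3 by simp
      also have "\<dots> = exp (2 * L - real r * b)"
        unfolding n2 power_eq_exp_ln[OF p_pos] exp_add[symmetric] by (simp add: b_def)
      finally show rb: "real r * b < 2 * L" by simp
      have "g * L * L = (1 - p) * L ^ 3 / (2 * (2 * L / b))"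
        using b L by (simp add: g_def power3_eq_cube)
      also have "\<dots> \<le> (1 - p) * L ^ 3 / (2 * real r)"
        using rb b r L p_less_1 by (intro divide_left_mono mult_left_mono) (auto simp: field_simps)
      also have "\<dots> \<le> (1 - p) * ((real n)\<^sup>2 * p ^ r) / (2 * real r)"
        using x p_less_1 by (intro divide_right_mono mult_left_mono) auto
      also have "\<dots> \<le> lam p n r" by (rule lam_bounds(1)[OF p_pos p_less_1 r])
      finally have "g * L * L \<le> lam p n r" .
      moreover have "1 * L \<le> g * L * L" using elim(2) L by (intro mult_right_mono) (auto simp: L_def)
      ultimately have "exp (- lam p n r) \<le> exp (- L)" by simp
      also have "\<dots> = 1 / real n" using n0 by (simp add: L_def exp_minus field_simps)
      finally show "exp (- lam p n r) \<le> 1 / real n" .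
    qed
    have split: "(4 * K + 1) * (L ^ 3 / real n) = 4 * K * (L ^ 3 / real n) + L ^ 3 / real n"
      by (simp only: distrib_right mult_1_left)
    have one: "1 / real n \<le> L ^ 3 / real n" using L3 n0 by (intro divide_right_mono) auto
    have "\<bar>below M \<xi> n r - exp (- lam p n r)\<bar> \<le> (4 * K + 1) * (L ^ 3 / real n)" if r: "r \<ge> 2" for r
    proof (cases "(real n)\<^sup>2 * p ^ r \<le> L ^ 3 / p")
      case True
      have "0 \<le> L ^ 3 / real n" using L n0 by simp
      then show ?thesis using main[OF r True] unfolding split by linarith
    next
      case False
      have Lp: "L ^ 3 \<le> L ^ 3 / p"
        using p_pos p_less_1 L by (simp add: le_divide_eq mult_left_le)
      have "(\<lambda>r. (real n)\<^sup>2 * p ^ r) \<longlonglongrightarrow> (real n)\<^sup>2 * 0"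
        using p_pos p_less_1 by (intro tendsto_mult tendsto_const LIMSEQ_power_zero) auto
      moreover have "0 < L ^ 3 / p" using L p_pos by simp
      ultimately have "\<forall>\<^sub>F r in sequentially. (real n)\<^sup>2 * p ^ r < L ^ 3 / p"
        by (intro order_tendstoD(2)) auto
      then obtain r1 where ex: "(real n)\<^sup>2 * p ^ r1 \<le> L ^ 3 / p"
        by (auto simp: eventually_sequentially intro: less_imp_le)
      \<comment> \<open>The first length in the range of the relative estimate. Its predecessor
        violates the threshold ln^3 n / p, so n^2 p^r0 still exceeds ln^3 n: at \<open>r0\<close>
        the relative estimate and the smallness of the exponential hold together. The 1/p in the
        threshold is there for this overlap.\<close>
      define r0 where "r0 = (LEAST r. (real n)\<^sup>2 * p ^ r \<le> L ^ 3 / p)"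
      have r0: "(real n)\<^sup>2 * p ^ r0 \<le> L ^ 3 / p" unfolding r0_def
        by (rule LeastI[where P = "\<lambda>r. (real n)\<^sup>2 * p ^ r \<le> L ^ 3 / p"]) (rule ex)
      have lt: "r < r0"
      proof (rule ccontr)
        assume "\<not> r < r0"
        then have "p ^ r \<le> p ^ r0" using p_pos p_less_1 by (intro power_decreasing) auto
        then have "(real n)\<^sup>2 * p ^ r \<le> (real n)\<^sup>2 * p ^ r0" by (intro mult_left_mono) auto
        then show False using False r0 by linarith
      qed
      have "\<not> (real n)\<^sup>2 * p ^ (r0 - 1) \<le> L ^ 3 / p"
        using not_less_Least[of "r0 - 1" "\<lambda>r. (real n)\<^sup>2 * p ^ r \<le> L ^ 3 / p"] lt
        unfolding r0_def[symmetric] by simp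
      then have "L ^ 3 < (real n)\<^sup>2 * p ^ (r0 - 1) * p" using p_pos by (simp add: field_simps)
      also have "\<dots> = (real n)\<^sup>2 * p ^ r0" using lt by (cases r0) auto
      finally have big0: "L ^ 3 < (real n)\<^sup>2 * p ^ r0" .
      have "below M \<xi> n r \<le> below M \<xi> n r0" using elim r lt by (intro below_mono) auto
      also have "\<dots> \<le> 1 / real n + 4 * K * (L ^ 3 / real n)"
        using main[OF _ r0] large(1)[OF _ big0] lt r by linarith
      finally have "below M \<xi> n r \<le> (4 * K + 1) * (L ^ 3 / real n)" using one unfolding split by linarith
      moreover have "exp (- lam p n r) \<le> 1 / real n" using False Lp by (intro large r) auto
      moreover have "0 \<le> 4 * K * (L ^ 3 / real n)" using K L n0 by simp
      ultimately show ?thesis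
        using below_le_1(2)[of n r] one exp_gt_zero[of "- lam p n r"]
        unfolding split abs_le_iff by linarith
    qed
    then show ?case unfolding L_def by blast
  qed
  then show ?thesis by blast
qed

lemma Max_below_sub_exp:
  "\<exists>K. \<forall>\<^sub>F n in sequentially.
     Max ((\<lambda>r. \<bar>below M \<xi> n r - exp (- lam p n r)\<bar>) ` {1<..n})
       \<le> K * ((ln (real n)) ^ 4 * ln (ln (real n)) / real n)"
proof -
  obtain K where K: "\<forall>\<^sub>F n in sequentially. \<forall>r. r \<ge> 2 \<longrightarrow>
    \<bar>below M \<xi> n r - exp (- lam p n r)\<bar> \<le> K * (ln (real n) ^ 3 / real n)"
    using below_sub_exp_le by blast
  have "\<forall>\<^sub>F n in sequentially. ln (real n) ^ 3 / real n \<le> (ln (real n)) ^ 4 * ln (ln (real n)) / real n"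
    by real_asymp
  moreover have "\<forall>\<^sub>F n in sequentially. n \<ge> (2::nat)" by (rule eventually_ge_at_top)
  ultimately have "\<forall>\<^sub>F n in sequentially.
     Max ((\<lambda>r. \<bar>below M \<xi> n r - exp (- lam p n r)\<bar>) ` {1<..n})
       \<le> \<bar>K\<bar> * ((ln (real n)) ^ 4 * ln (ln (real n)) / real n)"
    using K
  proof eventually_elim
    case (elim n)
    have "\<bar>below M \<xi> n r - exp (- lam p n r)\<bar> \<le> \<bar>K\<bar> * ((ln (real n)) ^ 4 * ln (ln (real n)) / real n)"
      if "r \<in> {1<..n}" for r
    proof -
      have "\<bar>below M \<xi> n r - exp (- lam p n r)\<bar> \<le> K * (ln (real n) ^ 3 / real n)"
        using elim(3) that by auto
      also have "\<dots> \<le> \<bar>K\<bar> * (ln (real n) ^ 3 / real n)"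
        using elim(2) by (intro mult_right_mono) auto
      also have "\<dots> \<le> \<bar>K\<bar> * ((ln (real n)) ^ 4 * ln (ln (real n)) / real n)"
        using elim(1) by (intro mult_left_mono) auto
      finally show ?thesis .
    qed
    then show ?case using elim(2) by (subst Max_le_iff) auto
  qed
  then show ?thesis by blast
qed

end

section \<open>The distribution around its centre\<close>

abbreviation lln :: "nat \<Rightarrow> real" where
  "lln n \<equiv> ln (ln (real n))"

text \<open>This is h_n, chosen such that p^(h_n) = ln n / n^2. Then n^2 p^r = ln n at r = h_n, and
  division by 2 r with r about - 2 ln n / ln p leaves the bounded intensity - q ln p / 4.\<close>

definition ap_center :: "real \<Rightarrow> nat \<Rightarrow> real" where
  "ap_center p n = - 2 / ln p * ln (real n) + 1 / ln p * lln n"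

lemma mult_exp_minus_le_1: "u * exp (- u) \<le> 1" for u :: real
proof -
  have "u \<le> exp u" using exp_ge_add_one_self[of u] by linarith
  then show ?thesis by (simp add: exp_minus field_simps)
qed

text \<open>Here L = ln n, l = ln ln n, R is the length and exp (- b x) = p^x. As b R = 2 L - l + b
  x, replacing (p + q R) / (2 R (R - 1)) by q b / (4 L) makes a relative error of order (l + |b x|)
  / L. Since x is not bounded above, |b x| may exceed l by far; the decay of exp (- b x)
  compensates, by u exp (- u) \<le> 1 for u = b x + a l.\<close>

lemma real_lam_intensity_diff:
  fixes L R b q p x l a :: real
  assumes b: "0 < b" and q: "0 \<le> q" "q \<le> 1" and p: "0 \<le> p" "p \<le> 1" and L: "L > 0" and l: "l \<ge> 1"
    and R: "R \<ge> 2" "L \<le> b * R" and bR: "b * R = 2 * L - l + b * x" and x: "b * x \<ge> - (a * l)"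
  shows "\<bar>L * exp (- b * x) * ((p + q * R) / (2 * R * (R - 1))) - q * b / 4 * exp (- b * x)\<bar>
    \<le> b / 2 * (2 + \<bar>a\<bar> + 3 * b) * (exp (a * l) * l / L)"
proof -
  define y where "y = exp (- b * x)"
  define u where "u = b * x + a * l"
  have u: "u \<ge> 0" using x by (simp add: u_def)
  have y: "y = exp (a * l) * exp (- u)" by (simp add: y_def u_def exp_add[symmetric])
  have ye: "y \<le> exp (a * l)" "y * u \<le> exp (a * l)"
  proof -
    show "y \<le> exp (a * l)" unfolding y using u by simp
    have "y * u = exp (a * l) * (u * exp (- u))" unfolding y by simp
    also have "\<dots> \<le> exp (a * l) * 1" by (intro mult_left_mono mult_exp_minus_le_1) auto
    finally show "y * u \<le> exp (a * l)" by simp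
  qed
  have y0: "0 \<le> y" by (simp add: y_def)
  have R1: "R * (R - 1) > 0" using R by (intro mult_pos_pos) auto
  have "L * ((p + q * R) / (2 * R * (R - 1))) - q * b / 4
      = (2 * L * (p + q * R) - q * b * (R * (R - 1))) / (4 * (R * (R - 1)))"
    using R by (simp add: field_simps)
  also have "2 * L * (p + q * R) - q * b * (R * (R - 1)) = 2 * L * p + q * R * (2 * L - b * R + b)"
    by (simp add: algebra_simps)
  also have "2 * L - b * R + b = l - b * x + b" using bR by simp
  finally have eq: "L * ((p + q * R) / (2 * R * (R - 1))) - q * b / 4
      = (2 * L * p + q * R * (l - b * x + b)) / (4 * (R * (R - 1)))" .
  have num: "\<bar>2 * L * p + q * R * (l - b * x + b)\<bar> \<le> R * (l + \<bar>b * x\<bar> + 3 * b)"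
  proof -
    have "\<bar>2 * L * p\<bar> \<le> 2 * (b * R) * 1"
      using L p R(2) unfolding abs_mult by (intro mult_mono) auto
    moreover have "\<bar>q * R * (l - b * x + b)\<bar> \<le> 1 * R * (l + \<bar>b * x\<bar> + b)"
    proof -
      have "\<bar>l - b * x + b\<bar> \<le> l + \<bar>b * x\<bar> + b" using l b by linarith
      then show ?thesis
        unfolding abs_mult[of "q * R"] abs_mult[of q] using q R by (intro mult_mono) auto
    qed
    ultimately have "\<bar>2 * L * p + q * R * (l - b * x + b)\<bar> \<le> 2 * (b * R) * 1 + 1 * R * (l + \<bar>b * x\<bar> + b)"
      by linarith
    also have "\<dots> = R * (l + \<bar>b * x\<bar> + 3 * b)" by (simp add: algebra_simps)
    finally show ?thesis .
  qed
  have "\<bar>L * ((p + q * R) / (2 * R * (R - 1))) - q * b / 4\<bar> \<le> R * (l + \<bar>b * x\<bar> + 3 * b) / (4 * (R * (R - 1)))"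
    unfolding eq abs_divide using num R1 by (intro frac_le) auto
  also have "\<dots> = (l + \<bar>b * x\<bar> + 3 * b) / (4 * (R - 1))" using R by simp
  also have "\<dots> \<le> (l + \<bar>b * x\<bar> + 3 * b) / (2 * (L / b))"
  proof -
    have "L / b \<le> R" using R(2) b by (simp add: field_simps)
    then have "2 * (L / b) \<le> 2 * R" by (intro mult_left_mono) auto
    also have "2 * R \<le> 4 * (R - 1)" using R(1) by simp
    finally have "2 * (L / b) \<le> 4 * (R - 1)" .
    moreover have "0 < 2 * (L / b) * (4 * (R - 1))" using b L R(1) by (intro mult_pos_pos) auto
    ultimately show ?thesis using b l by (intro divide_left_mono) (auto simp: mult.commute)
  qed
  also have "\<dots> = b / 2 * (l + \<bar>b * x\<bar> + 3 * b) / L" using b L by simp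
  finally have rho: "\<bar>L * ((p + q * R) / (2 * R * (R - 1))) - q * b / 4\<bar> \<le> b / 2 * (l + \<bar>b * x\<bar> + 3 * b) / L" .
  have "\<bar>b * x\<bar> \<le> u + \<bar>a\<bar> * l"
  proof -
    have "\<bar>a * l\<bar> = \<bar>a\<bar> * l" using l by (simp add: abs_mult)
    then show ?thesis using u by (simp add: u_def)
  qed
  then have "y * (l + \<bar>b * x\<bar> + 3 * b) \<le> y * (l + (u + \<bar>a\<bar> * l) + 3 * b)"
    using y0 by (intro mult_left_mono) auto
  also have "\<dots> = y * (l + \<bar>a\<bar> * l + 3 * b) + y * u" by (simp add: algebra_simps)
  also have "\<dots> \<le> exp (a * l) * (l + \<bar>a\<bar> * l + 3 * b) + exp (a * l) * 1"
    using ye l b by (intro add_mono mult_right_mono) auto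
  also have "\<dots> = exp (a * l) * (l + \<bar>a\<bar> * l + 3 * b + 1)" by (simp add: algebra_simps)
  also have "\<dots> \<le> exp (a * l) * ((2 + \<bar>a\<bar> + 3 * b) * l)"
  proof (rule mult_left_mono)
    have "3 * b * 1 \<le> 3 * b * l" using l b by (intro mult_left_mono) auto
    then show "l + \<bar>a\<bar> * l + 3 * b + 1 \<le> (2 + \<bar>a\<bar> + 3 * b) * l" using l by (simp add: algebra_simps)
  qed simp
  finally have ybound: "y * (l + \<bar>b * x\<bar> + 3 * b) \<le> exp (a * l) * ((2 + \<bar>a\<bar> + 3 * b) * l)" .
  have "L * y * ((p + q * R) / (2 * R * (R - 1))) - q * b / 4 * y
      = y * (L * ((p + q * R) / (2 * R * (R - 1))) - q * b / 4)" by (simp add: algebra_simps)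
  then have "\<bar>L * y * ((p + q * R) / (2 * R * (R - 1))) - q * b / 4 * y\<bar>
      = y * \<bar>L * ((p + q * R) / (2 * R * (R - 1))) - q * b / 4\<bar>" using y0 by (simp add: abs_mult)
  also have "\<dots> \<le> y * (b / 2 * (l + \<bar>b * x\<bar> + 3 * b) / L)" using y0 rho by (intro mult_left_mono)
  also have "\<dots> = b / 2 / L * (y * (l + \<bar>b * x\<bar> + 3 * b))" by simp
  also have "\<dots> \<le> b / 2 / L * (exp (a * l) * ((2 + \<bar>a\<bar> + 3 * b) * l))"
    using ybound b L by (intro mult_left_mono) auto
  also have "\<dots> = b / 2 * (2 + \<bar>a\<bar> + 3 * b) * (exp (a * l) * l / L)" by simp
  finally show ?thesis unfolding y_def .
qed

text \<open>The error of \<open>below_asymp\<close> is a power of ln n over n and far below the rate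
  claimed. The rate comes from replacing \<open>lam\<close> by its limiting form - (1 - p) ln p / 4
  * p^x.\<close>

lemma below_center_asymp:
  fixes p a :: real
  assumes p: "0 < p" "p < 1" and a: "a < 1"
  shows "\<exists>K>0. \<forall>\<^sub>F n in sequentially. \<forall>(M :: 'a measure) \<xi> x. iid_ones M \<xi> p \<longrightarrow>
    x \<ge> a * (1 / ln p) * lln n \<and> ap_center p n + x \<in> \<int> \<longrightarrow>
    \<bar>exp (- (1 - p) * ln p / 4 * p powr x)
       * measure M {\<omega> \<in> space M. real (longest_ap (\<lambda>i. \<xi> i \<omega>) n) < ap_center p n + x} - 1\<bar>
    \<le> K * (lln n / ln (real n) powr (1 - a))"
proof -
  define b where "b = - ln p"
  have b: "b > 0" using p by (simp add: b_def)
  obtain K where K: "K > 0" and ev: "\<forall>\<^sub>F n in sequentially. \<forall>(M :: 'a measure) \<xi> r. iid_ones M \<xi> p \<longrightarrow> r \<ge> 2 \<longrightarrow>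
    (real n)\<^sup>2 * p ^ r \<le> ln (real n) ^ 3 / p \<longrightarrow>
    \<bar>below M \<xi> n r * exp (lam p n r) - 1\<bar> \<le> K * (ln (real n) ^ 3 * (1 + lam p n r)\<^sup>2 / real n)"
    using below_asymp[OF p] by blast
  define K1 where "K1 = b / 2 * (2 + \<bar>a\<bar> + 3 * b)"
  have K1: "K1 > 0" using b by (simp add: K1_def pos_add_strict)
  have a1: "\<bar>1 + a\<bar> + 1 > 0" by simp
  have "\<forall>\<^sub>F n in sequentially. n \<ge> (1::nat)" by (rule eventually_ge_at_top)
  moreover have "\<forall>\<^sub>F n in sequentially. lln n \<ge> 1" by real_asymp
  moreover have "\<forall>\<^sub>F n in sequentially. ln (real n) \<ge> 1" by real_asymp
  \<comment> \<open>This gives (1 + a) ln ln n \<le> ln n, so that every admissible x keeps b (h_n +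
    x) \<ge> ln n: the lengths in question are at least of order ln n.\<close>
  moreover have "\<forall>\<^sub>F n in sequentially. (\<bar>1 + a\<bar> + 1) * lln n \<le> ln (real n)"
    using a1 by real_asymp
  moreover have "\<forall>\<^sub>F n in sequentially. ln (real n) / b \<ge> 2" using b by real_asymp
  moreover have "\<forall>\<^sub>F n in sequentially. K1 * (lln n / ln (real n) powr (1 - a)) \<le> 1"
    using a K1 by real_asymp
  moreover have "\<forall>\<^sub>F n in sequentially. K * (ln (real n) ^ 3 * (1 + ln (real n) ^ 2)\<^sup>2 / real n) \<le> 1"
    using K by real_asymp
  moreover have "\<forall>\<^sub>F n in sequentially. K * (ln (real n) ^ 3 * (1 + ln (real n) ^ 2)\<^sup>2 / real n)
      \<le> lln n / ln (real n) powr (1 - a)"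
    using K a by real_asymp
  ultimately have "\<forall>\<^sub>F n in sequentially. \<forall>(M :: 'a measure) \<xi> x. iid_ones M \<xi> p \<longrightarrow>
    x \<ge> a * (1 / ln p) * lln n \<and> ap_center p n + x \<in> \<int> \<longrightarrow>
    \<bar>exp (- (1 - p) * ln p / 4 * p powr x)
       * measure M {\<omega> \<in> space M. real (longest_ap (\<lambda>i. \<xi> i \<omega>) n) < ap_center p n + x} - 1\<bar>
    \<le> (4 * K1 + 1) * (lln n / ln (real n) powr (1 - a))"
    using ev
  proof eventually_elim
    case (elim n)
    define L where "L = ln (real n)"
    define l where "l = ln L"
    have L: "L \<ge> 1" "l \<ge> 1" "L > 0" using elim(2,3) unfolding L_def l_def by linarith+
    show ?case
    proof (intro allI impI, elim conjE)
      fix M :: "'a measure" and \<xi> :: "nat \<Rightarrow> 'a \<Rightarrow> real" and x :: real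
      assume iid: "iid_ones M \<xi> p" and x: "x \<ge> a * (1 / ln p) * lln n"
        and int: "ap_center p n + x \<in> \<int>"
      have "ln p = - b" by (simp add: b_def)
      then have bx: "b * x \<ge> - (a * l)" using x b by (simp add: l_def L_def field_simps)
      have hb: "b * ap_center p n = 2 * L - l"
        using b by (simp add: ap_center_def \<open>ln p = - b\<close> L_def l_def field_simps)
      define R where "R = ap_center p n + x"
      have bR: "b * R = 2 * L - l + b * x" using hb by (simp add: R_def algebra_simps)
      have "(1 + a) * l \<le> (\<bar>1 + a\<bar> + 1) * l" using L by (intro mult_right_mono) auto
      also have "\<dots> \<le> L" using elim by (simp add: L_def l_def)
      finally have LR: "L \<le> b * R" using bR bx by (simp add: algebra_simps)
      then have "L / b \<le> R" using b by (simp add: field_simps)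
      then have R2: "R \<ge> 2" using elim by (simp add: L_def)
      obtain r where r: "R = real r"
      proof -
        obtain z where z: "R = of_int z" using int unfolding R_def by (auto elim: Ints_cases)
        then have "R = real (nat z)" using R2 by simp
        then show ?thesis by (rule that)
      qed
      have r2: "r \<ge> 2" using R2 r by simp
      interpret iid_ones M \<xi> p by (rule iid)
      define y where "y = exp (- b * x)"
      have y: "y = p powr x" using p by (simp add: y_def powr_def b_def mult.commute)
      have n2: "(real n)\<^sup>2 * p ^ r = L * y"
      proof -
        have "(real n)\<^sup>2 * p ^ r = exp (2 * L - b * R)"
          unfolding power_eq_exp_ln[OF p(1)] square_eq_exp_ln[OF elim(1)] exp_add[symmetric]
          by (simp add: b_def L_def r)
        also have "2 * L - b * R = l + (- b * x)" using bR by simp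
        also have "exp (l + (- b * x)) = L * y" unfolding exp_add using L by (simp add: l_def y_def)
        finally show ?thesis .
      qed
      \<comment> \<open>p^x is at most (ln n)^a, and a < 1 brings this below ln n. Hence n^2 p^r
        \<le> ln^2 n, which lies in the range of the relative estimate.\<close>
      have "y \<le> exp (a * l)" using bx by (simp add: y_def)
      also have "\<dots> \<le> exp (1 * l)" using L a by (intro exp_le_cancel_iff[THEN iffD2] mult_right_mono) auto
      finally have yL: "y \<le> L" using L by (simp add: l_def)
      have y0: "0 \<le> y" by (simp add: y_def)
      define nu where "nu = lam p n r"
      have lam: "nu = L * y * ((p + (1 - p) * R) / (2 * R * (R - 1)))"
        unfolding nu_def lam_def n2 r by simp
      have l0: "0 \<le> nu" "nu \<le> L * y" using lam_bounds[OF p r2, of n] by (auto simp: nu_def n2)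
      have LL: "L * y \<le> L ^ 2" using yL L unfolding power2_eq_square by (intro mult_left_mono) auto
      define \<mu> where "\<mu> = (1 - p) * b / 4 * y"
      define P where "P = below M \<xi> n r"
      define F where "F = lln n / ln (real n) powr (1 - a)"
      have F: "F = exp (a * l) * l / L"
      proof -
        have "ln (real n) powr (1 - a) = exp ((1 - a) * l)"
          using L unfolding powr_def by (simp add: L_def l_def)
        also have "\<dots> = exp l / exp (a * l)" by (simp add: left_diff_distrib exp_diff)
        also have "exp l = L" using L by (simp add: l_def)
        finally show ?thesis unfolding F_def by (simp add: L_def l_def)
      qed
      have F0: "0 \<le> F" unfolding F using L by simp
      have diff: "\<bar>nu - \<mu>\<bar> \<le> K1 * F"
        unfolding lam \<mu>_def K1_def F y_def
        by (rule real_lam_intensity_diff) (use p L b R2 LR bR bx in auto)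
      have K1F: "K1 * F \<le> 1" using elim by (simp add: F_def)
      have "L * y \<le> L ^ 3 / p"
      proof -
        have "L ^ 2 \<le> L ^ 3" using L by (intro power_increasing) auto
        also have "\<dots> \<le> L ^ 3 / p" using p L by (simp add: le_divide_eq mult_left_le)
        finally show ?thesis using LL by linarith
      qed
      then have "\<bar>P * exp nu - 1\<bar> \<le> K * (L ^ 3 * (1 + nu)\<^sup>2 / real n)"
        using elim(9) iid r2 n2 unfolding P_def nu_def L_def by simp
      also have "\<dots> \<le> K * (L ^ 3 * (1 + L ^ 2)\<^sup>2 / real n)"
        using K L l0 LL by (intro mult_left_mono divide_right_mono power_mono) auto
      finally have PE: "\<bar>P * exp nu - 1\<bar> \<le> 1" "\<bar>P * exp nu - 1\<bar> \<le> F"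
        using elim(7,8) by (auto simp: L_def F_def)
      \<comment> \<open>The product exp \<mu> * P is split into the change of intensity
        \<open>A\<close> and the relative error \<open>B\<close>, each within a multiple of
        \<open>F\<close> of 1.\<close>
      define A where "A = exp (\<mu> - nu)"
      define B where "B = P * exp nu"
      have A: "\<bar>A - 1\<bar> \<le> 2 * (K1 * F)"
      proof -
        have d: "\<bar>\<mu> - nu\<bar> \<le> K1 * F" using diff by (simp only: abs_minus_commute)
        have "\<bar>A - 1\<bar> \<le> 2 * \<bar>\<mu> - nu\<bar>"
          unfolding A_def by (rule abs_exp_minus_1_le) (use d K1F in linarith)
        also have "\<dots> \<le> 2 * (K1 * F)" using d by (intro mult_left_mono) auto
        finally show ?thesis .
      qed
      have B: "\<bar>B\<bar> \<le> 2" "\<bar>B - 1\<bar> \<le> F" using PE by (auto simp: B_def)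
      have "exp \<mu> * P - 1 = A * B - 1" by (simp add: A_def B_def exp_diff)
      also have "\<dots> = (A - 1) * B + (B - 1)" by (simp add: algebra_simps)
      finally have "\<bar>exp \<mu> * P - 1\<bar> \<le> \<bar>A - 1\<bar> * \<bar>B\<bar> + \<bar>B - 1\<bar>"
        by (simp add: abs_mult[symmetric])
      also have "\<dots> \<le> (2 * (K1 * F)) * 2 + F"
        using A B by (intro add_mono mult_mono) auto
      also have "\<dots> = (4 * K1 + 1) * F" by (simp add: algebra_simps)
      finally have "\<bar>exp \<mu> * P - 1\<bar> \<le> (4 * K1 + 1) * F" .
      moreover have "P = measure M {\<omega> \<in> space M. real (longest_ap (\<lambda>i. \<xi> i \<omega>) n) < ap_center p n + x}"
        unfolding P_def below_def R_def[symmetric] r by simp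
      moreover have "\<mu> = - (1 - p) * ln p / 4 * p powr x"
        by (simp add: \<mu>_def y b_def algebra_simps)
      ultimately show "\<bar>exp (- (1 - p) * ln p / 4 * p powr x)
         * measure M {\<omega> \<in> space M. real (longest_ap (\<lambda>i. \<xi> i \<omega>) n) < ap_center p n + x} - 1\<bar>
      \<le> (4 * K1 + 1) * (lln n / ln (real n) powr (1 - a))"
        unfolding F_def by simp
    qed
  qed
  then show ?thesis using K1 by (intro exI[of _ "4 * K1 + 1"]) auto
qed

section \<open>Tail bounds and convergence in probability\<close>

lemma real_less_iff_nat_ceiling: "real m < z \<longleftrightarrow> m < nat \<lceil>z\<rceil>"
  by (metis nat_ceiling_le_eq not_le)

lemma exp_minus_le_half: "0 \<le> u \<Longrightarrow> u \<le> 1 \<Longrightarrow> exp (- u) \<le> 1 - u / 2" for u :: real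
proof -
  assume u: "0 \<le> u" "u \<le> 1"
  have "u * u \<le> 1 * u" using u by (intro mult_right_mono) auto
  then have "1 \<le> (1 - u / 2) * (1 + u)" by (simp add: algebra_simps)
  also have "\<dots> \<le> (1 - u / 2) * exp u" using u by (intro mult_left_mono exp_ge_add_one_self) auto
  finally show ?thesis by (simp add: exp_minus field_simps)
qed

context iid_ones
begin

abbreviation longest_lt :: "nat \<Rightarrow> real \<Rightarrow> 'a set" where
  "longest_lt n z \<equiv> {\<omega> \<in> space M. real (longest n \<omega>) < z}"

abbreviation longest_ge :: "nat \<Rightarrow> real \<Rightarrow> 'a set" where
  "longest_ge n z \<equiv> {\<omega> \<in> space M. z \<le> real (longest n \<omega>)}"

abbreviation level :: "real \<Rightarrow> nat \<Rightarrow> real" where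
  "level t n \<equiv> - 2 / ln p * ln (real n) + t * lln n"

lemma real_longest_less_event:
  "n \<ge> 1 \<Longrightarrow> z > 1 \<Longrightarrow> longest_lt n z \<in> events"
  unfolding real_less_iff_nat_ceiling by (rule longest_less_event) linarith+

lemma real_longest_ge_event:
  assumes "n \<ge> 1" "z > 1"
  shows "longest_ge n z \<in> events"
proof -
  have "longest_ge n z = space M - longest_lt n z"
    by auto
  then show ?thesis using real_longest_less_event[OF assms] by auto
qed

lemma prob_real_longest_ge:
  assumes "n \<ge> 1" "z > 1"
  shows "prob (longest_ge n z) = 1 - prob (longest_lt n z)"
proof -
  have "longest_ge n z = space M - longest_lt n z"
    by auto
  then show ?thesis using prob_compl[OF real_longest_less_event[OF assms]] by simp
qed

lemma ln_p_neg: "ln p < 0"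
  using p_pos p_less_1 by simp

text \<open>A correction of order ln ln n cannot use up more than half of the leading term. The
  resulting crude bound keeps all levels above 1, where the events are known to be
  measurable.\<close>

lemma upper_level_large:
  "\<forall>\<^sub>F n in sequentially. level \<theta> n \<ge> - ln (real n) / ln p"
  "\<forall>\<^sub>F n in sequentially. - ln (real n) / ln p \<ge> 2"
proof -
  have "(\<lambda>n. - 1 / ln p + \<theta> * (lln n / ln (real n))) \<longlonglongrightarrow> - 1 / ln p + \<theta> * 0"
    by (intro tendsto_add tendsto_const tendsto_mult) real_asymp
  then have "\<forall>\<^sub>F n in sequentially. - 1 / ln p + \<theta> * (lln n / ln (real n)) > 0"
    using ln_p_neg by (intro order_tendstoD(1)) auto
  moreover have "\<forall>\<^sub>F n in sequentially. ln (real n) > 0" by real_asymp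
  ultimately show "\<forall>\<^sub>F n in sequentially. level \<theta> n \<ge> - ln (real n) / ln p"
  proof eventually_elim
    case (elim n)
    then have "0 \<le> ln (real n) * (- 1 / ln p + \<theta> * (lln n / ln (real n)))" by simp
    also have "\<dots> = - ln (real n) / ln p + \<theta> * lln n"
      using elim(2) by (simp add: algebra_simps)
    finally show ?case by simp
  qed
  show "\<forall>\<^sub>F n in sequentially. - ln (real n) / ln p \<ge> 2"
    using ln_p_neg by real_asymp
qed

text \<open>At this level n^2 p^r is at most (ln n)^(\<theta> ln p), and the denominator of the
  union bound, of order ln n, lowers the exponent by 1. As ln p < 0, the exponent is below -1 for
  \<theta> > 0, equals -1 for \<theta> = 0, which is critical along n = 2^k, and vanishes at
  \<theta> = 1 / ln p.\<close>

lemma prob_longest_ge_asymp: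
  "\<exists>K>0. \<forall>\<^sub>F n in sequentially.
     prob (longest_ge n (level \<theta> n))
       \<le> K * ln (real n) powr (\<theta> * ln p - 1)"
proof -
  define b where "b = - ln p"
  have b: "b > 0" using ln_p_neg by (simp add: b_def)
  have "\<forall>\<^sub>F n in sequentially. n \<ge> (1::nat)" by (rule eventually_ge_at_top)
  moreover have "\<forall>\<^sub>F n in sequentially. ln (real n) > 0" by real_asymp
  ultimately have "\<forall>\<^sub>F n in sequentially.
     prob (longest_ge n (level \<theta> n))
       \<le> b * ln (real n) powr (\<theta> * ln p - 1)"
    using upper_level_large(1)[of \<theta>] upper_level_large(2)
  proof eventually_elim
    case (elim n)
    define L where "L = ln (real n)"
    define z where "z = - 2 / ln p * L + \<theta> * ln L"
    have L: "L > 0" using elim by (simp add: L_def)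
    have z: "z \<ge> L / b" "L / b \<ge> 2" using elim by (auto simp: z_def L_def b_def)
    define r where "r = nat \<lceil>z\<rceil>"
    have rz: "real r \<ge> z" unfolding r_def by linarith
    have r2: "r \<ge> 2" using rz z by linarith
    have "prob (longest_ge n z) = 1 - prob {\<omega> \<in> space M. longest n \<omega> < r}"
      using elim z by (subst prob_real_longest_ge) (auto simp: real_less_iff_nat_ceiling r_def)
    also have "\<dots> \<le> (real n)\<^sup>2 / (2 * (real r - 1)) * p ^ r"
      using elim r2 by (intro prob_longest_ge_le) auto
    also have "\<dots> = (real n)\<^sup>2 * p ^ r / (2 * (real r - 1))" by simp
    also have "\<dots> \<le> L powr (\<theta> * ln p) / (L / b)"
    proof (rule frac_le)
      have "(real n)\<^sup>2 * p ^ r = exp (2 * L - b * real r)"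
        unfolding power_eq_exp_ln[OF p_pos] square_eq_exp_ln[OF elim(1)] exp_add[symmetric]
        by (simp add: b_def L_def)
      also have "\<dots> \<le> exp (2 * L - b * z)" using rz b by simp
      also have "2 * L - b * z = \<theta> * ln p * ln L"
        using ln_p_neg by (simp add: z_def b_def field_simps)
      also have "exp (\<theta> * ln p * ln L) = L powr (\<theta> * ln p)" using L by (simp add: powr_def)
      finally show "(real n)\<^sup>2 * p ^ r \<le> L powr (\<theta> * ln p)" .
      have "w \<le> 2 * (real r - 1)" if "w \<le> z" "2 \<le> w" for w using that rz by simp
      from this[OF z] show "L / b \<le> 2 * (real r - 1)" .
    qed (use L b in auto)
    also have "\<dots> = b * L powr (\<theta> * ln p - 1)" using L by (simp add: powr_diff)
    finally show ?case unfolding z_def L_def .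
  qed
  then show ?thesis using b by blast
qed

text \<open>At h_n + a D ln ln n the intensity is larger than at h_n by the factor p^(a D ln ln n) =
  (ln n)^a, and \<open>below_center_asymp\<close> turns this intensity into an exponent.\<close>

lemma prob_longest_less_asymp:
  assumes a: "0 < a" "a < 1"
  shows "\<exists>c>0. \<forall>\<^sub>F n in sequentially.
     prob (longest_lt n (ap_center p n + a * (1 / ln p) * lln n))
       \<le> 2 * exp (- c * ln (real n) powr a)"
proof -
  define b where "b = - ln p"
  have b: "b > 0" using ln_p_neg by (simp add: b_def)
  \<comment> \<open>The last factor p pays for rounding the level up to an integer.\<close>
  define c where "c = (1 - p) * b / 4 * p"
  have c: "c > 0" using b p_pos p_less_1 by (simp add: c_def)
  obtain K where K: "K > 0" "\<forall>\<^sub>F n in sequentially. \<forall>(M :: 'a measure) \<xi> x. iid_ones M \<xi> p \<longrightarrow>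
    x \<ge> a * (1 / ln p) * lln n \<and> ap_center p n + x \<in> \<int> \<longrightarrow>
    \<bar>exp (- (1 - p) * ln p / 4 * p powr x)
       * measure M {\<omega> \<in> space M. real (longest_ap (\<lambda>i. \<xi> i \<omega>) n) < ap_center p n + x} - 1\<bar>
    \<le> K * (lln n / ln (real n) powr (1 - a))"
    using below_center_asymp[OF p_pos p_less_1 a(2)] by blast
  have "\<forall>\<^sub>F n in sequentially. n \<ge> (1::nat)" by (rule eventually_ge_at_top)
  moreover have "\<forall>\<^sub>F n in sequentially. ln (real n) > 0" by real_asymp
  moreover have "\<forall>\<^sub>F n in sequentially. K * (lln n / ln (real n) powr (1 - a)) \<le> 1"
    using K(1) a by real_asymp
  moreover have "\<forall>\<^sub>F n in sequentially. level ((1 + a) / ln p) n \<ge> - ln (real n) / ln p"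
    by (rule upper_level_large(1))
  ultimately have "\<forall>\<^sub>F n in sequentially.
     prob (longest_lt n (ap_center p n + a * (1 / ln p) * lln n))
       \<le> 2 * exp (- c * ln (real n) powr a)"
    using upper_level_large(2) K(2)
  proof eventually_elim
    case (elim n)
    define L where "L = ln (real n)"
    define w where "w = ap_center p n + a * (1 / ln p) * ln L"
    define x where "x = of_int \<lceil>w\<rceil> - ap_center p n"
    have L: "L > 0" using elim by (simp add: L_def)
    have "w = - 2 / ln p * L + ((1 + a) / ln p) * ln L"
      by (simp add: w_def ap_center_def L_def add_divide_distrib algebra_simps)
    then have w: "w \<ge> 2" using elim(4,5) by (simp add: L_def)
    have x: "x \<ge> a * (1 / ln p) * ln L" "x \<le> a * (1 / ln p) * ln L + 1" "ap_center p n + x \<in> \<int>"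
      unfolding x_def w_def by (linarith, linarith, simp)
    define P where "P = prob (longest_lt n (ap_center p n + x))"
    define \<mu> where "\<mu> = - (1 - p) * ln p / 4 * p powr x"
    have "\<bar>exp \<mu> * P - 1\<bar> \<le> 1"
      using elim(6)[rule_format, of M \<xi> x] elim(3) iid_ones_axioms x
      unfolding P_def \<mu>_def longest_def L_def by simp
    then have "exp \<mu> * P \<le> 2" by linarith
    then have P: "P \<le> 2 * exp (- \<mu>)" by (simp add: exp_minus field_simps)
    have "c * L powr a \<le> \<mu>"
    proof -
      have e: "(a * (1 / ln p) * ln L + 1) * ln p = ln p + a * ln L"
        using ln_p_neg by (simp add: field_simps)
      have "p powr (a * (1 / ln p) * ln L + 1) = exp (ln p + a * ln L)"
        using p_pos unfolding e[symmetric] by (simp add: powr_def)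
      then have "p * L powr a = p powr (a * (1 / ln p) * ln L + 1)"
        using p_pos L by (simp add: exp_add powr_def)
      also have "\<dots> \<le> p powr x" using x p_pos p_less_1 by (intro powr_mono') auto
      finally have "(1 - p) * b / 4 * (p * L powr a) \<le> (1 - p) * b / 4 * p powr x"
        using p_less_1 b by (intro mult_left_mono) auto
      then show ?thesis by (simp add: c_def \<mu>_def b_def algebra_simps)
    qed
    have "prob (longest_lt n w) \<le> P"
    proof -
      have wx: "w \<le> ap_center p n + x" by (simp add: x_def)
      have "longest_lt n w \<subseteq> longest_lt n (ap_center p n + x)"
        using wx by (auto intro: less_le_trans)
      then show ?thesis
        unfolding P_def using wx w elim(1)
        by (intro finite_measure_mono real_longest_less_event) simp_all
    qed
    also note P
    also have "2 * exp (- \<mu>) \<le> 2 * exp (- c * L powr a)" using \<open>c * L powr a \<le> \<mu>\<close> by simp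
    finally show ?case unfolding w_def L_def .
  qed
  then show ?thesis using c by blast
qed

lemma longest_tendsto_in_prob:
  "tendsto_in_prob M (\<lambda>n \<omega>. (real (longest n \<omega>) - (- 2 / ln p) * ln (real n)) / lln n) (1 / ln p)"
  unfolding tendsto_in_prob_def
proof (intro allI impI)
  fix e :: real assume e: "e > 0"
  \<comment> \<open>Small enough for a D \<ge> - e, and below 1 as the distribution estimate
    demands.\<close>
  define a where "a = min (e * (- ln p)) (1 / 2)"
  have a: "0 < a" "a < 1" using e ln_p_neg by (auto simp: a_def mult_pos_neg)
  have ae: "a * (1 / ln p) \<ge> - e"
  proof -
    have "a \<le> e * (- ln p)" by (simp add: a_def)
    then show ?thesis using ln_p_neg by (simp add: field_simps)
  qed
  obtain K where K: "K > 0" "\<forall>\<^sub>F n in sequentially.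
     prob (longest_ge n (level (1 / ln p + e) n))
       \<le> K * ln (real n) powr ((1 / ln p + e) * ln p - 1)"
    using prob_longest_ge_asymp by blast
  obtain c where c: "c > 0" "\<forall>\<^sub>F n in sequentially.
     prob (longest_lt n (ap_center p n + a * (1 / ln p) * lln n))
       \<le> 2 * exp (- c * ln (real n) powr a)"
    using prob_longest_less_asymp[OF a] by blast
  let ?X = "\<lambda>n \<omega>. (real (longest n \<omega>) - (- 2 / ln p) * ln (real n)) / lln n"
  show "(\<lambda>n. prob {\<omega> \<in> space M. \<bar>?X n \<omega> - 1 / ln p\<bar> > e}) \<longlonglongrightarrow> 0"
  proof (rule tendsto_sandwich[OF always_eventually _ tendsto_const])
    show "\<forall>n. 0 \<le> prob {\<omega> \<in> space M. \<bar>?X n \<omega> - 1 / ln p\<bar> > e}" by simp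
    have ex: "(1 / ln p + e) * ln p - 1 = e * ln p" using ln_p_neg by (simp add: field_simps)
    have "e * ln p < 0" using e ln_p_neg by (intro mult_pos_neg)
    then show "(\<lambda>n. K * ln (real n) powr ((1 / ln p + e) * ln p - 1) + 2 * exp (- c * ln (real n) powr a)) \<longlonglongrightarrow> 0"
      unfolding ex using K(1) c(1) a by real_asymp
    have "\<forall>\<^sub>F n in sequentially. n \<ge> (1::nat)" by (rule eventually_ge_at_top)
    moreover have "\<forall>\<^sub>F n in sequentially. lln n > 0" by real_asymp
    moreover have "\<forall>\<^sub>F n in sequentially. level ((1 + a) / ln p) n \<ge> - ln (real n) / ln p"
      by (rule upper_level_large(1))
    ultimately show "\<forall>\<^sub>F n in sequentially. prob {\<omega> \<in> space M. \<bar>?X n \<omega> - 1 / ln p\<bar> > e}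
      \<le> K * ln (real n) powr ((1 / ln p + e) * ln p - 1) + 2 * exp (- c * ln (real n) powr a)"
      using K(2) c(2) upper_level_large(1)[of "1 / ln p + e"] upper_level_large(2)
    proof eventually_elim
      case (elim n)
      define L where "L = ln (real n)"
      let ?A = "longest_ge n (- 2 / ln p * L + (1 / ln p + e) * ln L)"
      let ?B = "longest_lt n (ap_center p n + a * (1 / ln p) * ln L)"
      have w: "ap_center p n + a * (1 / ln p) * ln L = - 2 / ln p * L + ((1 + a) / ln p) * ln L"
        by (simp add: ap_center_def L_def add_divide_distrib algebra_simps)
      have A: "?A \<in> events" using elim by (intro real_longest_ge_event) (auto simp: L_def)
      have B: "?B \<in> events" unfolding w using elim by (intro real_longest_less_event) (auto simp: L_def)
      have l: "ln L > 0" using elim by (simp add: L_def)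
      have "{\<omega> \<in> space M. \<bar>?X n \<omega> - 1 / ln p\<bar> > e} \<subseteq> ?A \<union> ?B"
      proof (rule subsetI, rule UnCI)
        fix \<omega> assume "\<omega> \<in> {\<omega> \<in> space M. \<bar>?X n \<omega> - 1 / ln p\<bar> > e}" "\<omega> \<notin> ?B"
        then have \<omega>: "\<omega> \<in> space M" "\<bar>?X n \<omega> - 1 / ln p\<bar> > e" "\<omega> \<notin> ?B" by simp_all
        have "- e * ln L \<le> a * (1 / ln p) * ln L" using ae l by (intro mult_right_mono) auto
        then have "real (longest n \<omega>) \<ge> ap_center p n - e * ln L" using \<omega> by auto
        then have "real (longest n \<omega>) - (- 2 / ln p) * L \<ge> (1 / ln p - e) * ln L"
          by (simp add: ap_center_def L_def algebra_simps)
        then have "?X n \<omega> \<ge> 1 / ln p - e" using l unfolding L_def by (simp only: pos_le_divide_eq)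
        then have "?X n \<omega> \<ge> 1 / ln p + e" using \<omega>(2) by linarith
        then have "(1 / ln p + e) * ln L \<le> real (longest n \<omega>) - (- 2 / ln p) * L"
          using l unfolding L_def by (simp only: pos_le_divide_eq)
        then show "\<omega> \<in> ?A" using \<omega>(1) by simp
      qed
      then have "prob {\<omega> \<in> space M. \<bar>?X n \<omega> - 1 / ln p\<bar> > e} \<le> prob (?A \<union> ?B)"
        by (rule finite_measure_mono) (rule sets.Un[OF A B])
      also have "\<dots> \<le> prob ?A + prob ?B" using A B by (rule measure_Un_le)
      also have "\<dots> \<le> K * ln (real n) powr ((1 / ln p + e) * ln p - 1) + 2 * exp (- c * ln (real n) powr a)"
        using elim(4,5) unfolding L_def by (rule add_mono)
      finally show ?case .
    qed
  qed
qed

end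

text \<open>The level is h_n - D ln ln n, where the intensity is of order 1 / ln n.
  \<open>below_center_asymp\<close> is used with a = -1 because its error ln ln n / ln^2 n is then
  negligible against this intensity. Uniformity over all sequences is needed for the shifted
  ones.\<close>

lemma prob_longest_ge_lower:
  fixes p :: real
  assumes p: "0 < p" "p < 1"
  shows "\<exists>c>0. \<forall>\<^sub>F n in sequentially. \<forall>(M :: 'a measure) \<xi>. iid_ones M \<xi> p \<longrightarrow>
    measure M {\<omega> \<in> space M. - 2 / ln p * ln (real n) \<le> real (longest_ap (\<lambda>i. \<xi> i \<omega>) n)} \<ge> c / ln (real n)"
proof -
  define b where "b = - ln p"
  have b: "b > 0" using p by (simp add: b_def)
  have lnp: "ln p < 0" using p by simp
  define g where "g = (1 - p) * b / 4"
  have g: "g > 0" using b p by (simp add: g_def)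
  obtain K where K: "K > 0" "\<forall>\<^sub>F n in sequentially. \<forall>(M :: 'a measure) \<xi> x. iid_ones M \<xi> p \<longrightarrow>
    x \<ge> (- 1) * (1 / ln p) * lln n \<and> ap_center p n + x \<in> \<int> \<longrightarrow>
    \<bar>exp (- (1 - p) * ln p / 4 * p powr x)
       * measure M {\<omega> \<in> space M. real (longest_ap (\<lambda>i. \<xi> i \<omega>) n) < ap_center p n + x} - 1\<bar>
    \<le> K * (lln n / ln (real n) powr (1 - (- 1)))"
    using below_center_asymp[OF p, of "- 1"] by auto
  have "\<forall>\<^sub>F n in sequentially. n \<ge> (1::nat)" by (rule eventually_ge_at_top)
  moreover have "\<forall>\<^sub>F n in sequentially. ln (real n) \<ge> 1" by real_asymp
  moreover have "\<forall>\<^sub>F n in sequentially. K * (lln n / ln (real n) powr (1 - (- 1))) \<le> g * p / 4 / ln (real n)"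
    using K(1) g p by real_asymp
  moreover have "\<forall>\<^sub>F n in sequentially. g / ln (real n) \<le> 1" using g by real_asymp
  moreover have "\<forall>\<^sub>F n in sequentially. - 2 / ln p * ln (real n) \<ge> 2" using lnp by real_asymp
  ultimately have "\<forall>\<^sub>F n in sequentially. \<forall>(M :: 'a measure) \<xi>. iid_ones M \<xi> p \<longrightarrow>
    measure M {\<omega> \<in> space M. - 2 / ln p * ln (real n) \<le> real (longest_ap (\<lambda>i. \<xi> i \<omega>) n)} \<ge> (g * p / 4) / ln (real n)"
    using K(2)
  proof eventually_elim
    case (elim n)
    show ?case
    proof (intro allI impI)
      fix M :: "'a measure" and \<xi> :: "nat \<Rightarrow> 'a \<Rightarrow> real"
      assume iid: "iid_ones M \<xi> p"
      interpret iid_ones M \<xi> p by (rule iid)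
      define L where "L = ln (real n)"
      define w where "w = - 2 / ln p * L"
      define x where "x = of_int \<lceil>w\<rceil> - ap_center p n"
      have L: "L \<ge> 1" using elim by (simp add: L_def)
      have w: "w \<ge> 2" using elim by (simp add: w_def L_def)
      have cw: "ap_center p n = w + 1 / ln p * ln L" by (simp add: ap_center_def w_def L_def)
      have x: "x \<ge> (- 1) * (1 / ln p) * ln L" "x \<le> (- 1) * (1 / ln p) * ln L + 1" "ap_center p n + x \<in> \<int>"
        unfolding x_def cw by (linarith, linarith, simp)
      define P where "P = prob {\<omega> \<in> space M. real (longest n \<omega>) < w}"
      have P: "P = prob {\<omega> \<in> space M. real (longest n \<omega>) < ap_center p n + x}"
        unfolding P_def x_def using w by (simp add: real_less_iff_nat_ceiling)
      define \<mu> where "\<mu> = - (1 - p) * ln p / 4 * p powr x"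
      have PK: "\<bar>exp \<mu> * P - 1\<bar> \<le> K * (ln L / L powr (1 - (- 1)))"
        using elim(6)[rule_format, of M \<xi> x] iid x unfolding P \<mu>_def longest_def L_def by simp
      define F where "F = K * (ln L / L powr (1 - (- 1)))"
      have F: "F \<le> g * p / 4 / L" using elim by (simp add: F_def L_def)
      have powL: "p powr ((- 1) * (1 / ln p) * ln L) = 1 / L"
        using p L lnp by (simp add: powr_def exp_minus field_simps)
      have px: "p powr x \<le> 1 / L" "p * (1 / L) \<le> p powr x"
      proof -
        show "p powr x \<le> 1 / L" unfolding powL[symmetric] using x p by (intro powr_mono') auto
        have "p * (1 / L) = p powr ((- 1) * (1 / ln p) * ln L + 1)"
          unfolding powr_add powL using p by simp
        also have "\<dots> \<le> p powr x" using x p by (intro powr_mono') auto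
        finally show "p * (1 / L) \<le> p powr x" .
      qed
      have \<mu>: "\<mu> = g * p powr x" by (simp add: \<mu>_def g_def b_def algebra_simps)
      have \<mu>_bounds: "0 \<le> \<mu>" "\<mu> \<le> 1" "g * p / L \<le> \<mu>"
      proof -
        show "0 \<le> \<mu>" unfolding \<mu> using g by simp
        have "\<mu> \<le> g * (1 / L)" unfolding \<mu> using g px by (intro mult_left_mono) auto
        then show "\<mu> \<le> 1" using elim(4) by (simp add: L_def)
        have "g * (p * (1 / L)) \<le> \<mu>" unfolding \<mu> using g px by (intro mult_left_mono) auto
        then show "g * p / L \<le> \<mu>" by simp
      qed
      have F0: "0 \<le> F" using K(1) L by (simp add: F_def)
      have "exp \<mu> * P \<le> 1 + F" using PK unfolding F_def[symmetric] by linarith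
      then have "P \<le> exp (- \<mu>) * (1 + F)" by (simp add: exp_minus field_simps)
      also have "\<dots> = exp (- \<mu>) + exp (- \<mu>) * F" by (simp add: algebra_simps)
      also have "\<dots> \<le> (1 - \<mu> / 2) + 1 * F"
        using \<mu>_bounds F0 by (intro add_mono exp_minus_le_half mult_right_mono) auto
      finally have "P \<le> 1 - \<mu> / 2 + F" by simp
      \<comment> \<open>\<open>exp_minus_le_half\<close> leaves half of the intensity and the error
        takes at most half of that, whence the 4. The factor p is again the price of rounding
        up.\<close>
      then have "1 - P \<ge> g * p / 4 / L" using \<mu>_bounds(3) F by (simp add: field_simps)
      moreover have "prob {\<omega> \<in> space M. w \<le> real (longest n \<omega>)} = 1 - P"
        unfolding P_def using elim w by (intro prob_real_longest_ge) auto
      ultimately show "measure M {\<omega> \<in> space M. - 2 / ln p * ln (real n) \<le> real (longest_ap (\<lambda>i. \<xi> i \<omega>) n)}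
          \<ge> (g * p / 4) / ln (real n)"
        unfolding w_def L_def longest_def by simp
    qed
  qed
  then show ?thesis using g p by (intro exI[of _ "g * p / 4"]) auto
qed

section \<open>Weighted averages and Borel-Cantelli lemmas\<close>

text \<open>Eventually the increments of a - l b are at most e / 2 times those of b. Summed up, |a -
  l b| is at most e / 2 * b plus a constant, which b outgrows.\<close>

lemma stolz_cesaro:
  fixes a b :: "nat \<Rightarrow> real"
  assumes inc: "\<forall>\<^sub>F n in sequentially. b n < b (Suc n)"
    and lim_b: "filterlim b at_top sequentially"
    and lim: "(\<lambda>n. (a (Suc n) - a n) / (b (Suc n) - b n)) \<longlonglongrightarrow> l"
  shows "(\<lambda>n. a n / b n) \<longlonglongrightarrow> l"
proof (rule tendstoI)
  fix e :: real assume e: "e > 0"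
  have "\<forall>\<^sub>F n in sequentially. \<bar>(a (Suc n) - a n) / (b (Suc n) - b n) - l\<bar> < e / 2"
    using tendstoD[OF lim, of "e / 2"] e by (simp add: dist_real_def)
  then have "\<forall>\<^sub>F n in sequentially. \<bar>(a (Suc n) - l * b (Suc n)) - (a n - l * b n)\<bar> \<le> e / 2 * (b (Suc n) - b n)"
    using inc
  proof eventually_elim
    case (elim n)
    define d where "d = b (Suc n) - b n"
    have d: "d > 0" using elim by (simp add: d_def)
    have "((a (Suc n) - a n) / d - l) * d = (a (Suc n) - a n) - l * d"
      unfolding left_diff_distrib using d by simp
    also have "\<dots> = (a (Suc n) - l * b (Suc n)) - (a n - l * b n)"
      by (simp add: d_def algebra_simps)
    finally have "\<bar>(a (Suc n) - l * b (Suc n)) - (a n - l * b n)\<bar> = \<bar>((a (Suc n) - a n) / d - l) * d\<bar>"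
      by simp
    also have "\<dots> = \<bar>(a (Suc n) - a n) / d - l\<bar> * d" using d by (simp add: abs_mult)
    also have "\<dots> \<le> e / 2 * d" using elim d by (intro mult_right_mono) (auto simp: d_def)
    finally show ?case unfolding d_def .
  qed
  then obtain N where N: "\<And>n. n \<ge> N \<Longrightarrow>
      \<bar>(a (Suc n) - l * b (Suc n)) - (a n - l * b n)\<bar> \<le> e / 2 * (b (Suc n) - b n)"
    by (auto simp: eventually_sequentially)
  define c where "c n = a n - l * b n" for n
  have bound: "\<bar>c n - c N\<bar> \<le> e / 2 * (b n - b N)" if "n \<ge> N" for n
    using that
  proof (induction n rule: dec_induct)
    case (step n)
    have "\<bar>c (Suc n) - c n\<bar> \<le> e / 2 * (b (Suc n) - b n)" using N[of n] step by (simp add: c_def)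
    then have "\<bar>c (Suc n) - c N\<bar> \<le> e / 2 * (b (Suc n) - b n) + e / 2 * (b n - b N)"
      using step.IH by linarith
    then show ?case unfolding right_diff_distrib by linarith
  qed simp
  have "\<forall>\<^sub>F n in sequentially. b n > max 1 (2 * (\<bar>c N\<bar> + e / 2 * \<bar>b N\<bar>) / e)"
    using lim_b by (rule filterlim_at_top_dense[THEN iffD1, rule_format])
  moreover have "\<forall>\<^sub>F n in sequentially. n \<ge> N" by (rule eventually_ge_at_top)
  ultimately show "\<forall>\<^sub>F n in sequentially. dist (a n / b n) l < e"
  proof eventually_elim
    case (elim n)
    then have b: "b n > 0" "2 * (\<bar>c N\<bar> + e / 2 * \<bar>b N\<bar>) / e < b n" by auto
    have "\<bar>c N\<bar> + e / 2 * \<bar>b N\<bar> < e / 2 * b n" using b(2) e by (simp add: field_simps)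
    moreover have "\<bar>c n\<bar> \<le> \<bar>c N\<bar> + (e / 2 * b n + e / 2 * \<bar>b N\<bar>)"
    proof -
      have "- (e / 2 * b N) \<le> e / 2 * \<bar>b N\<bar>"
        using e mult_left_mono[of "- b N" "\<bar>b N\<bar>" "e / 2"] by simp
      then have "e / 2 * (b n - b N) \<le> e / 2 * b n + e / 2 * \<bar>b N\<bar>"
        unfolding right_diff_distrib by linarith
      then show ?thesis using bound[OF elim(2)] by linarith
    qed
    ultimately have "\<bar>c n\<bar> < e / 2 * b n + e / 2 * b n" by linarith
    then have "\<bar>c n\<bar> < e * b n" by simp
    moreover have "a n / b n - l = c n / b n" using b by (simp add: c_def field_simps)
    ultimately show ?case using b by (simp add: dist_real_def field_simps)
  qed
qed

text \<open>For nonnegative terms the monotonicity of \<open>G\<close> replaces summation by parts: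
  a tail of \<open>z\<close> up to n is at most G n times the tail of z / G, and the remaining
  initial sum is outgrown by \<open>G\<close>.\<close>

lemma kronecker_nonneg:
  fixes z G :: "nat \<Rightarrow> real"
  assumes z: "\<And>k. 0 \<le> z k" and sm: "summable (\<lambda>k. z k / G k)"
    and lim: "filterlim G at_top sequentially"
    and mono: "\<And>m n. N \<le> m \<Longrightarrow> m \<le> n \<Longrightarrow> G m \<le> G n" and pos: "\<And>n. N \<le> n \<Longrightarrow> 0 < G n"
  shows "(\<lambda>n. (\<Sum>k=1..n. z k) / G n) \<longlonglongrightarrow> 0"
proof (rule tendstoI)
  fix e :: real assume e: "e > 0"
  then obtain M0 where M0: "\<And>m n. m \<ge> M0 \<Longrightarrow> norm (\<Sum>k=m..<n. z k / G k) < e / 2"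
    using sm unfolding summable_Cauchy by (meson half_gt_zero)
  define M where "M = max M0 (max N 1)"
  define S where "S = (\<Sum>k=1..<M. z k)"
  have "\<forall>\<^sub>F n in sequentially. G n > 2 * S / e"
    using lim by (rule filterlim_at_top_dense[THEN iffD1, rule_format])
  moreover have "\<forall>\<^sub>F n in sequentially. n \<ge> M" by (rule eventually_ge_at_top)
  ultimately show "\<forall>\<^sub>F n in sequentially. dist ((\<Sum>k=1..n. z k) / G n) 0 < e"
  proof eventually_elim
    case (elim n)
    have Gn: "G n > 0" using pos elim by (simp add: M_def)
    have "(\<Sum>k=1..n. z k) = S + (\<Sum>k=M..<Suc n. z k)"
      unfolding S_def atLeastLessThanSuc_atLeastAtMost[symmetric]
      using elim by (intro sum.atLeastLessThan_concat[symmetric]) (auto simp: M_def)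
    also have "(\<Sum>k=M..<Suc n. z k) \<le> (\<Sum>k=M..<Suc n. z k / G k * G n)"
    proof (rule sum_mono)
      fix k assume k: "k \<in> {M..<Suc n}"
      have "0 < G k" "G k \<le> G n" using k pos mono by (auto simp: M_def)
      then have "z k / G k * G k \<le> z k / G k * G n" using z by (intro mult_left_mono) auto
      then show "z k \<le> z k / G k * G n" using \<open>0 < G k\<close> by simp
    qed
    also have "\<dots> = (\<Sum>k=M..<Suc n. z k / G k) * G n" by (rule sum_distrib_right[symmetric])
    also have "\<dots> \<le> e / 2 * G n"
    proof (rule mult_right_mono)
      have "norm (\<Sum>k=M..<Suc n. z k / G k) < e / 2" by (rule M0) (simp add: M_def)
      then show "(\<Sum>k=M..<Suc n. z k / G k) \<le> e / 2" by (simp add: abs_less_iff)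
    qed (use Gn in simp)
    finally have "(\<Sum>k=1..n. z k) \<le> S + e / 2 * G n" by simp
    also have "S < e / 2 * G n" using elim(1) e by (simp add: field_simps)
    finally have "(\<Sum>k=1..n. z k) < e * G n" by simp
    moreover have "0 \<le> (\<Sum>k=1..n. z k)" using z by (intro sum_nonneg)
    ultimately show ?case using Gn by (simp add: dist_real_def pos_divide_less_eq)
  qed
qed

text \<open>\<open>e\<close> is a deviation that is small relative to \<open>g\<close> except on
  rare levels, where \<open>z i\<close> bounds it. For fixed \<open>i\<close> the regular part
  eventually contributes at most 2 / (i + 1), and the rare part vanishes by
  \<open>kronecker_nonneg\<close>. The tolerances are indexed by naturals since only countably many
  can be combined almost surely.\<close>

lemma weighted_average_tendsto_0:
  fixes e g G :: "nat \<Rightarrow> real" and z :: "nat \<Rightarrow> nat \<Rightarrow> real"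
  assumes lim: "filterlim G at_top sequentially"
    and mono: "\<And>m n. N \<le> m \<Longrightarrow> m \<le> n \<Longrightarrow> G m \<le> G n" and pos: "\<And>n. N \<le> n \<Longrightarrow> 0 < G n"
    and g: "(\<lambda>n. (\<Sum>k=1..n. g k) / G n) \<longlonglongrightarrow> 1"
    and z: "\<And>i k. 0 \<le> z i k" and sm: "\<And>i. summable (\<lambda>k. z i k / G k)"
    and e: "\<And>i. \<forall>\<^sub>F k in sequentially. \<bar>e k\<bar> \<le> 1 / real (Suc i) * g k + z i k"
  shows "(\<lambda>n. (\<Sum>k=1..n. e k) / G n) \<longlonglongrightarrow> 0"
proof (rule tendstoI)
  fix \<epsilon> :: real assume \<epsilon>: "\<epsilon> > 0"
  obtain i where i: "1 / real (Suc i) < \<epsilon> / 4"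
    using nat_approx_posE[of "\<epsilon> / 4"] \<epsilon> by auto
  define t where "t k = 1 / real (Suc i) * g k + z i k" for k
  obtain M0 where M0: "\<And>k. k \<ge> M0 \<Longrightarrow> \<bar>e k\<bar> \<le> t k"
    using e[of i] by (auto simp: eventually_sequentially t_def)
  define M where "M = max M0 1"
  define S where "S = (\<Sum>k=1..<M. \<bar>e k\<bar> - t k)"
  have sum_le: "\<bar>\<Sum>k=1..n. e k\<bar> \<le> S + 1 / real (Suc i) * (\<Sum>k=1..n. g k) + (\<Sum>k=1..n. z i k)"
    if n: "n \<ge> M" for n
  proof -
    have "\<bar>\<Sum>k=1..n. e k\<bar> \<le> (\<Sum>k=1..n. \<bar>e k\<bar>)" by (rule sum_abs)
    also have "\<dots> = (\<Sum>k=1..n. \<bar>e k\<bar> - t k) + (\<Sum>k=1..n. t k)" by (simp add: sum_subtractf)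
    also have "(\<Sum>k=1..n. \<bar>e k\<bar> - t k) = S + (\<Sum>k=M..<Suc n. \<bar>e k\<bar> - t k)"
      unfolding S_def atLeastLessThanSuc_atLeastAtMost[symmetric]
      using n by (intro sum.atLeastLessThan_concat[symmetric]) (auto simp: M_def)
    also have "(\<Sum>k=M..<Suc n. \<bar>e k\<bar> - t k) \<le> 0"
      using M0 by (intro sum_nonpos) (auto simp: M_def)
    finally have "\<bar>\<Sum>k=1..n. e k\<bar> \<le> S + (\<Sum>k=1..n. t k)" by simp
    then show ?thesis unfolding t_def sum.distrib sum_distrib_left[symmetric] by simp
  qed
  have "(\<lambda>n. S / G n) \<longlonglongrightarrow> 0"
    using lim by (rule real_tendsto_divide_at_top[OF tendsto_const])
  then have "\<forall>\<^sub>F n in sequentially. S / G n < \<epsilon> / 4" using \<epsilon> by (intro order_tendstoD(2)) auto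
  moreover have "\<forall>\<^sub>F n in sequentially. (\<Sum>k=1..n. z i k) / G n < \<epsilon> / 4"
    using kronecker_nonneg[OF z sm lim mono pos] \<epsilon> by (intro order_tendstoD(2)) auto
  moreover have "\<forall>\<^sub>F n in sequentially. (\<Sum>k=1..n. g k) / G n < 2"
    using g by (intro order_tendstoD(2)) auto
  moreover have "\<forall>\<^sub>F n in sequentially. n \<ge> max M N" by (rule eventually_ge_at_top)
  ultimately show "\<forall>\<^sub>F n in sequentially. dist ((\<Sum>k=1..n. e k) / G n) 0 < \<epsilon>"
  proof eventually_elim
    case (elim n)
    have Gn: "G n > 0" using pos elim by simp
    have "\<bar>\<Sum>k=1..n. e k\<bar> / G n \<le> (S + 1 / real (Suc i) * (\<Sum>k=1..n. g k) + (\<Sum>k=1..n. z i k)) / G n"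
      using sum_le elim Gn by (intro divide_right_mono) auto
    also have "\<dots> = S / G n + 1 / real (Suc i) * ((\<Sum>k=1..n. g k) / G n) + (\<Sum>k=1..n. z i k) / G n"
      by (simp add: add_divide_distrib)
    also have "1 / real (Suc i) * ((\<Sum>k=1..n. g k) / G n) \<le> 1 / real (Suc i) * 2"
      using elim(3) by (intro mult_left_mono) auto
    also have "\<dots> < \<epsilon> / 4 * 2" using i by simp
    finally have "\<bar>\<Sum>k=1..n. e k\<bar> / G n < \<epsilon>" using elim(1,2) by linarith
    then show ?case using Gn by (simp add: dist_real_def)
  qed
qed

text \<open>The terms have the order of the differences of ln^(-\<kappa>) at consecutive integers,
  and those telescope.\<close>

lemma summable_inverse_mult_ln_powr:
  assumes "\<kappa> > 0"
  shows "summable (\<lambda>k. 1 / (real k * ln (real k)) * ln (real k) powr (- \<kappa>))"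
proof (rule summable_comparison_test_bigo)
  have "(\<lambda>k. ln (real k) powr (- \<kappa>)) \<longlonglongrightarrow> 0" using assms by real_asymp
  then have telescope: "summable (\<lambda>k. ln (real k) powr (- \<kappa>) - ln (real (Suc k)) powr (- \<kappa>))"
    by (rule telescope_summable')
  have "\<forall>\<^sub>F k in sequentially. ln (real k) powr (- \<kappa>) - ln (real (Suc k)) powr (- \<kappa>)
      = norm (ln (real k) powr (- \<kappa>) - ln (real (Suc k)) powr (- \<kappa>))"
  proof -
    have "\<forall>\<^sub>F k in sequentially. ln (real k) > 0" by real_asymp
    moreover have "\<forall>\<^sub>F k in sequentially. k > (0::nat)" by (rule eventually_gt_at_top)
    ultimately show ?thesis
    proof eventually_elim
      case (elim k)
      then have "ln (real (Suc k)) powr (- \<kappa>) \<le> ln (real k) powr (- \<kappa>)"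
        using assms by (intro powr_mono2') auto
      then show ?case by simp
    qed
  qed
  from summable_cong[OF this] telescope
  show "summable (\<lambda>k. norm (ln (real k) powr (- \<kappa>) - ln (real (Suc k)) powr (- \<kappa>)))"
    by (rule iffD1)
  show "(\<lambda>k. 1 / (real k * ln (real k)) * ln (real k) powr (- \<kappa>))
      \<in> O(\<lambda>k. ln (real k) powr (- \<kappa>) - ln (real (Suc k)) powr (- \<kappa>))"
    using assms by real_asymp
qed

section \<open>Exceptional events of summable weight\<close>

context prob_space
begin

lemma AE_eventually_notin:
  assumes ev: "\<forall>\<^sub>F k in sequentially. A k \<in> events"
    and le: "\<forall>\<^sub>F k in sequentially. prob (A k) \<le> f k" and sm: "summable f"
  shows "AE \<omega> in M. \<forall>\<^sub>F k in sequentially. \<omega> \<notin> A k"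
proof -
  obtain N where N: "\<And>k. k \<ge> N \<Longrightarrow> A k \<in> events" "\<And>k. k \<ge> N \<Longrightarrow> prob (A k) \<le> f k"
    using eventually_conj[OF ev le] by (auto simp: eventually_sequentially)
  have "summable (\<lambda>k. f (k + N))" using sm by (rule summable_ignore_initial_segment)
  then have "summable (\<lambda>k. prob (A (k + N)))"
    by (rule summable_comparison_test'[where N = 0]) (simp add: N)
  then have "AE \<omega> in M. \<forall>\<^sub>F k in sequentially. \<omega> \<in> space M - A (k + N)"
    using N by (intro borel_cantelli_AE1) (auto simp: emeasure_eq_measure)
  then show ?thesis
  proof (rule AE_mp, intro AE_I2 impI)
    fix \<omega> assume "\<forall>\<^sub>F k in sequentially. \<omega> \<in> space M - A (k + N)"
    then have "\<forall>\<^sub>F k in sequentially. \<omega> \<notin> A (k + N)" by (rule eventually_mono) auto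
    then show "\<forall>\<^sub>F k in sequentially. \<omega> \<notin> A k" by (subst (asm) eventually_sequentially_seg)
  qed
qed

text \<open>The expectation of the random series is the given convergent series, so the random
  series is finite almost surely, whatever the dependence between the events.\<close>

lemma AE_summable_indicator:
  assumes ev: "\<And>k. A k \<in> events" and v: "\<And>k. 0 \<le> v k"
    and sm: "summable (\<lambda>k. v k * prob (A k))"
  shows "AE \<omega> in M. summable (\<lambda>k. v k * indicator (A k) \<omega>)"
proof -
  note [measurable] = ev
  have "(\<integral>\<^sup>+ \<omega>. (\<Sum>k. ennreal (v k * indicator (A k) \<omega>)) \<partial>M) = (\<Sum>k. \<integral>\<^sup>+ \<omega>. ennreal (v k * indicator (A k) \<omega>) \<partial>M)"
    by (intro nn_integral_suminf) measurable
  also have "\<dots> = (\<Sum>k. ennreal (v k * prob (A k)))"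
  proof (rule suminf_cong)
    fix k
    have "(\<integral>\<^sup>+ \<omega>. ennreal (v k * indicator (A k) \<omega>) \<partial>M) = (\<integral>\<^sup>+ \<omega>. ennreal (v k) * indicator (A k) \<omega> \<partial>M)"
      by (intro nn_integral_cong) (auto simp: indicator_def)
    also have "\<dots> = ennreal (v k) * emeasure M (A k)" using ev by (simp add: nn_integral_cmult_indicator)
    finally show "(\<integral>\<^sup>+ \<omega>. ennreal (v k * indicator (A k) \<omega>) \<partial>M) = ennreal (v k * prob (A k))"
      using v by (simp add: emeasure_eq_measure ennreal_mult')
  qed
  also have "\<dots> \<noteq> \<infinity>" using sm v by (simp add: suminf_ennreal2)
  finally have "AE \<omega> in M. (\<Sum>k. ennreal (v k * indicator (A k) \<omega>)) \<noteq> \<infinity>"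
    by (intro nn_integral_PInf_AE) measurable
  then show ?thesis
    by (rule AE_mp) (use v in \<open>auto intro!: AE_I2 summable_suminf_not_top\<close>)
qed

lemma AE_summable_indicator_eventually:
  assumes ev: "\<forall>\<^sub>F k in sequentially. A k \<in> events" and v: "\<forall>\<^sub>F k in sequentially. 0 \<le> v k"
    and le: "\<forall>\<^sub>F k in sequentially. prob (A k) \<le> f k" and sm: "summable (\<lambda>k. v k * f k)"
  shows "AE \<omega> in M. summable (\<lambda>k. v k * indicator (A k) \<omega>)"
proof -
  obtain N where N: "\<And>k. k \<ge> N \<Longrightarrow> A k \<in> events" "\<And>k. k \<ge> N \<Longrightarrow> prob (A k) \<le> f k" "\<And>k. k \<ge> N \<Longrightarrow> 0 \<le> v k"
    using eventually_conj[OF ev eventually_conj[OF le v]] by (auto simp: eventually_sequentially)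
  have "summable (\<lambda>k. v (k + N) * f (k + N))"
    using sm by (rule summable_ignore_initial_segment)
  then have "summable (\<lambda>k. v (k + N) * prob (A (k + N)))"
    by (rule summable_comparison_test'[where N = 0]) (simp add: N abs_mult mult_left_mono)
  then have "AE \<omega> in M. summable (\<lambda>k. v (k + N) * indicator (A (k + N)) \<omega>)"
    using N by (intro AE_summable_indicator) auto
  then show ?thesis by (rule AE_mp) (auto intro!: AE_I2 simp: summable_iff_shift[of "\<lambda>k. v k * indicator (A k) _"])
qed

end

section \<open>Almost sure behaviour\<close>

lemma eventually_strict_mono_subseq:
  fixes f :: "nat \<Rightarrow> nat"
  assumes "strict_mono f" "\<forall>\<^sub>F n in sequentially. P n"
  shows "\<forall>\<^sub>F k in sequentially. P (f k)"
  using filterlim_subseq[OF assms(1)] assms(2) by (simp add: filterlim_iff)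

lemma strict_mono_two_power: "strict_mono (\<lambda>k. 2 ^ k :: nat)"
  by (rule strict_monoI) simp

text \<open>Probabilities are summed along n = 2^k; this places an arbitrary large n between two
  consecutive powers at which the desired property holds.\<close>

lemma eventually_two_power_block:
  fixes P :: "nat \<Rightarrow> bool"
  assumes "\<forall>\<^sub>F k in sequentially. P k"
  shows "\<forall>\<^sub>F n in sequentially. \<exists>k. P k \<and> P (Suc k) \<and> 2 ^ k \<le> n \<and> n < 2 ^ Suc k"
proof -
  obtain N where N: "\<And>k. k \<ge> N \<Longrightarrow> P k" using assms by (auto simp: eventually_sequentially)
  have "\<exists>k. P k \<and> P (Suc k) \<and> 2 ^ k \<le> n \<and> n < 2 ^ Suc k" if n: "n \<ge> 2 ^ N" for n :: nat
  proof -
    have "n \<ge> 1" using n by (meson le_trans one_le_numeral one_le_power)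
    then obtain k where k: "2 ^ k \<le> n" "n < 2 ^ Suc k" using ex_power_ivl1[of 2 n] by auto
    have "(2::nat) ^ N < 2 ^ Suc k" using n k by linarith
    then have "N < Suc k" by (subst (asm) power_strict_increasing_iff) simp_all
    then have "P k" "P (Suc k)" using N by simp_all
    then show ?thesis using k by blast
  qed
  then show ?thesis unfolding eventually_sequentially by blast
qed

lemma ap_idx_mono: "m \<le> n \<Longrightarrow> ap_idx m r \<subseteq> ap_idx n r"
  by (auto simp: ap_idx_def)

section \<open>Almost sure bounds along dyadic and doubly exponential sequences\<close>

context iid_ones
begin

text \<open>The characterisation by progressions covers lengths from 2 on; every application is at a
  level of at least 2.\<close>

lemma longest_mono:
  assumes "2 \<le> longest m \<omega>" "1 \<le> m" "m \<le> n"
  shows "longest m \<omega> \<le> longest n \<omega>"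
proof -
  have "\<exists>\<alpha>\<in>ap_idx m (longest m \<omega>). \<forall>i\<in>ap_ones (longest m \<omega>) \<alpha>. \<xi> i \<omega> = 1"
    using longest_ap_ge_iff[of m "longest m \<omega>" "\<lambda>i. \<xi> i \<omega>"] assms by (simp add: longest_def)
  then have "\<exists>\<alpha>\<in>ap_idx n (longest m \<omega>). \<forall>i\<in>ap_ones (longest m \<omega>) \<alpha>. \<xi> i \<omega> = 1"
    using ap_idx_mono[OF assms(3)] by blast
  then show ?thesis
    using longest_ap_ge_iff[of n "longest m \<omega>" "\<lambda>i. \<xi> i \<omega>"] assms by (simp add: longest_def)
qed

text \<open>Along n = 2^k the probability of reaching level e / 2 is of order k^(e/2 ln p - 1),
  which is summable. Between two powers the longest length is monotone and the leading term changes
  by at most C ln 2; the other half of e ln ln n pays for this.\<close>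

lemma AE_longest_upper:
  assumes e: "e > 0"
  shows "AE \<omega> in M. \<forall>\<^sub>F n in sequentially.
    real (longest n \<omega>) \<le> level e n"
proof -
  define C where "C = - 2 / ln p"
  have C: "C > 0" using ln_p_neg by (simp add: C_def)
  define s where "s = e / 2 * ln p - 1"
  have s: "s < - 1" using e ln_p_neg by (simp add: s_def mult_pos_neg)
  obtain K where K: "K > 0" "\<forall>\<^sub>F n in sequentially.
     prob (longest_ge n (level (e / 2) n))
       \<le> K * ln (real n) powr s"
    using prob_longest_ge_asymp[of "e / 2"] unfolding s_def by blast
  let ?A = "\<lambda>k. longest_ge (2 ^ k) (C * ln (real (2 ^ k)) + e / 2 * lln (2 ^ k))"
  have "AE \<omega> in M. \<forall>\<^sub>F k in sequentially. \<omega> \<notin> ?A k"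
  proof (rule AE_eventually_notin)
    have "\<forall>\<^sub>F n in sequentially. longest_ge n (C * ln (real n) + e / 2 * lln n) \<in> events"
      using upper_level_large(1)[of "e / 2"] upper_level_large(2) eventually_ge_at_top[of 1]
    proof eventually_elim
      case (elim n)
      then show ?case unfolding C_def by (intro real_longest_ge_event) auto
    qed
    then show "\<forall>\<^sub>F k in sequentially. ?A k \<in> events"
      by (rule eventually_strict_mono_subseq[OF strict_mono_two_power])
    show "\<forall>\<^sub>F k in sequentially. prob (?A k) \<le> K * (real k * ln 2) powr s"
      using eventually_strict_mono_subseq[OF strict_mono_two_power K(2)]
      by (simp add: ln_realpow C_def)
    show "summable (\<lambda>k. K * (real k * ln 2) powr s)"
    proof (rule summable_comparison_test_bigo)
      show "summable (\<lambda>k. norm (real k powr s))" using s by (simp add: summable_real_powr_iff)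
      show "(\<lambda>k. K * (real k * ln 2) powr s) \<in> O(\<lambda>k. real k powr s)" by real_asymp
    qed
  qed
  then show ?thesis
  proof (rule AE_mp, intro AE_I2 impI)
    fix \<omega> assume \<omega>: "\<omega> \<in> space M" "\<forall>\<^sub>F k in sequentially. \<omega> \<notin> ?A k"
    have "\<forall>\<^sub>F n in sequentially. C * (ln (real n) + ln 2) + e / 2 * ln (ln (real n) + ln 2)
        \<le> C * ln (real n) + e * lln n"
      using C e by real_asymp
    moreover have "\<forall>\<^sub>F n in sequentially. C * ln (real n) + e * lln n \<ge> 2"
      using C e by real_asymp
    moreover have "\<forall>\<^sub>F n in sequentially. n \<ge> (2::nat)" by (rule eventually_ge_at_top)
    ultimately show "\<forall>\<^sub>F n in sequentially. real (longest n \<omega>) \<le> level e n"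
      using eventually_two_power_block[OF \<omega>(2)]
    proof eventually_elim
      case (elim n)
      then obtain k where k: "\<omega> \<notin> ?A (Suc k)" "2 ^ k \<le> n" "n < 2 ^ Suc k" by blast
      show ?case
      proof (rule ccontr)
        assume "\<not> ?thesis"
        then have gt: "real (longest n \<omega>) > C * ln (real n) + e * lln n" by (simp add: C_def)
        then have "2 \<le> longest n \<omega>" using elim(2) by simp
        then have "longest n \<omega> \<le> longest (2 ^ Suc k) \<omega>" using elim k by (intro longest_mono) auto
        moreover have "real (longest (2 ^ Suc k) \<omega>) < C * ln (real (2 ^ Suc k)) + e / 2 * lln (2 ^ Suc k)"
          using k(1) \<omega>(1) by auto
        moreover have "C * ln (real (2 ^ Suc k)) + e / 2 * lln (2 ^ Suc k)
            \<le> C * (ln (real n) + ln 2) + e / 2 * ln (ln (real n) + ln 2)"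
        proof -
          have "real (2 ^ Suc k) \<le> real (2 * n)" using k(2) by (subst of_nat_le_iff) simp
          then have le: "ln (real (2 ^ Suc k)) \<le> ln (real (2 * n))"
            using elim(3) by (subst ln_le_cancel_iff) auto
          also have "ln (real (2 * n)) = ln (real n) + ln 2"
            using elim(3) by (simp add: ln_mult)
          finally have le: "ln (real (2 ^ Suc k)) \<le> ln (real n) + ln 2" .
          have pos: "0 < ln (real (2 ^ Suc k))"
            using one_less_power[of "2 :: real" "Suc k"] by (intro ln_gt_zero) simp
          then have "lln (2 ^ Suc k) \<le> ln (ln (real n) + ln 2)"
            using le by (subst ln_le_cancel_iff) linarith+
          then show ?thesis using le C e by (intro add_mono mult_left_mono) auto
        qed
        ultimately show False using gt elim(1) by linarith
      qed
    qed
  qed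
qed

text \<open>The lower tail exp (- c k^a) is summable along n = 2^k for every a > 0. As in the upper
  bound, half of e ln ln n is kept back to pay for the change C ln 2 between powers.\<close>

lemma AE_longest_lower:
  assumes e: "e > 0"
  shows "AE \<omega> in M. \<forall>\<^sub>F n in sequentially.
    level (1 / ln p - e) n \<le> real (longest n \<omega>)"
proof -
  define C where "C = - 2 / ln p"
  have C: "C > 0" using ln_p_neg by (simp add: C_def)
  \<comment> \<open>Makes (1 + a) / ln p at least D - e / 2 and keeps a below 1.\<close>
  define a where "a = min (e / 2 * (- ln p)) (1 / 2)"
  have a: "0 < a" "a < 1" using e ln_p_neg by (auto simp: a_def mult_pos_neg)
  define \<theta> where "\<theta> = (1 + a) / ln p"
  have \<theta>: "\<theta> < 0" "\<theta> \<ge> 1 / ln p - e / 2"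
  proof -
    show "\<theta> < 0" using a ln_p_neg by (simp add: \<theta>_def divide_pos_neg)
    have "a \<le> e / 2 * (- ln p)" by (simp add: a_def)
    then have "(1 + e / 2 * (- ln p)) / ln p \<le> \<theta>"
      unfolding \<theta>_def using ln_p_neg by (intro divide_right_mono_neg) auto
    moreover have "(1 + e / 2 * (- ln p)) / ln p = 1 / ln p - e / 2"
      using ln_p_neg by (simp add: add_divide_distrib diff_divide_distrib)
    ultimately show "\<theta> \<ge> 1 / ln p - e / 2" by simp
  qed
  have level: "ap_center p n + a * (1 / ln p) * l = C * ln (real n) + \<theta> * l" if "l = lln n" for n l
    using that by (simp add: ap_center_def \<theta>_def C_def add_divide_distrib algebra_simps)
  obtain c where c: "c > 0" "\<forall>\<^sub>F n in sequentially.
     prob (longest_lt n (C * ln (real n) + \<theta> * lln n))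
       \<le> 2 * exp (- c * ln (real n) powr a)"
    using prob_longest_less_asymp[OF a] unfolding level[OF refl] by blast
  let ?A = "\<lambda>k. longest_lt (2 ^ k) (C * ln (real (2 ^ k)) + \<theta> * lln (2 ^ k))"
  have large: "\<forall>\<^sub>F n in sequentially. C * ln (real n) + \<theta> * lln n \<ge> 2"
    using upper_level_large(1)[of \<theta>] upper_level_large(2) by eventually_elim (simp add: C_def)
  have "AE \<omega> in M. \<forall>\<^sub>F k in sequentially. \<omega> \<notin> ?A k"
  proof (rule AE_eventually_notin)
    have "\<forall>\<^sub>F n in sequentially. longest_lt n (C * ln (real n) + \<theta> * lln n) \<in> events"
      using large eventually_ge_at_top[of 1]
      by eventually_elim (intro real_longest_less_event, auto)
    then show "\<forall>\<^sub>F k in sequentially. ?A k \<in> events"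
      by (rule eventually_strict_mono_subseq[OF strict_mono_two_power])
    show "\<forall>\<^sub>F k in sequentially. prob (?A k) \<le> 2 * exp (- c * (real k * ln 2) powr a)"
      using eventually_strict_mono_subseq[OF strict_mono_two_power c(2)] by (simp add: ln_realpow)
    show "summable (\<lambda>k. 2 * exp (- c * (real k * ln 2) powr a))"
    proof (rule summable_comparison_test_bigo)
      show "summable (\<lambda>k. norm (real k powr (- 2)))" by (simp add: summable_real_powr_iff)
      show "(\<lambda>k. 2 * exp (- c * (real k * ln 2) powr a)) \<in> O(\<lambda>k. real k powr (- 2))"
        using c(1) a by real_asymp
    qed
  qed
  then show ?thesis
  proof (rule AE_mp, intro AE_I2 impI)
    fix \<omega> assume \<omega>: "\<omega> \<in> space M" "\<forall>\<^sub>F k in sequentially. \<omega> \<notin> ?A k"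
    have "\<forall>\<^sub>F k in sequentially. \<omega> \<notin> ?A k \<and> C * ln (real (2 ^ k)) + \<theta> * lln (2 ^ k) \<ge> 2 \<and> k \<ge> 1"
      using \<omega>(2) eventually_strict_mono_subseq[OF strict_mono_two_power large] eventually_ge_at_top[of 1]
      by eventually_elim blast
    note block = eventually_two_power_block[OF this]
    have "\<forall>\<^sub>F n in sequentially. C * ln 2 \<le> e / 2 * lln n" using e by real_asymp
    moreover have "\<forall>\<^sub>F n in sequentially. lln n \<ge> 0" by real_asymp
    ultimately show "\<forall>\<^sub>F n in sequentially. level (1 / ln p - e) n \<le> real (longest n \<omega>)"
      using block
    proof eventually_elim
      case (elim n)
      then obtain k where k: "\<omega> \<notin> ?A k" "C * ln (real (2 ^ k)) + \<theta> * lln (2 ^ k) \<ge> 2"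
        "2 ^ k \<le> n" "n < 2 ^ Suc k" "k \<ge> 1" by blast
      have ge: "C * ln (real (2 ^ k)) + \<theta> * lln (2 ^ k) \<le> real (longest (2 ^ k) \<omega>)"
        using k(1) \<omega>(1) by auto
      then have "2 \<le> longest (2 ^ k) \<omega>" using k(2) by linarith
      then have mono: "longest (2 ^ k) \<omega> \<le> longest n \<omega>" using k by (intro longest_mono) auto
      have n: "n \<ge> 1" using k(3) by (meson le_trans one_le_numeral one_le_power)
      have "real n \<le> real (2 ^ Suc k)" using k(4) by (simp only: of_nat_le_iff)
      then have "ln (real n) \<le> ln (real (2 ^ Suc k))" using n by (subst ln_le_cancel_iff) auto
      also have "\<dots> = ln (real (2 ^ k)) + ln 2" by (simp add: ln_mult)
      finally have l1: "ln (real n) - ln 2 \<le> ln (real (2 ^ k))" by simp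
      have "real (2 ^ k) \<le> real n" using k(3) by (simp only: of_nat_le_iff)
      then have "ln (real (2 ^ k)) \<le> ln (real n)" using n by (subst ln_le_cancel_iff) auto
      moreover have "0 < ln (real (2 ^ k))" using k(5) by (simp add: ln_realpow)
      ultimately have "lln (2 ^ k) \<le> lln n" by (subst ln_le_cancel_iff) linarith+
      then have l2: "\<theta> * lln n \<le> \<theta> * lln (2 ^ k)"
        using \<theta>(1) by (intro mult_left_mono_neg) auto
      have l3: "C * (ln (real n) - ln 2) \<le> C * ln (real (2 ^ k))" using l1 C by (intro mult_left_mono) auto
      have l4: "(1 / ln p - e / 2) * lln n \<le> \<theta> * lln n"
        using \<theta>(2) elim(2) by (intro mult_right_mono) auto
      have "(1 / ln p - e / 2) * lln n = (1 / ln p - e) * lln n + e / 2 * lln n"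
        by (simp add: algebra_simps)
      then have "C * ln (real n) + (1 / ln p - e) * lln n \<le> C * ln (real (2 ^ k)) + \<theta> * lln (2 ^ k)"
        using l2 l3 l4 elim(1) by (simp add: right_diff_distrib)
      also note ge
      also have "real (longest (2 ^ k) \<omega>) \<le> real (longest n \<omega>)" using mono by simp
      finally show ?case by (simp add: C_def)
    qed
  qed
qed

text \<open>Along 2^k these probabilities are bounded only by a multiple of k^(e ln p), which is not
  summable for small \<open>e\<close>. Along 2^(2^k) the logarithm of n itself is geometric, so the
  bounds form a geometric series. A sparse sequence is enough, since low values are wanted
  infinitely often only.\<close>

lemma AE_longest_frequently_low:
  assumes e: "e > 0"
  shows "AE \<omega> in M. \<exists>\<^sub>F n in sequentially.
    real (longest n \<omega>) \<le> level (1 / ln p + e) n"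
proof -
  define s where "s = (1 / ln p + e) * ln p - 1"
  have s: "s < 0" using e ln_p_neg by (simp add: s_def field_simps mult_pos_neg)
  obtain K where K: "K > 0" "\<forall>\<^sub>F n in sequentially.
     prob (longest_ge n (level (1 / ln p + e) n))
       \<le> K * ln (real n) powr s"
    using prob_longest_ge_asymp[of "1 / ln p + e"] unfolding s_def by blast
  define N :: "nat \<Rightarrow> nat" where "N k = 2 ^ (2 ^ k)" for k
  have N: "strict_mono N" unfolding N_def by (rule strict_monoI) simp
  have lnN: "ln (real (N k)) = 2 ^ k * ln 2" for k by (simp add: N_def ln_realpow)
  let ?A = "\<lambda>n. longest_ge n (level (1 / ln p + e) n)"
  have "AE \<omega> in M. \<forall>\<^sub>F k in sequentially. \<omega> \<notin> ?A (N k)"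
  proof (rule AE_eventually_notin)
    have "\<forall>\<^sub>F n in sequentially. ?A n \<in> events"
      using upper_level_large(1)[of "1 / ln p + e"] upper_level_large(2) eventually_ge_at_top[of 1]
      by eventually_elim (intro real_longest_ge_event, auto)
    then show "\<forall>\<^sub>F k in sequentially. ?A (N k) \<in> events"
      by (rule eventually_strict_mono_subseq[OF N])
    have "(2 ^ k * ln 2) powr s = ln 2 powr s * (2 powr s) ^ k" for k
      by (simp add: powr_mult powr_power powr_realpow[symmetric] powr_powr mult.commute)
    then show "\<forall>\<^sub>F k in sequentially. prob (?A (N k)) \<le> K * (ln 2 powr s * (2 powr s) ^ k)"
      using eventually_strict_mono_subseq[OF N K(2)] unfolding lnN by simp
    have "2 powr s < (1::real)" using s powr_less_mono[of s 0 2] by simp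
    then show "summable (\<lambda>k. K * (ln 2 powr s * (2 powr s) ^ k))"
      by (intro summable_mult summable_geometric) auto
  qed
  then show ?thesis
  proof (rule AE_mp, intro AE_I2 impI)
    fix \<omega> assume \<omega>: "\<omega> \<in> space M" "\<forall>\<^sub>F k in sequentially. \<omega> \<notin> ?A (N k)"
    show "\<exists>\<^sub>F n in sequentially. real (longest n \<omega>) \<le> level (1 / ln p + e) n"
      unfolding frequently_def
    proof
      assume "\<forall>\<^sub>F n in sequentially. \<not> real (longest n \<omega>) \<le> level (1 / ln p + e) n"
      then have "\<forall>\<^sub>F n in sequentially. \<omega> \<in> ?A n" by (rule eventually_mono) (use \<omega>(1) in auto)
      then have "\<forall>\<^sub>F k in sequentially. \<omega> \<in> ?A (N k)" by (rule eventually_strict_mono_subseq[OF N])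
      then have "\<forall>\<^sub>F k in sequentially. False" using \<omega>(2) by eventually_elim blast
      then show False by simp
    qed
  qed
qed

end

lemma ap_sites_le: "\<alpha> \<in> ap_idx n r \<Longrightarrow> ap_sites r \<alpha> \<subseteq> {..n}"
proof
  fix x assume \<alpha>: "\<alpha> \<in> ap_idx n r" and x: "x \<in> ap_sites r \<alpha>"
  obtain a s where as: "\<alpha> = (a, s)" by fastforce
  have le: "a + (r - 1) * s \<le> n" using \<alpha> by (simp add: as ap_idx_def)
  show "x \<in> {..n}"
  proof (cases "x \<in> ap_ones r \<alpha>")
    case True
    then obtain j where j: "j < r" "x = a + j * s" by (auto simp: as)
    have "j * s \<le> (r - 1) * s" using j(1) by (intro mult_le_mono1) simp
    then have "a + j * s \<le> n" using le by linarith
    then show ?thesis using j(2) by simp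
  next
    case False
    then have "x = a - s" using x by (auto simp: as ap_sites_def split: if_splits)
    then show ?thesis using le by simp
  qed
qed

section \<open>Lower and upper limits from eventual and frequent bounds\<close>

lemma ereal_le_liminfI:
  assumes "\<And>e. e > 0 \<Longrightarrow> \<forall>\<^sub>F n in sequentially. x - e \<le> X n"
  shows "ereal x \<le> liminf (\<lambda>n. ereal (X n))"
proof (rule ccontr)
  assume "\<not> ?thesis"
  then have "liminf (\<lambda>n. ereal (X n)) < ereal x" by (simp only: not_le)
  from ereal_dense2[OF this] obtain r where r: "liminf (\<lambda>n. ereal (X n)) < ereal r" "ereal r < ereal x"
    by blast
  have "ereal r \<le> liminf (\<lambda>n. ereal (X n))"
    using assms[of "x - r"] r(2) by (intro Liminf_bounded) simp
  then show False using r(1) by simp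
qed

lemma liminf_le_erealI:
  assumes "\<And>e. e > 0 \<Longrightarrow> \<exists>\<^sub>F n in sequentially. X n \<le> x + e"
  shows "liminf (\<lambda>n. ereal (X n)) \<le> ereal x"
proof (rule ccontr)
  assume "\<not> ?thesis"
  then have "ereal x < liminf (\<lambda>n. ereal (X n))" by (simp only: not_le)
  from ereal_dense2[OF this] obtain r where r: "ereal x < ereal r" "ereal r < liminf (\<lambda>n. ereal (X n))"
    by blast
  have "\<forall>\<^sub>F n in sequentially. \<not> X n \<le> r" using less_LiminfD[OF r(2)] by (simp add: not_le)
  moreover have "\<exists>\<^sub>F n in sequentially. X n \<le> r" using assms[of "r - x"] r(1) by simp
  ultimately show False by (simp add: frequently_def)
qed

lemma limsup_le_erealI:
  assumes "\<And>e. e > 0 \<Longrightarrow> \<forall>\<^sub>F n in sequentially. X n \<le> x + e"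
  shows "limsup (\<lambda>n. ereal (X n)) \<le> ereal x"
proof (rule ccontr)
  assume "\<not> ?thesis"
  then have "ereal x < limsup (\<lambda>n. ereal (X n))" by (simp only: not_le)
  from ereal_dense2[OF this] obtain r where r: "ereal x < ereal r" "ereal r < limsup (\<lambda>n. ereal (X n))"
    by blast
  have "limsup (\<lambda>n. ereal (X n)) \<le> ereal r"
    using assms[of "r - x"] r(1) by (intro Limsup_bounded) simp
  then show False using r(2) by simp
qed

lemma ereal_le_limsupI:
  assumes "\<And>e. e > 0 \<Longrightarrow> \<exists>\<^sub>F n in sequentially. x - e \<le> X n"
  shows "ereal x \<le> limsup (\<lambda>n. ereal (X n))"
proof (rule ccontr)
  assume "\<not> ?thesis"
  then have "limsup (\<lambda>n. ereal (X n)) < ereal x" by (simp only: not_le)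
  from ereal_dense2[OF this] obtain r where r: "limsup (\<lambda>n. ereal (X n)) < ereal r" "ereal r < ereal x"
    by blast
  have "\<forall>\<^sub>F n in sequentially. \<not> r \<le> X n" using Limsup_lessD[OF r(1)] by (simp add: not_le)
  moreover have "\<exists>\<^sub>F n in sequentially. r \<le> X n" using assms[of "x - r"] r(2) by simp
  ultimately show False by (simp add: frequently_def)
qed

lemma sum_inverse_unbounded:
  assumes "c > 0"
  shows "\<exists>j. B < (\<Sum>k=N..<N + j. c / real k)"
proof (rule ccontr)
  assume bounded: "\<not> ?thesis"
  have shift: "(\<Sum>k<j. c / real (k + N)) = (\<Sum>k=N..<N + j. c / real k)" for j
    using sum.shift_bounds_nat_ivl[of "\<lambda>k. c / real k" 0 N j] by (simp add: atLeast0LessThan add.commute)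
  have "summable (\<lambda>k. c / real (k + N))"
  proof (rule summableI_nonneg_bounded)
    show "0 \<le> c / real (k + N)" for k using assms by simp
    show "(\<Sum>k<j. c / real (k + N)) \<le> B" for j unfolding shift using bounded by (meson not_le)
  qed
  then have "summable (\<lambda>k. c / real k)" by (subst (asm) summable_iff_shift)
  then have "summable (\<lambda>k. inverse c * (c / real k))" by (rule summable_mult)
  then show False using not_summable_harmonic[where 'a = real] assms by (simp add: field_simps)
qed

section \<open>High values in independent blocks\<close>

context iid_ones
begin

text \<open>A second Borel-Cantelli argument by hand: block k has 2^k positions and succeeds with
  probability at least c' / k, so blocks N, ..., N + j - 1 all fail with probability at most exp of
  minus the harmonic sum. Success in block k is seen at n = 2^(k+1), where C ln (2^k) = C ln n - C
  ln 2; hence the constant in the statement.\<close>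

lemma AE_longest_frequently_high:
  "AE \<omega> in M. \<exists>\<^sub>F n in sequentially. - 2 / ln p * ln (real n) + 2 / ln p * ln 2 \<le> real (longest n \<omega>)"
proof -
  define C where "C = - 2 / ln p"
  have C: "C > 0" using ln_p_neg by (simp add: C_def)
  obtain c where c: "c > 0" "\<forall>\<^sub>F n in sequentially. \<forall>(M :: 'a measure) \<xi>. iid_ones M \<xi> p \<longrightarrow>
    measure M {\<omega> \<in> space M. - 2 / ln p * ln (real n) \<le> real (longest_ap (\<lambda>i. \<xi> i \<omega>) n)} \<ge> c / ln (real n)"
    using prob_longest_ge_lower[OF p_pos p_less_1] by blast
  define r where "r k = nat \<lceil>C * ln (real (2 ^ k))\<rceil>" for k :: nat
  \<comment> \<open>Failure of block k, expressed by starts of the shifted sequence: a progression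
    whose predecessor would fall at 2^k or earlier counts as having none, so \<open>Q k\<close>
    reads only positions inside the block.\<close>
  define Q where "Q k f \<longleftrightarrow> (\<forall>\<alpha>\<in>ap_idx (2 ^ k) (r k). \<not> ap_starts (r k) \<alpha> (\<lambda>i. f (i + 2 ^ k)))" for k :: nat and f
  have "\<forall>\<^sub>F n in sequentially. C * ln (real n) > 1" using C by real_asymp
  from eventually_strict_mono_subseq[OF strict_mono_two_power eventually_conj[OF this c(2)]]
  obtain N0 where N0: "\<And>k. k \<ge> N0 \<Longrightarrow> C * ln (real (2 ^ k)) > 1"
    "\<And>k (M :: 'a measure) \<xi>. k \<ge> N0 \<Longrightarrow> iid_ones M \<xi> p \<Longrightarrow>
    measure M {\<omega> \<in> space M. - 2 / ln p * ln (real (2 ^ k)) \<le> real (longest_ap (\<lambda>i. \<xi> i \<omega>) (2 ^ k))} \<ge> c / ln (real (2 ^ k))"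
    by (auto simp: eventually_sequentially)
  define c' where "c' = c / ln 2"
  have c': "c' > 0" using c(1) by (simp add: c'_def)
  have shifted: "{\<omega> \<in> space M. longest_ap (\<lambda>i. \<xi> (i + 2 ^ k) \<omega>) (2 ^ k) < r k} = evt (Q k)"
    and prob_Q: "prob (evt (Q k)) \<le> exp (- (c' / real k))" if k: "k \<ge> N0" for k
  proof -
    interpret S: iid_ones M "\<lambda>i. \<xi> (i + 2 ^ k)" p by (rule iid_ones_shift)
    have r2: "r k \<ge> 2" using N0(1)[OF k] unfolding r_def by linarith
    have "{\<omega> \<in> space M. S.longest (2 ^ k) \<omega> < r k}
        = S.evt (\<lambda>f. \<forall>\<alpha>\<in>ap_idx (2 ^ k) (r k). \<not> ap_starts (r k) \<alpha> f)"
      by (rule S.longest_less_eq_evt[OF _ r2]) simp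
    also have "\<dots> = evt (Q k)" unfolding S.evt_def evt_def Q_def ..
    finally show eq: "{\<omega> \<in> space M. longest_ap (\<lambda>i. \<xi> (i + 2 ^ k) \<omega>) (2 ^ k) < r k} = evt (Q k)"
      unfolding S.longest_def .
    have "c / ln (real (2 ^ k)) \<le> prob {\<omega> \<in> space M. C * ln (real (2 ^ k)) \<le> real (S.longest (2 ^ k) \<omega>)}"
      unfolding C_def S.longest_def by (rule N0(2)[OF k S.iid_ones_axioms])
    also have "\<dots> = 1 - prob {\<omega> \<in> space M. real (S.longest (2 ^ k) \<omega>) < C * ln (real (2 ^ k))}"
      using N0(1)[OF k] by (intro S.prob_real_longest_ge) auto
    also have "{\<omega> \<in> space M. real (S.longest (2 ^ k) \<omega>) < C * ln (real (2 ^ k))} = evt (Q k)"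
      unfolding eq[symmetric] real_less_iff_nat_ceiling r_def S.longest_def ..
    also have "c / ln (real (2 ^ k)) = c' / real k" by (simp add: c'_def ln_realpow mult.commute)
    finally have "prob (evt (Q k)) \<le> 1 - c' / real k" by linarith
    also have "\<dots> \<le> exp (- (c' / real k))" using exp_ge_add_one_self[of "- (c' / real k)"] by simp
    finally show "prob (evt (Q k)) \<le> exp (- (c' / real k))" .
  qed
  have dep: "depends_on (Q k) {2 ^ k<..2 ^ Suc k}" for k
    unfolding depends_on_def Q_def
  proof (intro allI impI ball_cong refl arg_cong[where f = Not])
    fix f g :: "nat \<Rightarrow> bool" and \<alpha>
    assume fg: "\<forall>i\<in>{2 ^ k<..2 ^ Suc k}. f i = g i" and \<alpha>: "\<alpha> \<in> ap_idx (2 ^ k) (r k)"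
    show "ap_starts (r k) \<alpha> (\<lambda>i. f (i + 2 ^ k)) = ap_starts (r k) \<alpha> (\<lambda>i. g (i + 2 ^ k))"
    proof (rule depends_onD[OF depends_on_ap_starts])
      fix i assume "i \<in> ap_sites (r k) \<alpha>"
      then have "1 \<le> i" "i \<le> 2 ^ k" using ap_sites_ge_1[OF \<alpha>] ap_sites_le[OF \<alpha>] by auto
      then show "f (i + 2 ^ k) = g (i + 2 ^ k)" by (intro fg[rule_format]) simp
    qed
  qed
  have joint_dep: "depends_on (\<lambda>f. \<forall>k\<in>{N..<N + j}. Q k f) {2 ^ N<..2 ^ (N + j)}" for N j
    unfolding depends_on_def
  proof (intro allI impI ball_cong refl)
    fix f g :: "nat \<Rightarrow> bool" and k
    assume fg: "\<forall>i\<in>{2 ^ N<..2 ^ (N + j)}. f i = g i" and k: "k \<in> {N..<N + j}"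
    show "Q k f = Q k g"
    proof (rule depends_onD[OF dep])
      fix i :: nat assume i: "i \<in> {2 ^ k<..2 ^ Suc k}"
      have "(2::nat) ^ N \<le> 2 ^ k" "(2::nat) ^ Suc k \<le> 2 ^ (N + j)"
        using k by (auto intro!: power_increasing simp del: power_Suc)
      moreover have "2 ^ k < i" "i \<le> 2 ^ Suc k" using i by (simp_all del: power_Suc)
      ultimately have "2 ^ N < i" "i \<le> 2 ^ (N + j)" by linarith+
      then show "f i = g i" by (intro fg[rule_format]) simp
    qed
  qed
  have joint_prob: "prob (evt (\<lambda>f. \<forall>k\<in>{N..<N + j}. Q k f)) \<le> exp (- (\<Sum>k=N..<N + j. c' / real k))"
    if N: "N \<ge> N0" for N j
  proof (induction j)
    case 0
    then show ?case by (simp add: evt_def prob_space)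
  next
    case (Suc j)
    have "evt (\<lambda>f. \<forall>k\<in>{N..<N + Suc j}. Q k f) = evt (\<lambda>f. (\<forall>k\<in>{N..<N + j}. Q k f) \<and> Q (N + j) f)"
      unfolding evt_def by (auto simp: less_Suc_eq)
    also have "prob \<dots> = prob (evt (\<lambda>f. \<forall>k\<in>{N..<N + j}. Q k f)) * prob (evt (Q (N + j)))"
      by (rule prob_evt_conj[OF joint_dep _ _ dep]) auto
    also have "\<dots> \<le> exp (- (\<Sum>k=N..<N + j. c' / real k)) * exp (- (c' / real (N + j)))"
      using Suc.IH prob_Q[of "N + j"] N by (intro mult_mono) auto
    also have "\<dots> = exp (- (\<Sum>k=N..<N + Suc j. c' / real k))"
      by (simp add: exp_add[symmetric])
    finally show ?case .
  qed
  have "AE \<omega> in M. \<exists>k\<ge>N. \<omega> \<notin> evt (Q k)" if N: "N \<ge> N0" for N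
  proof -
    define B where "B = (\<Inter>j. evt (\<lambda>f. \<forall>k\<in>{N..<N + j}. Q k f))"
    have ev: "evt (\<lambda>f. \<forall>k\<in>{N..<N + j}. Q k f) \<in> events" for j
      by (rule evt_events[OF joint_dep]) auto
    have B: "B \<in> events" unfolding B_def using ev by auto
    \<comment> \<open>A positive probability would stay below exp of minus every partial harmonic
      sum from N on, and these sums are unbounded.\<close>
    have "prob B = 0"
    proof (rule ccontr)
      assume "prob B \<noteq> 0"
      then have pos: "prob B > 0" by (simp add: zero_less_measure_iff)
      obtain j where j: "- ln (prob B) < (\<Sum>k=N..<N + j. c' / real k)"
        using sum_inverse_unbounded[OF c'] by blast
      have "prob B \<le> prob (evt (\<lambda>f. \<forall>k\<in>{N..<N + j}. Q k f))"
        using ev by (intro finite_measure_mono) (auto simp: B_def)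
      also have "\<dots> \<le> exp (- (\<Sum>k=N..<N + j. c' / real k))" by (rule joint_prob[OF N])
      also have "\<dots> < exp (ln (prob B))" using j by simp
      also have "\<dots> = prob B" using pos by simp
      finally show False by simp
    qed
    then have "AE \<omega> in M. \<omega> \<notin> B" using B prob_eq_0 by blast
    then show ?thesis
    proof (rule AE_mp, intro AE_I2 impI)
      fix \<omega> assume "\<omega> \<in> space M" "\<omega> \<notin> B"
      then show "\<exists>k\<ge>N. \<omega> \<notin> evt (Q k)" by (auto simp: B_def evt_def)
    qed
  qed
  from this[OF max.cobounded2]
  have "AE \<omega> in M. \<forall>N. \<exists>k\<ge>max N N0. \<omega> \<notin> evt (Q k)" unfolding AE_all_countable by (rule allI)
  then show ?thesis
  proof (rule AE_mp, intro AE_I2 impI)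
    fix \<omega> assume \<omega>: "\<omega> \<in> space M" "\<forall>N. \<exists>k\<ge>max N N0. \<omega> \<notin> evt (Q k)"
    show "\<exists>\<^sub>F n in sequentially. - 2 / ln p * ln (real n) + 2 / ln p * ln 2 \<le> real (longest n \<omega>)"
      unfolding frequently_sequentially
    proof
      fix N
      obtain k where k: "k \<ge> N" "k \<ge> N0" "\<omega> \<notin> evt (Q k)" using \<omega>(2) by (meson max.boundedE)
      have r2: "r k \<ge> 2" using N0(1)[OF k(2)] unfolding r_def by linarith
      have "r k \<le> longest_ap (\<lambda>i. \<xi> (i + 2 ^ k) \<omega>) (2 ^ k)"
        using k(3) \<omega>(1) unfolding shifted[OF k(2), symmetric] by auto
      then obtain a s where as: "(a, s) \<in> ap_idx (2 ^ k) (r k)" "\<forall>i\<in>ap_ones (r k) (a, s). \<xi> (i + 2 ^ k) \<omega> = 1"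
        using longest_ap_ge_iff[OF _ r2, of "2 ^ k" "\<lambda>i. \<xi> (i + 2 ^ k) \<omega>"] by fastforce
      have "(a + 2 ^ k, s) \<in> ap_idx (2 ^ Suc k) (r k)" using as(1) by (simp add: ap_idx_def)
      moreover have "\<forall>i\<in>ap_ones (r k) (a + 2 ^ k, s). \<xi> i \<omega> = 1"
        using as(2) by (auto simp: add.assoc add.commute[of "2 ^ k"])
      ultimately have "r k \<le> longest (2 ^ Suc k) \<omega>"
        using longest_ap_ge_iff[OF one_le_power r2, of 2 "\<lambda>i. \<xi> i \<omega>" "Suc k"] one_le_numeral
        unfolding longest_def by blast
      moreover have "C * ln (real (2 ^ k)) \<le> real (r k)" unfolding r_def by linarith
      ultimately have "C * ln (real (2 ^ k)) \<le> real (longest (2 ^ Suc k) \<omega>)" by linarith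
      moreover have "- 2 / ln p * ln (real (2 ^ Suc k)) + 2 / ln p * ln 2 = C * ln (real (2 ^ k))"
        by (simp add: C_def ln_mult ring_distribs)
      moreover have "N \<le> 2 ^ Suc k" using k(1) less_exp[of "Suc k"] by linarith
      ultimately show "\<exists>n\<ge>N. - 2 / ln p * ln (real n) + 2 / ln p * ln 2 \<le> real (longest n \<omega>)"
        by (intro exI[of _ "2 ^ Suc k"]) auto
    qed
  qed
qed

text \<open>Covers both averages: unit weights at N k = 2^k and weights 1 / k at N k = k. Lower
  deviations beyond ln ln / (i + 1) die out by \<open>AE_longest_lower\<close>. Upper ones recur,
  but with probability at most K (ln (N k))^(-\<kappa>), and \<open>sm\<close> makes their total
  weight relative to \<open>G\<close> finite. The last assumption is the claim with the longest
  length replaced by its typical value.\<close>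

lemma AE_weighted_average:
  fixes N :: "nat \<Rightarrow> nat" and w G a :: "nat \<Rightarrow> real"
  defines "l \<equiv> \<lambda>k. lln (N k)"
  assumes N: "strict_mono N" and w: "\<And>k. 0 \<le> w k"
    and lim: "filterlim G at_top sequentially"
    and mono: "\<And>m n. N1 \<le> m \<Longrightarrow> m \<le> n \<Longrightarrow> G m \<le> G n" and pos: "\<And>n. N1 \<le> n \<Longrightarrow> 0 < G n"
    and g: "(\<lambda>n. (\<Sum>k=1..n. w k * l k) / G n) \<longlonglongrightarrow> 1"
    and sm: "\<And>\<kappa>. \<kappa> > 0 \<Longrightarrow> summable (\<lambda>k. \<bar>w k * l k\<bar> / G k * ln (real (N k)) powr (- \<kappa>))"
    and a: "(\<lambda>n. ((\<Sum>k=1..n. w k * (1 / ln p * l k - 2 / ln p * ln (real (N k)))) + a n) / G n) \<longlonglongrightarrow> t"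
  shows "AE \<omega> in M. (\<lambda>n. ((\<Sum>k=1..n. w k * real (longest (N k) \<omega>)) + a n) / G n) \<longlonglongrightarrow> t"
proof -
  define D where "D = 1 / ln p"
  have D: "D < 0" using ln_p_neg by (simp add: D_def)
  define A where "A i k = longest_ge (N k) (- 2 / ln p * ln (real (N k)) + (D + 1 / real (Suc i)) * l k)"
    for i k
  have G: "\<forall>\<^sub>F k in sequentially. 0 < G k" using pos by (auto simp: eventually_sequentially)
  \<comment> \<open>1 - D is the distance between the typical coefficient D of ln ln and the
    coefficient 1, which \<open>AE_longest_upper\<close> never allows to be exceeded for large n. It
    bounds the cost of one exceptional level.\<close>
  have "AE \<omega> in M. summable (\<lambda>k. ((1 - D) * (\<bar>w k * l k\<bar> / G k)) * indicator (A i k) \<omega>)" for i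
  proof -
    obtain K where K: "K > 0" "\<forall>\<^sub>F n in sequentially.
     prob (longest_ge n (level (D + 1 / real (Suc i)) n))
       \<le> K * ln (real n) powr ((D + 1 / real (Suc i)) * ln p - 1)"
      using prob_longest_ge_asymp by blast
    define \<kappa> where "\<kappa> = - (1 / real (Suc i) * ln p)"
    have "1 / real (Suc i) * ln p < 0" using ln_p_neg by (intro mult_pos_neg) auto
    then have \<kappa>: "\<kappa> > 0" by (simp add: \<kappa>_def)
    have ex: "(D + 1 / real (Suc i)) * ln p - 1 = - \<kappa>"
      using ln_p_neg by (simp add: \<kappa>_def D_def distrib_right)
    show ?thesis
    proof (rule AE_summable_indicator_eventually)
      have "\<forall>\<^sub>F n in sequentially. longest_ge n (level (D + 1 / real (Suc i)) n) \<in> events"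
        using upper_level_large(1)[of "D + 1 / real (Suc i)"] upper_level_large(2) eventually_ge_at_top[of 1]
        by eventually_elim (intro real_longest_ge_event, auto)
      from eventually_strict_mono_subseq[OF N this]
      show "\<forall>\<^sub>F k in sequentially. A i k \<in> events" unfolding A_def l_def .
      show "\<forall>\<^sub>F k in sequentially. 0 \<le> (1 - D) * (\<bar>w k * l k\<bar> / G k)"
        using G by eventually_elim (use D in simp)
      from eventually_strict_mono_subseq[OF N K(2)]
      show "\<forall>\<^sub>F k in sequentially. prob (A i k) \<le> K * ln (real (N k)) powr (- \<kappa>)"
        unfolding A_def l_def ex .
      have "summable (\<lambda>k. ((1 - D) * K) * (\<bar>w k * l k\<bar> / G k * ln (real (N k)) powr (- \<kappa>)))"
        by (intro summable_mult sm \<kappa>)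
      then show "summable (\<lambda>k. (1 - D) * (\<bar>w k * l k\<bar> / G k) * (K * ln (real (N k)) powr (- \<kappa>)))"
        by (simp add: mult_ac)
    qed
  qed
  then have "AE \<omega> in M. \<forall>i. summable (\<lambda>k. ((1 - D) * (\<bar>w k * l k\<bar> / G k)) * indicator (A i k) \<omega>)"
    unfolding AE_all_countable by blast
  moreover have "AE \<omega> in M. \<forall>i. \<forall>\<^sub>F n in sequentially.
      level (D - 1 / real (Suc i)) n \<le> real (longest n \<omega>)"
    unfolding AE_all_countable D_def using AE_longest_lower by simp
  moreover have "AE \<omega> in M. \<forall>\<^sub>F n in sequentially.
      real (longest n \<omega>) \<le> - 2 / ln p * ln (real n) + 1 * lln n"
    by (rule AE_longest_upper) simp
  ultimately show ?thesis
    using AE_space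
  proof eventually_elim
    case (elim \<omega>)
    define d where "d k = real (longest (N k) \<omega>) + 2 / ln p * ln (real (N k)) - 1 / ln p * l k" for k
    have "(\<lambda>n. (\<Sum>k=1..n. w k * d k) / G n) \<longlonglongrightarrow> 0"
    proof (rule weighted_average_tendsto_0[OF lim mono pos g])
      show "0 \<le> (1 - D) * \<bar>w k * l k\<bar> * indicator (A i k) \<omega>" for i k
        using D by simp
      show "summable (\<lambda>k. (1 - D) * \<bar>w k * l k\<bar> * indicator (A i k) \<omega> / G k)" for i
        using elim(1) by simp
      fix i
      have l: "\<forall>\<^sub>F k in sequentially. 0 \<le> l k"
        unfolding l_def by (rule eventually_strict_mono_subseq[OF N]) real_asymp
      have lo: "\<forall>\<^sub>F k in sequentially. - 2 / ln p * ln (real (N k)) + (D - 1 / real (Suc i)) * l k \<le> real (longest (N k) \<omega>)"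
        unfolding l_def by (rule eventually_strict_mono_subseq[OF N]) (use elim(2) in blast)
      have up: "\<forall>\<^sub>F k in sequentially. real (longest (N k) \<omega>) \<le> - 2 / ln p * ln (real (N k)) + 1 * l k"
        unfolding l_def by (rule eventually_strict_mono_subseq[OF N elim(3)])
      show "\<forall>\<^sub>F k in sequentially. \<bar>w k * d k\<bar> \<le> 1 / real (Suc i) * (w k * l k) + (1 - D) * \<bar>w k * l k\<bar> * indicator (A i k) \<omega>"
        using l lo up
      proof eventually_elim
        case (elim k)
        have ge: "- (1 / real (Suc i) * l k) \<le> d k"
          using elim(2) by (simp add: d_def D_def[symmetric] left_diff_distrib)
        have le: "d k \<le> (1 - D) * l k"
          using elim(3) by (simp add: d_def D_def[symmetric] left_diff_distrib)
        have nonneg: "0 \<le> 1 / real (Suc i) * l k" "0 \<le> (1 - D) * l k" using elim(1) D by auto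
        have "\<bar>d k\<bar> \<le> 1 / real (Suc i) * l k + (1 - D) * l k * indicator (A i k) \<omega>"
        proof (cases "\<omega> \<in> A i k")
          case True
          then show ?thesis using ge le nonneg by simp
        next
          case False
          then have "real (longest (N k) \<omega>) < - 2 / ln p * ln (real (N k)) + (D + 1 / real (Suc i)) * l k"
            using \<open>\<omega> \<in> space M\<close> by (auto simp: A_def)
          then have "d k \<le> 1 / real (Suc i) * l k"
            by (simp add: d_def D_def[symmetric] distrib_right)
          then show ?thesis using ge False by simp
        qed
        then have "w k * \<bar>d k\<bar> \<le> w k * (1 / real (Suc i) * l k + (1 - D) * l k * indicator (A i k) \<omega>)"
          using w by (rule mult_left_mono)
        then show ?case using w[of k] elim(1) by (simp add: abs_mult algebra_simps)
      qed
    qed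
    from tendsto_add[OF this a] show ?case
      by (simp add: add_divide_distrib[symmetric] add.assoc[symmetric] sum.distrib[symmetric]
          distrib_left[symmetric] d_def)
  qed
qed


lemma AE_dyadic_average:
  "AE \<omega> in M. (\<lambda>n. 1 / (real n * ln (real n))
     * ((\<Sum>k=1..n. real (longest (2 ^ k) \<omega>)) + ln 2 / ln p * (real n)\<^sup>2)) \<longlonglongrightarrow> 1 / ln p"
proof -
  define G where "G n = real n * ln (real n)" for n :: nat
  have lim: "filterlim G at_top sequentially" unfolding G_def by real_asymp
  have inc: "\<forall>\<^sub>F n in sequentially. G n < G (Suc n)" unfolding G_def by real_asymp
  have mono: "G m \<le> G n" if "2 \<le> m" "m \<le> n" for m n
    unfolding G_def using that by (intro mult_mono) auto
  have pos: "0 < G n" if "2 \<le> n" for n using that by (simp add: G_def)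
  have lnN: "ln (real (2 ^ k)) = real k * ln 2" for k by (simp add: ln_realpow)
  have g: "(\<lambda>n. (\<Sum>k=1..n. 1 * lln (2 ^ k)) / G n) \<longlonglongrightarrow> 1"
  proof (rule stolz_cesaro[OF inc lim])
    show "(\<lambda>n. ((\<Sum>k=1..Suc n. 1 * lln (2 ^ k)) - (\<Sum>k=1..n. 1 * lln (2 ^ k))) / (G (Suc n) - G n)) \<longlonglongrightarrow> 1"
      unfolding G_def lnN by simp real_asymp
  qed
  \<comment> \<open>ln ln (2^k) and ln k have the same order and cancel, and ln (2^k) = k ln 2, so
    the terms have order k^(-1-\<kappa>).\<close>
  have sm: "summable (\<lambda>k. \<bar>1 * lln (2 ^ k)\<bar> / G k * ln (real (2 ^ k)) powr (- \<kappa>))" if "\<kappa> > 0" for \<kappa>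
  proof (rule summable_comparison_test_bigo)
    show "summable (\<lambda>k. norm (real k powr (- 1 - \<kappa>)))" using that by (simp add: summable_real_powr_iff)
    show "(\<lambda>k. \<bar>1 * lln (2 ^ k)\<bar> / G k * ln (real (2 ^ k)) powr (- \<kappa>)) \<in> O(\<lambda>k. real k powr (- 1 - \<kappa>))"
      unfolding G_def lnN using that by real_asymp
  qed
  \<comment> \<open>The leading terms add up to - (ln 2 / ln p) n (n + 1). The square cancels this
    up to a multiple of n, which is negligible against n ln n.\<close>
  have "(\<lambda>n. ((\<Sum>k=1..n. 1 * (1 / ln p * lln (2 ^ k) - 2 / ln p * ln (real (2 ^ k)))) + ln 2 / ln p * (real n)\<^sup>2) / G n) \<longlonglongrightarrow> 1 / ln p"
  proof (rule stolz_cesaro[OF inc lim])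
    show "(\<lambda>n. ((\<Sum>k=1..Suc n. 1 * (1 / ln p * lln (2 ^ k) - 2 / ln p * ln (real (2 ^ k)))) + ln 2 / ln p * (real (Suc n))\<^sup>2
        - ((\<Sum>k=1..n. 1 * (1 / ln p * lln (2 ^ k) - 2 / ln p * ln (real (2 ^ k)))) + ln 2 / ln p * (real n)\<^sup>2)) / (G (Suc n) - G n)) \<longlonglongrightarrow> 1 / ln p"
      unfolding G_def lnN using ln_p_neg by (simp, real_asymp, simp add: inverse_eq_divide)
  qed
  from AE_weighted_average[OF strict_mono_two_power _ lim mono pos g sm this] show ?thesis
    by (simp add: G_def)
qed

lemma AE_logarithmic_average:
  "AE \<omega> in M. (\<lambda>n. 1 / (ln (real n) * lln n)
     * ((\<Sum>k=1..n. real (longest k \<omega>) / real k) + 1 / ln p * (ln (real n))\<^sup>2)) \<longlonglongrightarrow> 1 / ln p"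
proof -
  define G where "G n = ln (real n) * lln n" for n :: nat
  have lim: "filterlim G at_top sequentially" unfolding G_def by real_asymp
  have inc: "\<forall>\<^sub>F n in sequentially. G n < G (Suc n)" unfolding G_def by real_asymp
  have "\<forall>\<^sub>F n in sequentially. ln (real n) > 0" "\<forall>\<^sub>F n in sequentially. lln n > 0" by real_asymp+
  from eventually_conj[OF this(1) eventually_conj[OF this(2) eventually_gt_at_top[of 0]]]
  obtain N1 where N1: "\<And>n. n \<ge> N1 \<Longrightarrow> 0 < ln (real n) \<and> 0 < lln n \<and> 0 < n"
    by (auto simp: eventually_sequentially)
  have mono: "G m \<le> G n" if "N1 \<le> m" "m \<le> n" for m n
  proof -
    have pos: "0 < ln (real m)" "0 < lln m" "0 < m" "0 < n" using N1[of m] N1[of n] that by auto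
    have le: "ln (real m) \<le> ln (real n)" using pos that by simp
    moreover have "lln m \<le> lln n" using pos le by (subst ln_le_cancel_iff) linarith+
    ultimately show ?thesis unfolding G_def using pos by (intro mult_mono) linarith+
  qed
  have pos: "0 < G n" if "N1 \<le> n" for n using N1[OF that] by (simp add: G_def)
  have g: "(\<lambda>n. (\<Sum>k=1..n. 1 / real k * lln k) / G n) \<longlonglongrightarrow> 1"
  proof (rule stolz_cesaro[OF inc lim])
    show "(\<lambda>n. ((\<Sum>k=1..Suc n. 1 / real k * lln k) - (\<Sum>k=1..n. 1 / real k * lln k)) / (G (Suc n) - G n)) \<longlonglongrightarrow> 1"
      unfolding G_def by simp real_asymp
  qed
  \<comment> \<open>ln ln k cancels against \<open>G\<close>; what remains is 1 / (k ln k), just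
    short of convergence, and any power ln^(-\<kappa>) suffices.\<close>
  have sm: "summable (\<lambda>k. \<bar>1 / real k * lln k\<bar> / G k * ln (real k) powr (- \<kappa>))" if "\<kappa> > 0" for \<kappa>
  proof (rule summable_cong[THEN iffD2, OF _ summable_inverse_mult_ln_powr[OF that]])
    have "\<forall>\<^sub>F k in sequentially. lln k > 0" by real_asymp
    then show "\<forall>\<^sub>F k in sequentially. \<bar>1 / real k * lln k\<bar> / G k * ln (real k) powr (- \<kappa>)
        = 1 / (real k * ln (real k)) * ln (real k) powr (- \<kappa>)"
      by eventually_elim (simp add: G_def abs_mult)
  qed
  \<comment> \<open>The sum of - 2 ln k / (k ln p) is - ln^2 n / ln p up to a bounded term, so the
    added square of the logarithm cancels it.\<close>
  have "(\<lambda>n. ((\<Sum>k=1..n. 1 / real k * (1 / ln p * lln k - 2 / ln p * ln (real k))) + 1 / ln p * (ln (real n))\<^sup>2) / G n) \<longlonglongrightarrow> 1 / ln p"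
  proof (rule stolz_cesaro[OF inc lim])
    show "(\<lambda>n. ((\<Sum>k=1..Suc n. 1 / real k * (1 / ln p * lln k - 2 / ln p * ln (real k))) + 1 / ln p * (ln (real (Suc n)))\<^sup>2
        - ((\<Sum>k=1..n. 1 / real k * (1 / ln p * lln k - 2 / ln p * ln (real k))) + 1 / ln p * (ln (real n))\<^sup>2)) / (G (Suc n) - G n)) \<longlonglongrightarrow> 1 / ln p"
      unfolding G_def using ln_p_neg by (simp, real_asymp, simp add: inverse_eq_divide)
  qed
  from AE_weighted_average[of "\<lambda>k. k", OF _ _ lim mono pos g sm this] show ?thesis
    by (simp add: G_def strict_mono_def)
qed

section \<open>Lower and upper limit\<close>

lemma AE_liminf_limsup:
  defines "X \<equiv> \<lambda>n \<omega>. (real (longest n \<omega>) - (- 2 / ln p) * ln (real n)) / lln n"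
  shows "AE \<omega> in M. liminf (\<lambda>n. ereal (X n \<omega>)) = ereal (1 / ln p) \<and> limsup (\<lambda>n. ereal (X n \<omega>)) = 0"
proof -
  define D where "D = 1 / ln p"
  have "AE \<omega> in M. \<forall>i. \<forall>\<^sub>F n in sequentially.
      real (longest n \<omega>) \<le> level (1 / real (Suc i)) n"
    unfolding AE_all_countable by (intro allI AE_longest_upper) simp
  moreover have "AE \<omega> in M. \<forall>i. \<forall>\<^sub>F n in sequentially.
      level (D - 1 / real (Suc i)) n \<le> real (longest n \<omega>)"
    unfolding AE_all_countable D_def by (intro allI AE_longest_lower) simp
  moreover have "AE \<omega> in M. \<forall>i. \<exists>\<^sub>F n in sequentially.
      real (longest n \<omega>) \<le> level (D + 1 / real (Suc i)) n"
    unfolding AE_all_countable D_def by (intro allI AE_longest_frequently_low) simp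
  ultimately show ?thesis
    using AE_longest_frequently_high
  proof eventually_elim
    case (elim \<omega>)
    have l: "\<forall>\<^sub>F n in sequentially. lln n > 0" by real_asymp
    have le: "X n \<omega> \<le> t" if "lln n > 0" "real (longest n \<omega>) \<le> level t n" for n t
      unfolding X_def using that by (simp add: pos_divide_le_eq)
    have ge: "t \<le> X n \<omega>" if "lln n > 0" "level t n \<le> real (longest n \<omega>)" for n t
      unfolding X_def using that by (simp add: pos_le_divide_eq)
    have small: "\<exists>i. 1 / real (Suc i) < e" if "e > 0" for e :: real
      using nat_approx_posE[OF that] by auto
    have "ereal D \<le> liminf (\<lambda>n. ereal (X n \<omega>))"
    proof (rule ereal_le_liminfI)
      fix e :: real assume "e > 0"
      then obtain i where i: "1 / real (Suc i) < e" using small by blast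
      show "\<forall>\<^sub>F n in sequentially. D - e \<le> X n \<omega>"
        using elim(2)[rule_format, of i] l
      proof eventually_elim
        case (elim n)
        from ge[OF elim(2,1)] i show ?case by linarith
      qed
    qed
    moreover have "liminf (\<lambda>n. ereal (X n \<omega>)) \<le> ereal D"
    proof (rule liminf_le_erealI)
      fix e :: real assume "e > 0"
      then obtain i where i: "1 / real (Suc i) < e" using small by blast
      have "\<forall>\<^sub>F n in sequentially. real (longest n \<omega>) \<le> level (D + 1 / real (Suc i)) n
          \<longrightarrow> X n \<omega> \<le> D + e"
        using l
      proof eventually_elim
        case (elim n)
        from le[OF elim(1), of "D + 1 / real (Suc i)"] i show ?case by linarith
      qed
      from frequently_mp[OF this elim(3)[rule_format, of i]]
      show "\<exists>\<^sub>F n in sequentially. X n \<omega> \<le> D + e" .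
    qed
    moreover have "limsup (\<lambda>n. ereal (X n \<omega>)) \<le> ereal 0"
    proof (rule limsup_le_erealI)
      fix e :: real assume "e > 0"
      then obtain i where i: "1 / real (Suc i) < e" using small by blast
      show "\<forall>\<^sub>F n in sequentially. X n \<omega> \<le> 0 + e"
        using elim(1)[rule_format, of i] l
      proof eventually_elim
        case (elim n)
        from le[OF elim(2,1)] i show ?case by linarith
      qed
    qed
    moreover have "ereal 0 \<le> limsup (\<lambda>n. ereal (X n \<omega>))"
    \<comment> \<open>The additive constant in \<open>AE_longest_frequently_high\<close> disappears
      after division by ln ln n.\<close>
    proof (rule ereal_le_limsupI)
      fix e :: real assume e: "e > 0"
      have "\<forall>\<^sub>F n in sequentially. - 2 / ln p * ln 2 \<le> e * lln n" using e by real_asymp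
      then have "\<forall>\<^sub>F n in sequentially. - 2 / ln p * ln (real n) + 2 / ln p * ln 2 \<le> real (longest n \<omega>) \<longrightarrow> 0 - e \<le> X n \<omega>"
        using l
      proof eventually_elim
        case (elim n)
        show ?case
        proof
          assume "- 2 / ln p * ln (real n) + 2 / ln p * ln 2 \<le> real (longest n \<omega>)"
          then show "0 - e \<le> X n \<omega>" using elim(1) by (intro ge elim(2)) simp
        qed
      qed
      from frequently_mp[OF this elim(4)] show "\<exists>\<^sub>F n in sequentially. 0 - e \<le> X n \<omega>" .
    qed
    ultimately show ?case unfolding D_def zero_ereal_def by (auto intro: antisym)
  qed
qed

end

theorem theorem1p1:
  fixes M :: "'a measure"
    and \<xi> :: "nat \<Rightarrow> 'a \<Rightarrow> real"
    and p q C D :: real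
    and U :: "nat \<Rightarrow> 'a \<Rightarrow> nat"
    and h :: "nat \<Rightarrow> real"
  assumes M: "prob_space M"
    and p: "0 < p" "p < 1"
    and indep: "prob_space.indep_vars M (\<lambda>_. borel) \<xi> {1..}"
    and distr: "\<And>i. i \<ge> 1 \<Longrightarrow> measure M {\<omega> \<in> space M. \<xi> i \<omega> = 1} = p"
               "\<And>i. i \<ge> 1 \<Longrightarrow> measure M {\<omega> \<in> space M. \<xi> i \<omega> = 0} = 1 - p"
    and q: "q = 1 - p"
    and C: "C = - 2 / ln p"
    and D: "D = 1 / ln p"
    and U: "U = (\<lambda>n \<omega>. longest_ap (\<lambda>i. \<xi> i \<omega>) n)"
    and h: "h = (\<lambda>n. C * ln (real n) + D * ln (ln (real n)))"
  shows
    "(\<exists>K::real. \<forall>\<^sub>F n in sequentially.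
        Max ((\<lambda>r::nat. \<bar>measure M {\<omega> \<in> space M. U n \<omega> < r} - exp (- lam p n r)\<bar>) ` {1<..n})
          \<le> K * ((ln (real n)) ^ 4 * ln (ln (real n)) / real n))
   \<and> (\<forall>a::real. a < 1 \<longrightarrow>
        (\<exists>K::real. \<forall>\<^sub>F n in sequentially.
          \<forall>x::real. x \<ge> a * D * ln (ln (real n)) \<and> h n + x \<in> \<int> \<longrightarrow>
            \<bar>exp (- q * ln p / 4 * p powr x)
               * measure M {\<omega> \<in> space M. real (U n \<omega>) < h n + x} - 1\<bar>
            \<le> K * (ln (ln (real n)) / ln (real n) powr (1 - a))))
   \<and> tendsto_in_prob M (\<lambda>n \<omega>. (real (U n \<omega>) - C * ln (real n)) / ln (ln (real n))) D
   \<and> (AE \<omega> in M.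
        ereal D = liminf (\<lambda>n. ereal ((real (U n \<omega>) - C * ln (real n)) / ln (ln (real n))))
      \<and> liminf (\<lambda>n. ereal ((real (U n \<omega>) - C * ln (real n)) / ln (ln (real n))))
          < limsup (\<lambda>n. ereal ((real (U n \<omega>) - C * ln (real n)) / ln (ln (real n))))
      \<and> limsup (\<lambda>n. ereal ((real (U n \<omega>) - C * ln (real n)) / ln (ln (real n)))) = 0
      \<and> (\<lambda>n. 1 / (real n * ln (real n))
              * ((\<Sum>k=1..n. real (U (2 ^ k) \<omega>)) + ln 2 / ln p * (real n)\<^sup>2)) \<longlonglongrightarrow> D
      \<and> (\<lambda>n. 1 / (ln (real n) * ln (ln (real n)))
              * ((\<Sum>k=1..n. real (U k \<omega>) / real k) + D * (ln (real n))\<^sup>2)) \<longlonglongrightarrow> D)"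
proof -
  interpret prob_space M by (rule M)
  interpret iid_ones M \<xi> p
    by unfold_locales (use p indep distr(1) in auto)
  have U_eq: "U n \<omega> = longest n \<omega>" for n \<omega> by (simp add: U longest_def)
  have center: "h n = ap_center p n" for n by (simp add: h C D ap_center_def)
  show ?thesis
  proof (intro conjI allI impI)
    show "\<exists>K. \<forall>\<^sub>F n in sequentially.
        Max ((\<lambda>r. \<bar>measure M {\<omega> \<in> space M. U n \<omega> < r} - exp (- lam p n r)\<bar>) ` {1<..n})
          \<le> K * ((ln (real n)) ^ 4 * ln (ln (real n)) / real n)"
      using Max_below_sub_exp unfolding below_eq U_eq .
  next
    fix a :: real assume a: "a < 1"
    obtain K where "\<forall>\<^sub>F n in sequentially. \<forall>(M :: 'a measure) \<xi> x. iid_ones M \<xi> p \<longrightarrow>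
      x \<ge> a * (1 / ln p) * ln (ln (real n)) \<and> ap_center p n + x \<in> \<int> \<longrightarrow>
      \<bar>exp (- (1 - p) * ln p / 4 * p powr x)
         * measure M {\<omega> \<in> space M. real (longest_ap (\<lambda>i. \<xi> i \<omega>) n) < ap_center p n + x} - 1\<bar>
      \<le> K * (ln (ln (real n)) / ln (real n) powr (1 - a))"
      using below_center_asymp[OF p a] by blast
    then have "\<forall>\<^sub>F n in sequentially.
          \<forall>x::real. x \<ge> a * D * ln (ln (real n)) \<and> h n + x \<in> \<int> \<longrightarrow>
            \<bar>exp (- q * ln p / 4 * p powr x)
               * measure M {\<omega> \<in> space M. real (U n \<omega>) < h n + x} - 1\<bar>
            \<le> K * (ln (ln (real n)) / ln (real n) powr (1 - a))"
      by (rule eventually_mono) (use iid_ones_axioms in \<open>simp add: U center D q\<close>)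
    then show "\<exists>K. \<forall>\<^sub>F n in sequentially.
          \<forall>x::real. x \<ge> a * D * ln (ln (real n)) \<and> h n + x \<in> \<int> \<longrightarrow>
            \<bar>exp (- q * ln p / 4 * p powr x)
               * measure M {\<omega> \<in> space M. real (U n \<omega>) < h n + x} - 1\<bar>
            \<le> K * (ln (ln (real n)) / ln (real n) powr (1 - a))" by blast
  next
    show "tendsto_in_prob M (\<lambda>n \<omega>. (real (U n \<omega>) - C * ln (real n)) / ln (ln (real n))) D"
      using longest_tendsto_in_prob unfolding U_eq C D .
  next
    \<comment> \<open>The negativity of D is what separates the lower limit D strictly from the
      upper limit 0.\<close>
    have neg: "1 / ln p < 0" using ln_p_neg by simp
    from AE_liminf_limsup AE_dyadic_average AE_logarithmic_average
    show "AE \<omega> in M.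
        ereal D = liminf (\<lambda>n. ereal ((real (U n \<omega>) - C * ln (real n)) / ln (ln (real n))))
      \<and> liminf (\<lambda>n. ereal ((real (U n \<omega>) - C * ln (real n)) / ln (ln (real n))))
          < limsup (\<lambda>n. ereal ((real (U n \<omega>) - C * ln (real n)) / ln (ln (real n))))
      \<and> limsup (\<lambda>n. ereal ((real (U n \<omega>) - C * ln (real n)) / ln (ln (real n)))) = 0
      \<and> (\<lambda>n. 1 / (real n * ln (real n))
              * ((\<Sum>k=1..n. real (U (2 ^ k) \<omega>)) + ln 2 / ln p * (real n)\<^sup>2)) \<longlonglongrightarrow> D
      \<and> (\<lambda>n. 1 / (ln (real n) * ln (ln (real n)))
              * ((\<Sum>k=1..n. real (U k \<omega>) / real k) + D * (ln (real n))\<^sup>2)) \<longlonglongrightarrow> D"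
      unfolding U_eq C D
    proof eventually_elim
      case (elim \<omega>)
      show ?case
        unfolding elim(1)[THEN conjunct1] elim(1)[THEN conjunct2]
        by (intro conjI refl elim(2,3)) (use neg in \<open>simp add: zero_ereal_def\<close>)
    qed
  qed
qed

end
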